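(* Let $\alpha,\beta\in(-\tfrac12,\tfrac12)$ satisfy $\alpha_-+\beta_+<\tfrac12$. For each $n$ let $\xi_n\sim N(0,T_n(g_\beta))$ (all defined on one probability space). Then \[ \lim_{n\to\infty} n^{-1}\langle \xi_n, T_n(g_\alpha)^{-1}\xi_n\rangle=\frac1{2\pi}\int_{-\pi}^{\pi}\frac{g_\beta(t)}{g_\alpha(t)}\,dt\quad\text{almost surely.} \]
   Context: For $H\in(0,1)$ let $f_H(\lambda)=C_H|e^{i\lambda}-1|^2\sum_{k\in\mathbb Z}|\lambda-2\pi k|^{-(2H+1)}$, $\lambda\in[-\pi,\pi)$, where $C_H>0$ is the normalizing constant making $f_H$ the spectral density of fractional Gaussian noise, i.e. $\frac1{2\pi}\int_{-\pi}^{\pi}e^{-imt}f_H(t)\,dt=\mathrm{Cov}(Z_{m+1}-Z_m,Z_1-Z_0)$ for a fractional Brownian motion $Z$ with $\mathrm{Var}\,Z_t=|t|^{2H}$. For $\alpha\in(-\frac12,\frac12)$ put $g_\alpha:=f_{1/2+\alpha}$. For integrable $g$ on $[-\pi,\pi)$ write $\hat g(m)=\frac1{2\pi}\int_{-\pi}^{\pi}e^{-imt}g(t)\,dt$ and $T_n(g)=(\hat g(j-k))_{j,k=1}^n$ (Toeplitz matrix). $x_+=\max(x,0)$, $x_-=\max(-x,0)$. *)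

theory Defs
  imports "HOL-Probability.Probability" "Jordan_Normal_Form.Gauss_Jordan_Elimination"
begin

(* unnormalised spectral density of fGn:  |e^{i l}-1|^2 * sum_{k in Z} |l - 2 pi k|^{-(2H+1)} *)
definition fgn_raw :: "real \<Rightarrow> real \<Rightarrow> real" where
  "fgn_raw H l = (cmod (cis l - 1))\<^sup>2 *
     (\<Sum>\<^sub>\<infinity>k::int. \<bar>l - 2 * pi * real_of_int k\<bar> powr (-(2 * H + 1)))"

definition fourier_coeff :: "(real \<Rightarrow> real) \<Rightarrow> int \<Rightarrow> complex" where
  "fourier_coeff g m = complex_of_real (1 / (2 * pi)) *
     set_lebesgue_integral lborel {-pi..<pi} (\<lambda>t. cis (- real_of_int m * t) * complex_of_real (g t))"

(* covariance of fBm Z with Var Z_t = |t|^{2H}, and of its unit increments *)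
definition fbm_cov :: "real \<Rightarrow> real \<Rightarrow> real \<Rightarrow> real" where
  "fbm_cov H s t = (\<bar>s\<bar> powr (2*H) + \<bar>t\<bar> powr (2*H) - \<bar>s - t\<bar> powr (2*H)) / 2"

definition fgn_cov :: "real \<Rightarrow> int \<Rightarrow> real" where
  "fgn_cov H m = fbm_cov H (real_of_int m + 1) 1 - fbm_cov H (real_of_int m + 1) 0
                 - fbm_cov H (real_of_int m) 1 + fbm_cov H (real_of_int m) 0"
  (* = Cov(Z_{m+1} - Z_m, Z_1 - Z_0) by bilinearity *)

definition fgn_const :: "real \<Rightarrow> real" where
  "fgn_const H = (THE c. c > 0 \<and>
     (\<forall>m. fourier_coeff (\<lambda>t. c * fgn_raw H t) m = complex_of_real (fgn_cov H m)))"

definition fgn_density :: "real \<Rightarrow> real \<Rightarrow> real" where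
  "fgn_density H l = fgn_const H * fgn_raw H l"

definition g_dens :: "real \<Rightarrow> real \<Rightarrow> real" where
  "g_dens a = fgn_density (1/2 + a)"

definition toeplitz :: "nat \<Rightarrow> (real \<Rightarrow> real) \<Rightarrow> complex mat" where
  "toeplitz n g = mat n n (\<lambda>(j,k). fourier_coeff g (int j - int k))"

definition mat_inv :: "complex mat \<Rightarrow> complex mat" where
  "mat_inv A = the (mat_inverse A)"

definition centered_gaussian :: "'a measure \<Rightarrow> nat \<Rightarrow> ('a \<Rightarrow> nat \<Rightarrow> real) \<Rightarrow> complex mat \<Rightarrow> bool" where
  "centered_gaussian M n X S \<longleftrightarrow>
     (\<forall>i<n. (\<lambda>\<omega>. X \<omega> i) \<in> borel_measurable M) \<and>
     (\<forall>c::nat \<Rightarrow> real.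
        (CLINT \<omega>|M. cis (\<Sum>i<n. c i * X \<omega> i)) =
        exp (- (1/2) * (\<Sum>i<n. \<Sum>j<n. complex_of_real (c i * c j) * S $$ (i,j))))"

definition quad_inv :: "nat \<Rightarrow> complex mat \<Rightarrow> (nat \<Rightarrow> real) \<Rightarrow> complex" where
  "quad_inv n A x = (let v = vec n (\<lambda>i. complex_of_real (x i)) in v \<bullet> (mat_inv A *\<^sub>v v))"

end

theory Submission
  imports Defs "Jordan_Normal_Form.Determinant"
begin

text \<open>
  Write \<open>f, h\<close> for the spectral densities with parameters \<open>\<alpha>, \<beta>\<close>. Near \<open>0\<close> they behave like
  \<open>\<bar>t\<bar> powr (- 2 * \<alpha>)\<close> and \<open>\<bar>t\<bar> powr (- 2 * \<beta>)\<close>, so \<open>1 / f\<close> and \<open>h\<close> are dominated by \<open>\<bar>t\<bar> powr (- a)\<close>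
  and \<open>\<bar>t\<bar> powr (- b)\<close> with \<open>a = 2 * \<alpha>\<^sub>-\<close>, \<open>b = 2 * \<beta>\<^sub>+\<close>, and the hypothesis says \<open>a + b < 1\<close>.

  A basis that is orthonormal for \<open>T\<^sub>n(f)\<close> and orthogonal for \<open>T\<^sub>n(h)\<close> turns the quadratic form into a
  sum of squares of independent centred Gaussians with variances \<open>\<mu>\<^sub>i\<close>, the eigenvalues of
  \<open>T\<^sub>n(f)\<^sup>-\<^sup>1 T\<^sub>n(h)\<close>. Let \<open>K\<^sub>n(t)\<close> be the Christoffel function \<open>e\<^sub>t\<^sup>* T\<^sub>n(f)\<^sup>-\<^sup>1 e\<^sub>t\<close>, where \<open>e\<^sub>t\<close> is the vector of
  exponentials. By Cauchy--Schwarz and duality, \<open>1 / \<sigma>\<^sub>n(f) \<le> K\<^sub>n / n \<le> \<sigma>\<^sub>n(1 / f)\<close> with Fejer means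
  \<open>\<sigma>\<^sub>n\<close>, and both bounds tend to \<open>1 / f\<close>. Since \<open>\<sigma>\<^sub>n(1 / f) \<le> C \<bar>t\<bar> powr (- a)\<close>, dominated convergence
  gives the limit of the normalised trace \<open>(\<Sum> \<mu>\<^sub>i) / n\<close>, which is the mean of \<open>h * K\<^sub>n / n\<close>.
  The same bounds give \<open>\<mu>\<^sub>i \<le> C n powr (a + b)\<close>, so Chernoff bounds show that deviations of the form
  from its trace by \<open>\<delta> n\<close> have probability at most \<open>2 exp (- c n powr (1 - a - b))\<close>, and
  Borel--Cantelli applies whatever the joint law of the \<open>\<xi>\<^sub>n\<close> is.
\<close>

section \<open>Simultaneous diagonalisation of quadratic forms\<close>

text \<open>Nothing links the vectors \<open>\<xi> n\<close> for different \<open>n\<close>, so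
  almost sure convergence has to come from summable probabilities. Chebyshev is too weak: the
  variance \<open>2 * (\<Sum>i<n. (\<mu> i)\<^sup>2)\<close> is controlled by the largest eigenvalue
  times the trace, of order \<open>n powr (1 + a + b)\<close>, and this gives deviation
  probabilities of order \<open>n powr (a + b - 1)\<close>. With exponential bounds it suffices that
  the eigenvalues are of smaller order than \<open>n\<close>. Gaussianity is given through
  characteristic functions. The law of the vector is never identified; averaging over auxiliary
  Gaussian dual variables turns information on linear functionals into information on squares.
  \<open>fgn_const\<close> is a definite description, about which nothing is known before existence
  and uniqueness are proved. Unfolding the integral over a period to the whole line turns the
  Fourier coefficients into combinations of Levy integrals, which represent
  \<open>\<bar>x\<bar> powr (2 * H)\<close>. The densities are even, so the Toeplitz matrices are
  real symmetric and the algebra can be done with real bilinear forms.\<close>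

definition dotp :: "nat \<Rightarrow> (nat \<Rightarrow> real) \<Rightarrow> (nat \<Rightarrow> real) \<Rightarrow> real" where
  "dotp n x y = (\<Sum>k<n. x k * y k)"

text \<open>Vectors and matrices are functions read only below \<open>n\<close>: orthonormal
  families then form a subset of a product space, where Tychonoff's theorem supplies
  compactness.\<close>

definition bform :: "nat \<Rightarrow> (nat \<Rightarrow> nat \<Rightarrow> real) \<Rightarrow> (nat \<Rightarrow> real) \<Rightarrow> (nat \<Rightarrow> real) \<Rightarrow> real" where
  "bform n S x y = (\<Sum>k<n. \<Sum>l<n. x k * S k l * y l)"

lemma dotp_lin:
  "dotp n (\<lambda>k. a * x k + b * y k) z = a * dotp n x z + b * dotp n y z"
  "dotp n z (\<lambda>k. a * x k + b * y k) = a * dotp n z x + b * dotp n z y"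
  by (simp_all add: dotp_def sum.distrib sum_distrib_left algebra_simps)

lemma bform_lin:
  "bform n S (\<lambda>k. a * x k + b * y k) z = a * bform n S x z + b * bform n S y z"
  "bform n S z (\<lambda>k. a * x k + b * y k) = a * bform n S z x + b * bform n S z y"
  by (simp_all add: bform_def sum.distrib sum_distrib_left algebra_simps)

lemma bform_comm:
  assumes "\<And>k l. k < n \<Longrightarrow> l < n \<Longrightarrow> S k l = S l k"
  shows "bform n S x y = bform n S y x"
proof -
  have "bform n S x y = (\<Sum>k<n. \<Sum>l<n. y l * S l k * x k)"
    unfolding bform_def by (intro sum.cong refl) (use assms in auto)
  also have "\<dots> = bform n S y x"
    unfolding bform_def by (rule sum.swap)
  finally show ?thesis .
qed

section \<open>Orthonormal eigenbases by maximisation\<close>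

lemma compact_Pi_UNIV:
  fixes S :: "'i \<Rightarrow> 'a::topological_space set"
  assumes "\<And>i. compact (S i)"
  shows "compact (Pi UNIV S)"
proof -
  have "compactin (product_topology (\<lambda>i. euclidean) UNIV) (PiE UNIV S)"
    unfolding compactin_PiE using assms by auto
  then show ?thesis
    by (simp add: euclidean_product_topology PiE_UNIV_domain)
qed

text \<open>The bounds inside the \<open>n\<close> by \<open>n\<close> block follow from normality.
  They are stated, together with the value 0 outside, to place the set inside a product of compact
  sets.\<close>

definition orthonormal_families :: "nat \<Rightarrow> (nat \<Rightarrow> nat \<Rightarrow> real) set" where
  "orthonormal_families n =
     {u. (\<forall>i k. u i k \<in> (if i < n \<and> k < n then {-1..1} else {0})) \<and>
         (\<forall>i<n. \<forall>j<n. dotp n (u i) (u j) = (if i = j then 1 else 0))}"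

lemma continuous_on_entry: "continuous_on A (\<lambda>u::nat \<Rightarrow> nat \<Rightarrow> real. u i k)"
proof -
  have "continuous_on UNIV ((\<lambda>v. v k) \<circ> (\<lambda>u::nat \<Rightarrow> nat \<Rightarrow> real. u i))"
    by (intro continuous_on_compose continuous_on_product_coordinates
        continuous_on_subset[OF continuous_on_product_coordinates]) auto
  then show ?thesis
    by (auto simp: o_def intro: continuous_on_subset)
qed

lemma compact_orthonormal_families: "compact (orthonormal_families n)"
proof -
  let ?K = "Pi UNIV (\<lambda>i. Pi UNIV (\<lambda>k. if i < n \<and> k < n then {-1..1::real} else {0}))"
  let ?C = "{u::nat \<Rightarrow> nat \<Rightarrow> real. \<forall>i j. i < n \<longrightarrow> j < n \<longrightarrow> dotp n (u i) (u j) = (if i = j then 1 else 0)}"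
  have "closed ?C"
  proof (intro closed_Collect_all)
    fix i j
    show "closed {u::nat \<Rightarrow> nat \<Rightarrow> real. i < n \<longrightarrow> j < n \<longrightarrow> dotp n (u i) (u j) = (if i = j then 1 else 0)}"
      by (intro closed_Collect_imp open_Collect_const closed_Collect_eq)
         (auto simp: dotp_def intro!: continuous_intros continuous_on_entry)
  qed
  moreover have "compact ?K"
    by (intro compact_Pi_UNIV) auto
  ultimately have "compact (?K \<inter> ?C)"
    by (intro compact_Int_closed)
  moreover have "orthonormal_families n = ?K \<inter> ?C"
    unfolding orthonormal_families_def Pi_def by auto
  ultimately show ?thesis by simp
qed

lemma orthonormal_familiesI:
  assumes "\<And>i j. i < n \<Longrightarrow> j < n \<Longrightarrow> dotp n (u i) (u j) = (if i = j then 1 else 0)"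
    and "\<And>i k. \<not> (i < n \<and> k < n) \<Longrightarrow> u i k = 0"
  shows "u \<in> orthonormal_families n"
proof -
  have "\<bar>u i k\<bar> \<le> 1" if "i < n" "k < n" for i k
  proof -
    have "(u i k)\<^sup>2 \<le> (\<Sum>k<n. (u i k)\<^sup>2)"
      by (rule member_le_sum) (use that in auto)
    also have "\<dots> = 1"
      using assms(1)[of i i] that by (simp add: dotp_def power2_eq_square)
    finally show ?thesis by (simp add: abs_square_le_1)
  qed
  then show ?thesis
    using assms unfolding orthonormal_families_def by (auto simp: abs_le_iff)
qed

text \<open>The maximiser of \<open>\<Sum> i * S(u\<^sub>i, u\<^sub>i)\<close> over orthonormal families diagonalises \<open>S\<close>:
  rotating in the plane of \<open>u\<^sub>p, u\<^sub>q\<close> changes the objective to first order by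
  \<open>2 (p - q) S(u\<^sub>p, u\<^sub>q)\<close>.\<close>

lemma symmetric_orthonormal_eigenbasis:
  assumes sym: "\<And>k l. k < n \<Longrightarrow> l < n \<Longrightarrow> S k l = S l k"
  shows "\<exists>u. (\<forall>i<n. \<forall>j<n. dotp n (u i) (u j) = (if i = j then 1 else 0)) \<and>
    (\<forall>i<n. \<forall>j<n. i \<noteq> j \<longrightarrow> bform n S (u i) (u j) = 0)"
proof -
  define F where "F = (\<lambda>u::nat \<Rightarrow> nat \<Rightarrow> real. \<Sum>i<n. real i * bform n S (u i) (u i))"
  have "(\<lambda>i k. if i < n \<and> k < n \<and> i = k then 1 else 0) \<in> orthonormal_families n"
    by (rule orthonormal_familiesI) (auto simp: dotp_def if_distrib[of "\<lambda>x. x * _"] sum.delta cong: if_cong)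
  then have "orthonormal_families n \<noteq> {}" by auto
  moreover have "continuous_on (orthonormal_families n) F"
    unfolding F_def bform_def by (intro continuous_intros continuous_on_entry)
  ultimately obtain u where u: "u \<in> orthonormal_families n"
      and max: "\<And>v. v \<in> orthonormal_families n \<Longrightarrow> F v \<le> F u"
    using continuous_attains_sup[OF compact_orthonormal_families] by metis
  have on: "dotp n (u i) (u j) = (if i = j then 1 else 0)" if "i < n" "j < n" for i j
    using u that by (auto simp: orthonormal_families_def)
  have z: "u i k = 0" if "\<not> (i < n \<and> k < n)" for i k
  proof -
    have "u i k \<in> (if i < n \<and> k < n then {-1..1} else {0})"
      using u unfolding orthonormal_families_def by blast
    with that show ?thesis by auto
  qed
  have "bform n S (u p) (u q) = 0" if pq: "p < n" "q < n" "p \<noteq> q" for p q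
  proof -
    let ?B = "\<lambda>i j. bform n S (u i) (u j)"
    have Bs: "?B q p = ?B p q" by (rule bform_comm[OF sym])
    have rot: "(real p - real q) * (2 * c * s * ?B p q) \<le> (real p - real q) * (s\<^sup>2 * (?B p p - ?B q q))"
      if cs: "c\<^sup>2 + s\<^sup>2 = 1" for c s
    proof -
      \<comment> \<open>A variable for \<open>- s\<close> keeps the rotated vectors in the literal
        form \<open>a * x k + b * y k\<close> that \<open>dotp_lin\<close> and
        \<open>bform_lin\<close> rewrite.\<close>
      define r where "r = - s"
      have r: "r * r = s * s" "r * c = - (s * c)" "c * r = - (s * c)" and s: "s * s = 1 - c * c"
        using cs by (auto simp: r_def power2_eq_square)
      define v where "v = u(p := \<lambda>k. c * u p k + s * u q k, q := \<lambda>k. r * u p k + c * u q k)"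
      have vi: "v i = (if i = p then \<lambda>k. c * u p k + s * u q k else
                     if i = q then \<lambda>k. r * u p k + c * u q k else u i)" for i
        using pq by (auto simp: v_def)
      have "v \<in> orthonormal_families n"
      proof (rule orthonormal_familiesI)
        fix i j assume "i < n" "j < n"
        then show "dotp n (v i) (v j) = (if i = j then 1 else 0)"
          using pq on by (auto simp: vi dotp_lin r s)
      next
        fix i k assume "\<not> (i < n \<and> k < n)"
        then show "v i k = 0" using z pq by (auto simp: vi)
      qed
      then have "F v \<le> F u" by (rule max)
      have split: "F w = real p * bform n S (w p) (w p) + (real q * bform n S (w q) (w q) +
          (\<Sum>i\<in>{..<n}-{p}-{q}. real i * bform n S (w i) (w i)))" for w
        unfolding F_def using pq by (subst sum.remove[of _ p], simp, simp, subst sum.remove[of _ q]) auto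
      have "(\<Sum>i\<in>{..<n}-{p}-{q}. real i * bform n S (v i) (v i)) =
            (\<Sum>i\<in>{..<n}-{p}-{q}. real i * bform n S (u i) (u i))"
        by (intro sum.cong) (auto simp: vi)
      with \<open>F v \<le> F u\<close> have "real p * bform n S (v p) (v p) + real q * bform n S (v q) (v q)
          \<le> real p * ?B p p + real q * ?B q q"
        unfolding split by simp
      moreover have "bform n S (v p) (v p) = c\<^sup>2 * ?B p p + 2 * c * s * ?B p q + s\<^sup>2 * ?B q q"
        unfolding vi by (simp only: if_True simp_thms bform_lin Bs) (simp add: power2_eq_square algebra_simps)
      moreover have "bform n S (v q) (v q) = s\<^sup>2 * ?B p p - 2 * c * s * ?B p q + c\<^sup>2 * ?B q q"
        unfolding vi using pq by (simp add: bform_lin Bs) (simp add: r_def power2_eq_square algebra_simps)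
      moreover have c2: "c\<^sup>2 = 1 - s\<^sup>2" using cs by simp
      ultimately show ?thesis unfolding c2 by (simp add: algebra_simps)
    qed
    define X where "X = (real p - real q) * (2 * ?B p q)"
    define Y where "Y = (real p - real q) * (?B p p - ?B q q)"
    have rot': "c * s * X \<le> s\<^sup>2 * Y" if "c\<^sup>2 + s\<^sup>2 = 1" for c s
      using rot[OF that] by (simp add: X_def Y_def algebra_simps)
    \<comment> \<open>The rotations by \<open>t\<close> and \<open>- t\<close> bound both signs of
      \<open>X\<close>. Dividing by \<open>sin t > 0\<close> and letting \<open>t\<close> tend to 0
      forces \<open>X = 0\<close>, and \<open>p \<noteq> q\<close> then removes the factor
      \<open>real p - real q\<close>.\<close>
    have "\<bar>X\<bar> * cos t \<le> sin t * \<bar>Y\<bar>" if t: "0 < t" "t < pi" for t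
    proof -
      have "sin t > 0" using t by (rule sin_gt_zero)
      have "cos t * sin t * X \<le> (sin t)\<^sup>2 * Y" "- (cos t * sin t * X) \<le> (sin t)\<^sup>2 * Y"
        using rot'[of "cos t" "sin t"] rot'[of "cos t" "- sin t"] by auto
      then have "sin t * (cos t * X) \<le> sin t * (sin t * Y)" "sin t * (- (cos t * X)) \<le> sin t * (sin t * Y)"
        by (simp_all add: power2_eq_square algebra_simps)
      then have "cos t * X \<le> sin t * Y" "- (cos t * X) \<le> sin t * Y"
        using \<open>sin t > 0\<close> by (simp_all only: mult_le_cancel_left_pos)
      moreover have "sin t * Y \<le> sin t * \<bar>Y\<bar>" using \<open>sin t > 0\<close> by simp
      ultimately show ?thesis by (auto simp: abs_if algebra_simps)
    qed
    then have "\<forall>\<^sub>F t in at_right 0. \<bar>X\<bar> * cos t \<le> sin t * \<bar>Y\<bar>"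
      by (intro eventually_at_rightI[of 0 pi]) auto
    moreover have "((\<lambda>t. \<bar>X\<bar> * cos t) \<longlongrightarrow> \<bar>X\<bar> * cos 0) (at_right 0)"
      by (intro tendsto_intros)
    moreover have "((\<lambda>t. sin t * \<bar>Y\<bar>) \<longlongrightarrow> sin 0 * \<bar>Y\<bar>) (at_right 0)"
      by (intro tendsto_intros)
    ultimately have "\<bar>X\<bar> * cos 0 \<le> sin 0 * \<bar>Y\<bar>"
      by (rule_tac tendsto_le[OF _ _ _ ]) auto
    then show ?thesis using pq by (simp add: X_def)
  qed
  with on show ?thesis by blast
qed

section \<open>Simultaneous diagonalisation and the inverse form\<close>

lemma left_inverse_imp_right_inverse:
  fixes X Y :: "nat \<Rightarrow> nat \<Rightarrow> real"
  assumes "\<And>i j. i < n \<Longrightarrow> j < n \<Longrightarrow> (\<Sum>k<n. X i k * Y k j) = (if i = j then 1 else 0)"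
    and "i < n" "j < n"
  shows "(\<Sum>k<n. Y i k * X k j) = (if i = j then 1 else 0)"
proof -
  let ?X = "mat n n (\<lambda>(i,j). X i j)" and ?Y = "mat n n (\<lambda>(i,j). Y i j)"
  have "?X * ?Y = 1\<^sub>m n"
    by (rule eq_matI) (use assms(1) in \<open>auto simp: scalar_prod_def atLeast0LessThan\<close>)
  then have "?Y * ?X = 1\<^sub>m n"
    by (intro mat_mult_left_right_inverse[where A = ?X]) auto
  then have "(?Y * ?X) $$ (i,j) = 1\<^sub>m n $$ (i,j)" by simp
  then show ?thesis using assms(2,3) by (auto simp: scalar_prod_def atLeast0LessThan)
qed

lemma bform_zero: "bform n S (\<lambda>k. 0) z = 0" "bform n S z (\<lambda>k. 0) = 0"
  by (simp_all add: bform_def)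

lemma bform_sum:
  fixes m :: nat
  shows "bform n S (\<lambda>k. \<Sum>a<m. w a * v a k) z = (\<Sum>a<m. w a * bform n S (v a) z)" (is ?L)
  "bform n S z (\<lambda>k. \<Sum>a<m. w a * v a k) = (\<Sum>a<m. w a * bform n S z (v a))" (is ?R)
proof -
  show ?L
  proof (induction m)
    case (Suc m)
    then show ?case using bform_lin(1)[of n S 1 "\<lambda>k. \<Sum>a<m. w a * v a k" "w m" "v m" z] by simp
  qed (simp add: bform_zero)
  show ?R
  proof (induction m)
    case (Suc m)
    then show ?case using bform_lin(2)[of n S z 1 "\<lambda>k. \<Sum>a<m. w a * v a k" "w m" "v m"] by simp
  qed (simp add: bform_zero)
qed

lemma bform_linear_combination:
  fixes m :: nat
  shows "bform n S (\<lambda>k. \<Sum>a<m. w a * v a k) (\<lambda>k. \<Sum>b<m. w' b * v b k) =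
     bform m (\<lambda>a b. bform n S (v a) (v b)) w w'"
  unfolding bform_sum bform_def[of m] sum_distrib_left
  by (intro sum.cong refl) (simp add: mult_ac)

lemma bform_diagonal:
  assumes "\<And>a b. a < n \<Longrightarrow> b < n \<Longrightarrow> S a b = (if a = b then 1 else 0)"
  shows "bform n S x y = dotp n x y"
proof -
  have "bform n S x y = (\<Sum>k<n. \<Sum>l<n. if k = l then x k * y l else 0)"
    unfolding bform_def by (intro sum.cong refl) (use assms in auto)
  then show ?thesis by (simp add: dotp_def)
qed

text \<open>Rescaling an eigenbasis of \<open>A\<close> gives an \<open>A\<close>-orthonormal basis
  \<open>v\<close>. In its coordinates \<open>A\<close> is the standard inner product, so an
  orthonormal eigenbasis of the Gram matrix of \<open>B\<close> diagonalises \<open>B\<close>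
  without disturbing \<open>A\<close>. The third conclusion says that the inverse of
  \<open>A\<close> is the sum of the rank-one matrices built from the \<open>c i\<close>.\<close>

lemma simultaneous_diagonalisation:
  assumes symA: "\<And>k l. k < n \<Longrightarrow> l < n \<Longrightarrow> A k l = A l k"
    and symB: "\<And>k l. k < n \<Longrightarrow> l < n \<Longrightarrow> B k l = B l k"
    and pos: "\<And>x k. k < n \<Longrightarrow> x k \<noteq> 0 \<Longrightarrow> bform n A x x > 0"
  obtains c where
    "\<And>i j. i < n \<Longrightarrow> j < n \<Longrightarrow> bform n A (c i) (c j) = (if i = j then 1 else 0)"
    "\<And>i j. i < n \<Longrightarrow> j < n \<Longrightarrow> i \<noteq> j \<Longrightarrow> bform n B (c i) (c j) = 0"
    "\<And>k l. k < n \<Longrightarrow> l < n \<Longrightarrow> (\<Sum>m<n. A k m * (\<Sum>i<n. c i m * c i l)) = (if k = l then 1 else 0)"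
proof -
  obtain u where on: "\<And>i j. i < n \<Longrightarrow> j < n \<Longrightarrow> dotp n (u i) (u j) = (if i = j then 1 else 0)"
    and Au: "\<And>i j. i < n \<Longrightarrow> j < n \<Longrightarrow> i \<noteq> j \<Longrightarrow> bform n A (u i) (u j) = 0"
    using symmetric_orthonormal_eigenbasis[of n A, OF symA] by blast
  have d: "bform n A (u i) (u i) > 0" if "i < n" for i
  proof -
    have "\<exists>k<n. u i k \<noteq> 0"
    proof (rule ccontr)
      assume "\<not> ?thesis"
      then have "dotp n (u i) (u i) = 0" by (simp add: dotp_def)
      then show False using on[OF that that] by simp
    qed
    then show ?thesis using pos by blast
  qed
  \<comment> \<open>The summand \<open>0 * u i k\<close> only brings the scaled vector into the
    shape required by \<open>bform_lin\<close>.\<close>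
  define v where "v = (\<lambda>i k. (1 / sqrt (bform n A (u i) (u i))) * u i k + 0 * u i k)"
  have vA: "bform n A (v i) (v j) = (if i = j then 1 else 0)" if "i < n" "j < n" for i j
    unfolding v_def bform_lin using Au[OF that] d[OF that(1)]
    by (cases "i = j") (auto simp: real_sqrt_mult_self divide_simps)
  have symV: "bform n B (v i) (v j) = bform n B (v j) (v i)" for i j
    by (rule bform_comm[OF symB])
  obtain w where won: "\<And>i j. i < n \<Longrightarrow> j < n \<Longrightarrow> dotp n (w i) (w j) = (if i = j then 1 else 0)"
    and Bw: "\<And>i j. i < n \<Longrightarrow> j < n \<Longrightarrow> i \<noteq> j \<Longrightarrow> bform n (\<lambda>a b. bform n B (v a) (v b)) (w i) (w j) = 0"
    using symmetric_orthonormal_eigenbasis[of n "\<lambda>a b. bform n B (v a) (v b)", OF symV] by blast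
  define c where "c = (\<lambda>i k. \<Sum>a<n. w i a * v a k)"
  have cA: "bform n A (c i) (c j) = (if i = j then 1 else 0)" if "i < n" "j < n" for i j
    unfolding c_def bform_linear_combination using won[OF that] bform_diagonal[of n, OF vA] by simp
  have cB: "bform n B (c i) (c j) = 0" if "i < n" "j < n" "i \<noteq> j" for i j
    unfolding c_def bform_linear_combination using Bw[OF that] by simp
  \<comment> \<open>With \<open>C\<close> the matrix of rows \<open>c i\<close>, orthonormality
    reads \<open>(C A) C^T = I\<close>. Exchanging the factors gives \<open>C^T (C A) = I\<close>,
    and the symmetry of \<open>A\<close> turns this into the claim.\<close>
  have left: "(\<Sum>k<n. (\<Sum>m<n. c i m * A m k) * c j k) = (if i = j then 1 else 0)" if "i < n" "j < n" for i j
    unfolding cA[OF that, symmetric] bform_def sum_distrib_right by (rule sum.swap)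
  have inv: "(\<Sum>i<n. c i l * (\<Sum>m<n. c i m * A m k)) = (if l = k then 1 else 0)" if "l < n" "k < n" for k l
    using left_inverse_imp_right_inverse[of n "\<lambda>i k. \<Sum>m<n. c i m * A m k" "\<lambda>k j. c j k", OF left that] .
  have "(\<Sum>m<n. A k m * (\<Sum>i<n. c i m * c i l)) = (if k = l then 1 else 0)" if kl: "k < n" "l < n" for k l
  proof -
    have "(\<Sum>m<n. A k m * (\<Sum>i<n. c i m * c i l)) = (\<Sum>m<n. \<Sum>i<n. c i l * (c i m * A m k))"
      using kl symA[OF kl(1)] unfolding sum_distrib_left
      by (intro sum.cong refl) (auto simp: mult_ac)
    also have "\<dots> = (\<Sum>i<n. c i l * (\<Sum>m<n. c i m * A m k))"
      by (subst sum.swap) (simp add: sum_distrib_left)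
    finally show ?thesis using inv[OF kl(2,1)] by auto
  qed
  with cA cB show thesis by (rule that)
qed

text \<open>By \<open>inv\<close> the Gram sum of the \<open>c i\<close> inverts \<open>A\<close>,
  and its quadratic form splits into squares of the linear forms
  \<open>dotp n (c i)\<close>.\<close>

lemma quad_inv_eq_sum_squares:
  assumes A: "A = mat n n (\<lambda>(j,k). complex_of_real (a j k))"
    and inv: "\<And>k l. k < n \<Longrightarrow> l < n \<Longrightarrow> (\<Sum>m<n. a k m * (\<Sum>i<n. c i m * c i l)) = (if k = l then 1 else 0)"
  shows "quad_inv n A x = complex_of_real (\<Sum>i<n. (dotp n (c i) x)\<^sup>2)"
proof -
  let ?G = "mat n n (\<lambda>(m,l). complex_of_real (\<Sum>i<n. c i m * c i l))"
  have AG: "A * ?G = 1\<^sub>m n"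
  proof (rule eq_matI)
    fix k l assume "k < dim_row (1\<^sub>m n :: complex mat)" "l < dim_col (1\<^sub>m n :: complex mat)"
    then have kl: "k < n" "l < n" by auto
    have "(A * ?G) $$ (k,l) = complex_of_real (\<Sum>m<n. a k m * (\<Sum>i<n. c i m * c i l))"
      using kl by (simp add: A scalar_prod_def atLeast0LessThan)
    then show "(A * ?G) $$ (k,l) = 1\<^sub>m n $$ (k,l)"
      using kl by (simp add: inv)
  qed (auto simp: A)
  have GA: "?G * A = 1\<^sub>m n"
    by (rule mat_mult_left_right_inverse[OF _ _ AG]) (auto simp: A)
  have cA: "A \<in> carrier_mat n n" by (simp add: A)
  \<comment> \<open>\<open>mat_inv\<close> unwraps an option, so \<open>mat_inverse\<close> must
    first be shown to succeed; the explicit two-sided inverse makes \<open>A\<close> a unit.\<close>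
  have "mat_inverse A \<noteq> None"
  proof
    assume "mat_inverse A = None"
    from mat_inverse(1)[OF cA this] have "A \<notin> Units (ring_mat TYPE(complex) n n)" .
    moreover have "A \<in> Units (ring_mat TYPE(complex) n n)"
      unfolding Units_def using AG GA cA by (auto simp: ring_mat_def intro!: bexI[of _ ?G])
    ultimately show False by simp
  qed
  then obtain B where B: "mat_inverse A = Some B" by auto
  from mat_inverse(2)[OF cA B] have "A * B = 1\<^sub>m n" "B * A = 1\<^sub>m n" "B \<in> carrier_mat n n" by auto
  then have "B = B * (A * ?G)" unfolding AG by simp
  also have "\<dots> = ?G" using \<open>B * A = 1\<^sub>m n\<close> \<open>B \<in> carrier_mat n n\<close> cA
    by (subst assoc_mult_mat[symmetric]) auto
  finally have "mat_inv A = ?G" by (simp add: mat_inv_def B)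
  then have "quad_inv n A x =
      (\<Sum>m<n. complex_of_real (x m) * (\<Sum>l<n. complex_of_real (\<Sum>i<n. c i m * c i l) * complex_of_real (x l)))"
    by (simp add: quad_inv_def Let_def scalar_prod_def atLeast0LessThan)
  also have "\<dots> = complex_of_real (\<Sum>m<n. \<Sum>l<n. \<Sum>i<n. (c i m * x m) * (c i l * x l))"
    unfolding of_real_sum sum_distrib_left sum_distrib_right
    by (intro sum.cong refl) (simp add: mult_ac)
  also have "(\<Sum>m<n. \<Sum>l<n. \<Sum>i<n. (c i m * x m) * (c i l * x l)) = (\<Sum>m<n. \<Sum>i<n. \<Sum>l<n. (c i m * x m) * (c i l * x l))"
    by (rule sum.cong[OF refl]) (rule sum.swap)
  also have "\<dots> = (\<Sum>i<n. \<Sum>m<n. \<Sum>l<n. (c i m * x m) * (c i l * x l))"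
    by (rule sum.swap)
  also have "\<dots> = (\<Sum>i<n. (dotp n (c i) x)\<^sup>2)"
    by (simp add: dotp_def power2_eq_square sum_product)
  finally show ?thesis .
qed

section \<open>Concentration of Gaussian quadratic forms\<close>

lemma borel_measurable_cis [measurable]: "cis \<in> borel_measurable borel"
  by (intro borel_measurable_continuous_onI continuous_intros)

text \<open>Completing the square: the exponential tilt moves the mean of the standard normal
  density to \<open>a\<close>, at the price of the factor
  \<open>exp (a\<^sup>2 / 2)\<close>.\<close>

lemma nn_integral_exp_linear_std_normal:
  "(\<integral>\<^sup>+z. ennreal (exp (a * z)) \<partial>std_normal_distribution) = ennreal (exp (a\<^sup>2 / 2))"
proof -
  have *: "std_normal_density z * exp (a * z) = exp (a\<^sup>2 / 2) * normal_density a 1 z" for z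
    by (simp add: normal_density_def exp_add[symmetric] field_simps power2_eq_square)
  have "(\<integral>\<^sup>+z. ennreal (exp (a * z)) \<partial>std_normal_distribution) =
      (\<integral>\<^sup>+z. ennreal (std_normal_density z) * ennreal (exp (a * z)) \<partial>lborel)"
    by (subst nn_integral_density) auto
  also have "\<dots> = (\<integral>\<^sup>+z. ennreal (exp (a\<^sup>2 / 2)) * ennreal (normal_density a 1 z) \<partial>lborel)"
    by (intro nn_integral_cong) (simp add: ennreal_mult[symmetric] *)
  also have "\<dots> = ennreal (exp (a\<^sup>2 / 2)) * (\<integral>\<^sup>+z. ennreal (normal_density a 1 z) \<partial>lborel)"
    by (rule nn_integral_cmult) simp
  also have "(\<integral>\<^sup>+z. ennreal (normal_density a 1 z) \<partial>lborel) = 1"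
    using prob_space.emeasure_space_1[OF prob_space_normal_density[of 1 a]]
    by (simp add: emeasure_density)
  finally show ?thesis by simp
qed

text \<open>A quadratic tilt changes the variance to \<open>1 / (1 - 2 * a)\<close>. Negative
  \<open>a\<close> is allowed and serves the lower tail.\<close>

lemma nn_integral_exp_square_std_normal:
  assumes "a < 1/2"
  shows "(\<integral>\<^sup>+z. ennreal (exp (a * z\<^sup>2)) \<partial>std_normal_distribution) = ennreal (1 / sqrt (1 - 2 * a))"
proof -
  define \<sigma> where "\<sigma> = 1 / sqrt (1 - 2 * a)"
  have \<sigma>: "\<sigma> > 0" "\<sigma>\<^sup>2 = 1 / (1 - 2 * a)"
    using assms by (auto simp: \<sigma>_def power_divide)
  have *: "std_normal_density z * exp (a * z\<^sup>2) = \<sigma> * normal_density 0 \<sigma> z" for z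
  proof -
    have "- (z\<^sup>2 / 2) + a * z\<^sup>2 = - (z\<^sup>2 / (2 * \<sigma>\<^sup>2))"
      by (simp add: \<sigma> field_simps)
    then show ?thesis
      using \<sigma>(1) unfolding normal_density_def by (simp add: exp_add[symmetric] real_sqrt_mult)
  qed
  have "(\<integral>\<^sup>+z. ennreal (exp (a * z\<^sup>2)) \<partial>std_normal_distribution) =
      (\<integral>\<^sup>+z. ennreal (std_normal_density z) * ennreal (exp (a * z\<^sup>2)) \<partial>lborel)"
    by (subst nn_integral_density) auto
  also have "\<dots> = (\<integral>\<^sup>+z. ennreal \<sigma> * ennreal (normal_density 0 \<sigma> z) \<partial>lborel)"
    using \<sigma> by (intro nn_integral_cong) (simp add: ennreal_mult[symmetric] *)
  also have "\<dots> = ennreal \<sigma> * (\<integral>\<^sup>+z. ennreal (normal_density 0 \<sigma> z) \<partial>lborel)"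
    by (rule nn_integral_cmult) simp
  also have "(\<integral>\<^sup>+z. ennreal (normal_density 0 \<sigma> z) \<partial>lborel) = 1"
    using prob_space.emeasure_space_1[OF prob_space_normal_density[of \<sigma> 0]] \<sigma>
    by (simp add: emeasure_density)
  finally show ?thesis by (simp add: \<sigma>_def)
qed

lemma integral_cis_std_normal:
  "(CLINT z|std_normal_distribution. cis (a * z)) = complex_of_real (exp (- a\<^sup>2 / 2))"
  using fun_cong[OF char_std_normal_distribution, of a] by (simp add: char_def cis_conv_exp)

text \<open>Levy uniqueness identifies the law of \<open>X\<close> with that of
  \<open>sqrt v * Z\<close>, \<open>Z\<close> standard normal. Comparing with an image measure
  instead of a normal density includes the degenerate case \<open>v = 0\<close>.\<close>

lemma (in prob_space) gaussian_exponential_moment: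
  fixes X :: "'a \<Rightarrow> real"
  assumes [measurable]: "X \<in> borel_measurable M" and v: "v \<ge> 0"
    and cf: "\<And>t. (CLINT \<omega>|M. cis (t * X \<omega>)) = complex_of_real (exp (- (t\<^sup>2 * v) / 2))"
  shows "(\<integral>\<^sup>+\<omega>. ennreal (exp (X \<omega>)) \<partial>M) = ennreal (exp (v / 2))"
proof -
  interpret N: real_distribution std_normal_distribution by (rule real_dist_normal_dist)
  let ?N = "distr std_normal_distribution borel (\<lambda>z. sqrt v * z)"
  have "distr M borel X = ?N"
  proof (rule Levy_uniqueness)
    show "real_distribution (distr M borel X)"
      by (rule real_distribution_distr) simp
    show "real_distribution ?N"
      by (rule N.real_distribution_distr) simp
    show "char (distr M borel X) = char ?N"
    proof
      fix t
      have "char (distr M borel X) t = (CLINT \<omega>|M. cis (t * X \<omega>))"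
        unfolding char_def by (subst integral_distr) (auto simp: cis_conv_exp)
      also have "\<dots> = (CLINT z|std_normal_distribution. cis ((t * sqrt v) * z))"
        unfolding cf integral_cis_std_normal using v by (simp add: power_mult_distrib)
      also have "\<dots> = char ?N t"
        unfolding char_def by (subst integral_distr) (auto simp: cis_conv_exp mult_ac)
      finally show "char (distr M borel X) t = char ?N t" .
    qed
  qed
  then have "(\<integral>\<^sup>+x. ennreal (exp x) \<partial>distr M borel X) = (\<integral>\<^sup>+x. ennreal (exp x) \<partial>?N)"
    by simp
  then show ?thesis
    using v by (simp add: nn_integral_distr nn_integral_exp_linear_std_normal)
qed

section \<open>Exponential moments of sums of squares\<close>

abbreviation std_normals :: "nat \<Rightarrow> (nat \<Rightarrow> real) measure" where
  "std_normals n \<equiv> Pi\<^sub>M {..<n} (\<lambda>_. std_normal_distribution)"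

lemma prob_space_std_normal: "prob_space std_normal_distribution"
  by (rule prob_space_normal_density) simp

lemma product_sigma_finite_std_normal: "product_sigma_finite (\<lambda>_::nat. std_normal_distribution)"
  unfolding product_sigma_finite_def
  using prob_space_std_normal prob_space_imp_sigma_finite by blast

lemma prob_space_std_normals: "prob_space (std_normals n)"
  by (intro prob_space_PiM prob_space_std_normal)

text \<open>Hubbard--Stratonovich: \<open>exp (s y\<^sup>2)\<close> is the mean of \<open>exp (sqrt (2 s) y Z)\<close>, and
  \<open>exp (- s y\<^sup>2)\<close> that of \<open>cis (sqrt (2 s) y Z)\<close>, over a standard normal \<open>Z\<close>; exchanging the two
  expectations reduces the Laplace transform of a sum of squares to linear functionals.\<close>

lemma (in prob_space) exponential_moment_sum_squares:
  fixes Y :: "nat \<Rightarrow> 'a \<Rightarrow> real"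
  assumes meas: "\<And>i. i < n \<Longrightarrow> Y i \<in> borel_measurable M"
    and \<mu>: "\<And>i. i < n \<Longrightarrow> \<mu> i \<ge> 0"
    and cf: "\<And>\<theta>::nat \<Rightarrow> real. (CLINT \<omega>|M. cis (\<Sum>i<n. \<theta> i * Y i \<omega>)) = 
        complex_of_real (exp (- (\<Sum>i<n. (\<theta> i)\<^sup>2 * \<mu> i) / 2))"
    and s: "s \<ge> 0" "\<And>i. i < n \<Longrightarrow> s * \<mu> i < 1/2"
  shows "(\<integral>\<^sup>+\<omega>. ennreal (exp (s * (\<Sum>i<n. (Y i \<omega>)\<^sup>2))) \<partial>M) = ennreal (\<Prod>i<n. 1 / sqrt (1 - 2 * (s * \<mu> i)))"
proof -
  interpret N: product_sigma_finite "\<lambda>_::nat. std_normal_distribution"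
    by (rule product_sigma_finite_std_normal)
  interpret P: prob_space "std_normals n" by (rule prob_space_std_normals)
  interpret MP: pair_sigma_finite M "std_normals n" ..
  define r where "r = sqrt (2 * s)"
  have r: "r\<^sup>2 = 2 * s" using s by (simp add: r_def)
  have HS: "ennreal (exp (s * (\<Sum>i<n. (y i)\<^sup>2))) =
      (\<integral>\<^sup>+z. ennreal (exp (\<Sum>i<n. (r * z i) * y i)) \<partial>std_normals n)" for y :: "nat \<Rightarrow> real"
  proof -
    have "ennreal (exp (s * (\<Sum>i<n. (y i)\<^sup>2))) = (\<Prod>i<n. ennreal (exp ((r * y i)\<^sup>2 / 2)))"
      by (simp add: sum_distrib_left exp_sum prod_ennreal power_mult_distrib r)
    also have "\<dots> = (\<Prod>i<n. \<integral>\<^sup>+z. ennreal (exp ((r * y i) * z)) \<partial>std_normal_distribution)"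
      by (simp add: nn_integral_exp_linear_std_normal)
    also have "\<dots> = (\<integral>\<^sup>+z. (\<Prod>i<n. ennreal (exp ((r * y i) * z i))) \<partial>std_normals n)"
      by (rule N.product_nn_integral_prod[symmetric]) auto
    finally show ?thesis
      by (simp add: exp_sum prod_ennreal mult_ac)
  qed
  have [measurable]: "(\<lambda>x. \<Sum>i<n. (r * snd x i) * Y i (fst x)) \<in> borel_measurable (M \<Otimes>\<^sub>M std_normals n)"
  proof (rule borel_measurable_sum)
    fix i assume i: "i \<in> {..<n}"
    have [measurable]: "(\<lambda>x. Y i (fst x)) \<in> borel_measurable (M \<Otimes>\<^sub>M std_normals n)"
      using meas[of i] i by auto
    have "(\<lambda>x. snd x i) \<in> measurable (M \<Otimes>\<^sub>M std_normals n) std_normal_distribution"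
      using measurable_compose[OF measurable_snd measurable_component_singleton[OF i]] .
    then have [measurable]: "(\<lambda>x. snd x i) \<in> borel_measurable (M \<Otimes>\<^sub>M std_normals n)"
      by simp
    show "(\<lambda>x. (r * snd x i) * Y i (fst x)) \<in> borel_measurable (M \<Otimes>\<^sub>M std_normals n)"
      by measurable
  qed
  have "(\<integral>\<^sup>+\<omega>. ennreal (exp (s * (\<Sum>i<n. (Y i \<omega>)\<^sup>2))) \<partial>M) =
      (\<integral>\<^sup>+\<omega>. (\<integral>\<^sup>+z. ennreal (exp (\<Sum>i<n. (r * z i) * Y i \<omega>)) \<partial>std_normals n) \<partial>M)"
    by (simp add: HS)
  also have "\<dots> = (\<integral>\<^sup>+z. (\<integral>\<^sup>+\<omega>. ennreal (exp (\<Sum>i<n. (r * z i) * Y i \<omega>)) \<partial>M) \<partial>std_normals n)"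
    by (rule MP.Fubini'[symmetric]) (simp add: case_prod_beta)
  \<comment> \<open>For fixed \<open>z\<close> the inner sum is a centred Gaussian of variance
    \<open>\<Sum>i<n. (r * z i)\<^sup>2 * \<mu> i\<close>. Its exponential moment is a product over
    the coordinates \<open>z i\<close>, and \<open>s * \<mu> i < 1/2\<close> keeps each remaining
    Gaussian integral finite.\<close>
  also have "\<dots> = (\<integral>\<^sup>+z. (\<Prod>i<n. ennreal (exp (s * \<mu> i * (z i)\<^sup>2))) \<partial>std_normals n)"
  proof (rule nn_integral_cong)
    fix z
    have v: "(\<Sum>i<n. (r * z i)\<^sup>2 * \<mu> i) \<ge> 0"
      using \<mu> by (intro sum_nonneg) auto
    have "(\<integral>\<^sup>+\<omega>. ennreal (exp (\<Sum>i<n. (r * z i) * Y i \<omega>)) \<partial>M) = ennreal (exp ((\<Sum>i<n. (r * z i)\<^sup>2 * \<mu> i) / 2))"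
    proof (rule gaussian_exponential_moment[OF _ v])
      show "(\<lambda>\<omega>. \<Sum>i<n. (r * z i) * Y i \<omega>) \<in> borel_measurable M"
        using meas by (intro borel_measurable_sum) auto
      show "(CLINT \<omega>|M. cis (t * (\<Sum>i<n. (r * z i) * Y i \<omega>))) =
        complex_of_real (exp (- (t\<^sup>2 * (\<Sum>i<n. (r * z i)\<^sup>2 * \<mu> i)) / 2))" for t
        using cf[of "\<lambda>i. t * (r * z i)"] by (simp add: sum_distrib_left power_mult_distrib mult_ac)
    qed
    then show "(\<integral>\<^sup>+\<omega>. ennreal (exp (\<Sum>i<n. (r * z i) * Y i \<omega>)) \<partial>M) = (\<Prod>i<n. ennreal (exp (s * \<mu> i * (z i)\<^sup>2)))"
      by (simp add: power_mult_distrib r prod_ennreal exp_sum[symmetric] sum_divide_distrib mult_ac)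
  qed
  also have "\<dots> = (\<Prod>i<n. \<integral>\<^sup>+z. ennreal (exp (s * \<mu> i * z\<^sup>2)) \<partial>std_normal_distribution)"
    by (rule N.product_nn_integral_prod) auto
  also have "\<dots> = (\<Prod>i<n. ennreal (1 / sqrt (1 - 2 * (s * \<mu> i))))"
    using s by (intro prod.cong refl nn_integral_exp_square_std_normal) auto
  also have "\<dots> = ennreal (\<Prod>i<n. 1 / sqrt (1 - 2 * (s * \<mu> i)))"
    using s by (intro prod_ennreal) (force simp: less_imp_le)
  finally show ?thesis .
qed

text \<open>Here the auxiliary average is taken of \<open>cis\<close>, so \<open>cf\<close> applies
  directly with \<open>\<theta> i = r * z i\<close>, and boundedness of the integrand justifies
  Fubini. No upper bound on \<open>s\<close> arises, because \<open>1 + 2 * (s * \<mu> i)\<close> is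
  at least 1.\<close>

lemma (in prob_space) laplace_transform_sum_squares:
  fixes Y :: "nat \<Rightarrow> 'a \<Rightarrow> real"
  assumes meas: "\<And>i. i < n \<Longrightarrow> Y i \<in> borel_measurable M"
    and \<mu>: "\<And>i. i < n \<Longrightarrow> \<mu> i \<ge> 0"
    and cf: "\<And>\<theta>::nat \<Rightarrow> real. (CLINT \<omega>|M. cis (\<Sum>i<n. \<theta> i * Y i \<omega>)) = 
        complex_of_real (exp (- (\<Sum>i<n. (\<theta> i)\<^sup>2 * \<mu> i) / 2))"
    and s: "s \<ge> 0"
  shows "(\<integral>\<^sup>+\<omega>. ennreal (exp (- s * (\<Sum>i<n. (Y i \<omega>)\<^sup>2))) \<partial>M) = ennreal (\<Prod>i<n. 1 / sqrt (1 + 2 * (s * \<mu> i)))"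
proof -
  interpret N: product_sigma_finite "\<lambda>_::nat. std_normal_distribution"
    by (rule product_sigma_finite_std_normal)
  interpret N1: prob_space std_normal_distribution by (rule prob_space_std_normal)
  interpret P: prob_space "std_normals n" by (rule prob_space_std_normals)
  interpret MP: pair_prob_space M "std_normals n" ..
  define r where "r = sqrt (2 * s)"
  have r: "r\<^sup>2 = 2 * s" using s by (simp add: r_def)
  have cis_sum: "cis (\<Sum>i<n. f i) = (\<Prod>i<n. cis (f i))" for f :: "nat \<Rightarrow> real"
    by (induction n) (simp_all add: cis_mult[symmetric])
  have HS: "complex_of_real (exp (- s * (\<Sum>i<n. (y i)\<^sup>2))) =
      (CLINT z|std_normals n. cis (\<Sum>i<n. (r * z i) * y i))" for y :: "nat \<Rightarrow> real"
  proof -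
    have "complex_of_real (exp (- s * (\<Sum>i<n. (y i)\<^sup>2))) = (\<Prod>i<n. complex_of_real (exp (- (r * y i)\<^sup>2 / 2)))"
      by (simp add: sum_distrib_left exp_sum power_mult_distrib r sum_negf[symmetric] del: of_real_exp)
    also have "\<dots> = (\<Prod>i<n. CLINT z|std_normal_distribution. cis ((r * y i) * z))"
      by (simp add: integral_cis_std_normal)
    also have "\<dots> = (CLINT z|std_normals n. (\<Prod>i<n. cis ((r * y i) * z i)))"
      by (rule N.product_integral_prod[symmetric]) (auto intro!: N1.integrable_const_bound[where B = 1])
    finally show ?thesis
      by (simp add: cis_sum mult_ac)
  qed
  have m[measurable]: "(\<lambda>x. \<Sum>i<n. (r * snd x i) * Y i (fst x)) \<in> borel_measurable (M \<Otimes>\<^sub>M std_normals n)"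
  proof (rule borel_measurable_sum)
    fix i assume i: "i \<in> {..<n}"
    have [measurable]: "(\<lambda>x. Y i (fst x)) \<in> borel_measurable (M \<Otimes>\<^sub>M std_normals n)"
      using meas[of i] i by auto
    have "(\<lambda>x. snd x i) \<in> measurable (M \<Otimes>\<^sub>M std_normals n) std_normal_distribution"
      using measurable_compose[OF measurable_snd measurable_component_singleton[OF i]] .
    then have [measurable]: "(\<lambda>x. snd x i) \<in> borel_measurable (M \<Otimes>\<^sub>M std_normals n)"
      by simp
    show "(\<lambda>x. (r * snd x i) * Y i (fst x)) \<in> borel_measurable (M \<Otimes>\<^sub>M std_normals n)"
      by measurable
  qed
  have int: "integrable (M \<Otimes>\<^sub>M std_normals n) (\<lambda>(\<omega>, z). cis (\<Sum>i<n. (r * z i) * Y i \<omega>))"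
    by (rule MP.P.integrable_const_bound[where B = 1]) (auto simp: case_prod_beta)
  have Qm: "(\<lambda>\<omega>. \<Sum>i<n. (Y i \<omega>)\<^sup>2) \<in> borel_measurable M"
    using meas by (intro borel_measurable_sum) auto
  have Qi: "integrable M (\<lambda>\<omega>. exp (- s * (\<Sum>i<n. (Y i \<omega>)\<^sup>2)))"
    using Qm s by (intro integrable_const_bound[where B = 1]) (auto simp: sum_nonneg)
  have expm2: "(CLINT z|std_normal_distribution. complex_of_real (exp (- (s * \<mu> i) * z\<^sup>2))) =
      complex_of_real (1 / sqrt (1 + 2 * (s * \<mu> i)))" if "i < n" for i
  proof -
    have "(LINT z|std_normal_distribution. exp (- (s * \<mu> i) * z\<^sup>2)) = enn2real (ennreal (1 / sqrt (1 - 2 * (- (s * \<mu> i)))))"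
    proof (subst integral_eq_nn_integral)
      have "- (s * \<mu> i) < 1/2"
        using s \<mu>[OF that] by (smt (verit) half_gt_zero_iff mult_nonneg_nonneg)
      then show "enn2real (\<integral>\<^sup>+z. ennreal (exp (- (s * \<mu> i) * z\<^sup>2)) \<partial>std_normal_distribution) = enn2real (ennreal (1 / sqrt (1 - 2 * (- (s * \<mu> i)))))"
        by (simp only: nn_integral_exp_square_std_normal)
    qed auto
    also have "\<dots> = 1 / sqrt (1 + 2 * (s * \<mu> i))"
      using s \<mu>[OF that] by simp
    finally show ?thesis by (simp only: integral_complex_of_real)
  qed
  have "complex_of_real (LINT \<omega>|M. exp (- s * (\<Sum>i<n. (Y i \<omega>)\<^sup>2))) =
      (CLINT \<omega>|M. (CLINT z|std_normals n. cis (\<Sum>i<n. (r * z i) * Y i \<omega>)))"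
    by (simp only: HS[symmetric] integral_complex_of_real)
  also have "\<dots> = (CLINT z|std_normals n. (CLINT \<omega>|M. cis (\<Sum>i<n. (r * z i) * Y i \<omega>)))"
    by (rule MP.Fubini_integral[OF int, symmetric])
  also have "\<dots> = (CLINT z|std_normals n. (\<Prod>i<n. complex_of_real (exp (- (s * \<mu> i) * (z i)\<^sup>2))))"
  proof (intro Bochner_Integration.integral_cong refl)
    fix z :: "nat \<Rightarrow> real"
    show "(CLINT \<omega>|M. cis (\<Sum>i<n. (r * z i) * Y i \<omega>)) = (\<Prod>i<n. complex_of_real (exp (- (s * \<mu> i) * (z i)\<^sup>2)))"
      unfolding cf[of "\<lambda>i. r * z i"] of_real_prod[symmetric] 
      by (simp add: power_mult_distrib r exp_sum[symmetric] sum_divide_distrib sum_negf[symmetric] mult_ac del: of_real_exp of_real_prod)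
  qed
  also have "\<dots> = (\<Prod>i<n. CLINT z|std_normal_distribution. complex_of_real (exp (- (s * \<mu> i) * z\<^sup>2)))"
    using s \<mu> by (intro N.product_integral_prod N1.integrable_const_bound[where B = 1]) auto
  also have "\<dots> = (\<Prod>i<n. complex_of_real (1 / sqrt (1 + 2 * (s * \<mu> i))))"
    by (intro prod.cong refl expm2) auto
  also have "\<dots> = complex_of_real (\<Prod>i<n. 1 / sqrt (1 + 2 * (s * \<mu> i)))"
    by simp
  finally have "(LINT \<omega>|M. exp (- s * (\<Sum>i<n. (Y i \<omega>)\<^sup>2))) = (\<Prod>i<n. 1 / sqrt (1 + 2 * (s * \<mu> i)))"
    by (simp only: of_real_eq_iff)
  then show ?thesis
    using nn_integral_eq_integral[OF Qi] by simp
qed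

section \<open>Two-sided Chernoff bound\<close>

lemma (in prob_space) prob_ge_le_exponential_moment:
  fixes X :: "'a \<Rightarrow> real"
  assumes [measurable]: "X \<in> borel_measurable M"
    and le: "(\<integral>\<^sup>+\<omega>. ennreal (exp (X \<omega>)) \<partial>M) \<le> ennreal (exp b)"
  shows "prob {\<omega> \<in> space M. x \<le> X \<omega>} \<le> exp (b - x)"
proof -
  have "emeasure M {\<omega> \<in> space M. 1 \<le> ennreal (exp (- x)) * ennreal (exp (X \<omega>))} \<le>
      ennreal (exp (- x)) * (\<integral>\<^sup>+\<omega>. ennreal (exp (X \<omega>)) \<partial>M)"
    using nn_integral_Markov_inequality[of "\<lambda>\<omega>. ennreal (exp (X \<omega>))" "space M" M "ennreal (exp (- x))"]
    by (simp cong: nn_integral_cong)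
  also have "\<dots> \<le> ennreal (exp (- x)) * ennreal (exp b)"
    by (intro mult_left_mono le) simp
  also have "\<dots> = ennreal (exp (b - x))"
    by (simp add: ennreal_mult[symmetric] exp_add[symmetric])
  also have "{\<omega> \<in> space M. 1 \<le> ennreal (exp (- x)) * ennreal (exp (X \<omega>))} = {\<omega> \<in> space M. x \<le> X \<omega>}"
    by (simp add: ennreal_mult[symmetric] exp_add[symmetric] flip: ennreal_1)
  finally show ?thesis by (simp add: emeasure_eq_measure)
qed

text \<open>The condition \<open>4 * s * \<Lambda> \<le> 1\<close> puts
  \<open>x = 2 * (s * \<mu> i)\<close> into \<open>[0, 1/2]\<close>, where
  \<open>ln (1 - x) \<ge> - x - 2 * x\<^sup>2\<close>. Halving the exponent gives
  \<open>s * \<mu> i + 4 * (s * \<mu> i)\<^sup>2\<close>: the linear part sums to the mean, and the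
  quadratic part is bounded by \<open>\<Lambda>\<close> times the trace.\<close>

lemma sum_squares_concentration:
  fixes Y :: "nat \<Rightarrow> 'a \<Rightarrow> real"
  assumes "prob_space M"
    and meas: "\<And>i. i < n \<Longrightarrow> Y i \<in> borel_measurable M"
    and \<mu>: "\<And>i. i < n \<Longrightarrow> 0 \<le> \<mu> i" "\<And>i. i < n \<Longrightarrow> \<mu> i \<le> \<Lambda>"
    and cf: "\<And>\<theta>::nat \<Rightarrow> real. (CLINT \<omega>|M. cis (\<Sum>i<n. \<theta> i * Y i \<omega>)) = 
        complex_of_real (exp (- (\<Sum>i<n. (\<theta> i)\<^sup>2 * \<mu> i) / 2))"
    and s: "s \<ge> 0" "4 * s * \<Lambda> \<le> 1"
  shows "measure M {\<omega> \<in> space M. x \<le> \<bar>(\<Sum>i<n. (Y i \<omega>)\<^sup>2) - (\<Sum>i<n. \<mu> i)\<bar>} \<le>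
      2 * exp (4 * s\<^sup>2 * \<Lambda> * (\<Sum>i<n. \<mu> i) - s * x)"
proof (cases "s = 0")
  \<comment> \<open>For \<open>s = 0\<close> the bound is 2. Excluding this case allows division by
    \<open>s\<close> when the event is split into its two tails.\<close>
  case True
  interpret prob_space M by fact
  show ?thesis using True order_trans[OF prob_le_1, of 2] by simp
next
  case False
  with s have s0: "s > 0" by simp
  interpret prob_space M by fact
  define Q where "Q = (\<lambda>\<omega>. \<Sum>i<n. (Y i \<omega>)\<^sup>2)"
  define T where "T = (\<Sum>i<n. \<mu> i)"
  have Qm[measurable]: "Q \<in> borel_measurable M"
    unfolding Q_def using meas by (intro borel_measurable_sum) auto
  have small: "0 \<le> 2 * (s * \<mu> i)" "2 * (s * \<mu> i) \<le> 1/2" if "i < n" for i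
  proof -
    have "s * \<mu> i \<le> s * \<Lambda>" using \<mu>(2)[OF that] s by (intro mult_left_mono) auto
    with s show "2 * (s * \<mu> i) \<le> 1/2" by simp
    show "0 \<le> 2 * (s * \<mu> i)" using \<mu>(1)[OF that] s by simp
  qed
  have sq: "(\<Sum>i<n. 4 * (s * \<mu> i)\<^sup>2) \<le> 4 * s\<^sup>2 * \<Lambda> * T"
  proof -
    have "4 * (s * \<mu> i)\<^sup>2 \<le> 4 * s\<^sup>2 * \<Lambda> * \<mu> i" if "i < n" for i
    proof -
      have "(\<mu> i)\<^sup>2 \<le> \<Lambda> * \<mu> i"
        using \<mu>[OF that] by (simp add: power2_eq_square mult_right_mono)
      then have "4 * s\<^sup>2 * (\<mu> i)\<^sup>2 \<le> 4 * s\<^sup>2 * (\<Lambda> * \<mu> i)" by (intro mult_left_mono) auto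
      then show ?thesis by (simp add: power_mult_distrib mult_ac)
    qed
    then have "(\<Sum>i<n. 4 * (s * \<mu> i)\<^sup>2) \<le> (\<Sum>i<n. 4 * s\<^sup>2 * \<Lambda> * \<mu> i)"
      by (intro sum_mono) auto
    then show ?thesis by (simp add: T_def sum_distrib_left)
  qed
  have inverse_le: "1 / r \<le> exp b" if "exp (- b) \<le> r" for r b :: real
  proof -
    have "0 < r" using that less_le_trans[OF exp_gt_zero] by blast
    then have "1 / r \<le> 1 / exp (- b)" using that by (intro divide_left_mono) auto
    then show ?thesis by (simp add: exp_minus divide_inverse)
  qed
  have up: "prob {\<omega> \<in> space M. s * (T + x) \<le> s * Q \<omega>} \<le> exp ((s * T + 4 * s\<^sup>2 * \<Lambda> * T) - s * (T + x))"
  proof (rule prob_ge_le_exponential_moment)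
    have "(\<integral>\<^sup>+\<omega>. ennreal (exp (s * Q \<omega>)) \<partial>M) = ennreal (\<Prod>i<n. 1 / sqrt (1 - 2 * (s * \<mu> i)))"
      unfolding Q_def using small s by (intro exponential_moment_sum_squares meas \<mu> cf) force+
    also have "\<dots> \<le> ennreal (\<Prod>i<n. exp (s * \<mu> i + 4 * (s * \<mu> i)\<^sup>2))"
    proof (intro ennreal_leI prod_mono conjI)
      fix i assume "i \<in> {..<n}"
      then have i: "i < n" by simp
      let ?x = "2 * (s * \<mu> i)"
      have "exp (- ?x - 2 * ?x\<^sup>2) \<le> 1 - ?x"
        using ln_one_minus_pos_lower_bound[OF small[OF i]] small[OF i]
        by (subst ln_ge_iff[symmetric]) auto
      then have "sqrt (exp (- ?x - 2 * ?x\<^sup>2)) \<le> sqrt (1 - ?x)" by (rule real_sqrt_le_mono)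
      also have "sqrt (exp (- ?x - 2 * ?x\<^sup>2)) = exp (- (s * \<mu> i + 4 * (s * \<mu> i)\<^sup>2))"
        by (rule real_sqrt_unique) (simp_all add: exp_double[symmetric] power_mult_distrib)
      finally show "1 / sqrt (1 - ?x) \<le> exp (s * \<mu> i + 4 * (s * \<mu> i)\<^sup>2)"
        using small[OF i] by (intro inverse_le) auto
      show "0 \<le> 1 / sqrt (1 - ?x)" using small[OF i] by simp
    qed
    also have "(\<Prod>i<n. exp (s * \<mu> i + 4 * (s * \<mu> i)\<^sup>2)) = exp (s * T + (\<Sum>i<n. 4 * (s * \<mu> i)\<^sup>2))"
      by (simp add: exp_sum[symmetric] sum.distrib T_def sum_distrib_left)
    also have "ennreal \<dots> \<le> ennreal (exp (s * T + 4 * s\<^sup>2 * \<Lambda> * T))"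
      using sq by (intro ennreal_leI) simp
    finally show "(\<integral>\<^sup>+\<omega>. ennreal (exp (s * Q \<omega>)) \<partial>M) \<le> ennreal (exp (s * T + 4 * s\<^sup>2 * \<Lambda> * T))" .
  qed simp
  have lo: "prob {\<omega> \<in> space M. - s * (T - x) \<le> - s * Q \<omega>} \<le> exp ((- s * T + 4 * s\<^sup>2 * \<Lambda> * T) - (- s * (T - x)))"
  proof (rule prob_ge_le_exponential_moment)
    have "(\<integral>\<^sup>+\<omega>. ennreal (exp (- s * Q \<omega>)) \<partial>M) = ennreal (\<Prod>i<n. 1 / sqrt (1 + 2 * (s * \<mu> i)))"
      unfolding Q_def using s by (intro laplace_transform_sum_squares meas \<mu> cf) auto
    also have "\<dots> \<le> ennreal (\<Prod>i<n. exp (- (s * \<mu> i) + 4 * (s * \<mu> i)\<^sup>2))"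
    proof (intro ennreal_leI prod_mono conjI)
      fix i assume "i \<in> {..<n}"
      then have i: "i < n" by simp
      let ?x = "2 * (s * \<mu> i)"
      have "exp (?x - 2 * ?x\<^sup>2) \<le> 1 + ?x"
      proof (subst ln_ge_iff[symmetric])
        \<comment> \<open>The sharper bound with \<open>?x\<^sup>2\<close> is weakened so that both
          tails get the same exponent.\<close>
        have "?x - 2 * ?x\<^sup>2 \<le> ?x - ?x\<^sup>2" by simp
        also have "\<dots> \<le> ln (1 + ?x)"
          using small[OF i] by (intro ln_one_plus_pos_lower_bound) auto
        finally show "?x - 2 * ?x\<^sup>2 \<le> ln (1 + ?x)" .
      qed (use small[OF i] in auto)
      then have "sqrt (exp (?x - 2 * ?x\<^sup>2)) \<le> sqrt (1 + ?x)" by (rule real_sqrt_le_mono)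
      also have "sqrt (exp (?x - 2 * ?x\<^sup>2)) = exp (- (- (s * \<mu> i) + 4 * (s * \<mu> i)\<^sup>2))"
        by (rule real_sqrt_unique) (simp_all add: exp_double[symmetric] power_mult_distrib)
      finally show "1 / sqrt (1 + ?x) \<le> exp (- (s * \<mu> i) + 4 * (s * \<mu> i)\<^sup>2)"
        using small[OF i] by (intro inverse_le) auto
      show "0 \<le> 1 / sqrt (1 + ?x)" using small[OF i] by simp
    qed
    also have "(\<Prod>i<n. exp (- (s * \<mu> i) + 4 * (s * \<mu> i)\<^sup>2)) = exp (- s * T + (\<Sum>i<n. 4 * (s * \<mu> i)\<^sup>2))"
      by (simp add: exp_sum[symmetric] sum.distrib T_def sum_distrib_left sum_subtractf sum_negf)
    also have "ennreal \<dots> \<le> ennreal (exp (- s * T + 4 * s\<^sup>2 * \<Lambda> * T))"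
      using sq by (intro ennreal_leI) simp
    finally show "(\<integral>\<^sup>+\<omega>. ennreal (exp (- s * Q \<omega>)) \<partial>M) \<le> ennreal (exp (- s * T + 4 * s\<^sup>2 * \<Lambda> * T))" .
  qed simp
  have "{\<omega> \<in> space M. x \<le> \<bar>Q \<omega> - T\<bar>} \<subseteq>
      {\<omega> \<in> space M. s * (T + x) \<le> s * Q \<omega>} \<union> {\<omega> \<in> space M. - s * (T - x) \<le> - s * Q \<omega>}"
    using s0 by auto
  then have "prob {\<omega> \<in> space M. x \<le> \<bar>Q \<omega> - T\<bar>} \<le>
      prob ({\<omega> \<in> space M. s * (T + x) \<le> s * Q \<omega>} \<union> {\<omega> \<in> space M. - s * (T - x) \<le> - s * Q \<omega>})"
    by (intro finite_measure_mono) auto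
  also have "\<dots> \<le> prob {\<omega> \<in> space M. s * (T + x) \<le> s * Q \<omega>} + prob {\<omega> \<in> space M. - s * (T - x) \<le> - s * Q \<omega>}"
    by (intro measure_Un_le) auto
  also have "\<dots> \<le> 2 * exp (4 * s\<^sup>2 * \<Lambda> * T - s * x)"
    using up lo by (simp add: algebra_simps)
  finally show ?thesis by (simp add: Q_def T_def)
qed

section \<open>The spectral density of fractional Gaussian noise\<close>

lemma has_bochner_integral_on_Icc_0_powr:
  fixes q d :: real
  assumes "q > -1" "d \<ge> 0"
  shows "has_bochner_integral lborel (\<lambda>t. indicator {0..d} t * \<bar>t\<bar> powr q) (d powr (q + 1) / (q + 1))"
proof (rule has_bochner_integral_nn_integral)
  have "((\<lambda>t. t powr q) has_integral (d powr (q + 1) / (q + 1))) {0..d}"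
    by (rule has_integral_powr_from_0[OF assms])
  then have "((\<lambda>t. indicator {0..d} t * \<bar>t\<bar> powr q) has_integral (d powr (q + 1) / (q + 1))) UNIV"
    by (subst has_integral_restrict_UNIV[symmetric], subst (asm) has_integral_restrict_UNIV[symmetric])
       (auto elim!: has_integral_eq[rotated] simp: indicator_def)
  then show "(\<integral>\<^sup>+t. ennreal (indicator {0..d} t * \<bar>t\<bar> powr q) \<partial>lborel) = ennreal (d powr (q + 1) / (q + 1))"
    by (intro nn_integral_has_integral_lborel) auto
qed (use assms in auto)

lemma has_bochner_integral_on_atLeast_powr:
  fixes q :: real
  assumes "q < -1"
  shows "has_bochner_integral lborel (\<lambda>t. indicator {1..} t * \<bar>t\<bar> powr q) (- 1 / (q + 1))"
proof (rule has_bochner_integral_nn_integral)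
  have "((\<lambda>t. t powr q) has_integral (- (1 powr (q + 1)) / (q + 1))) {1..}"
    by (rule has_integral_powr_to_inf) (use assms in auto)
  then have "((\<lambda>t. indicator {1..} t * \<bar>t\<bar> powr q) has_integral (- 1 / (q + 1))) UNIV"
    by (subst has_integral_restrict_UNIV[symmetric], subst (asm) has_integral_restrict_UNIV[symmetric])
       (auto elim!: has_integral_eq[rotated] simp: indicator_def)
  then show "(\<integral>\<^sup>+t. ennreal (indicator {1..} t * \<bar>t\<bar> powr q) \<partial>lborel) = ennreal (- 1 / (q + 1))"
    by (intro nn_integral_has_integral_lborel) auto
qed (use assms in \<open>auto simp: divide_nonpos_neg\<close>)

lemma has_bochner_integral_reflect:
  fixes f :: "real \<Rightarrow> real"
  assumes "has_bochner_integral lborel f I"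
  shows "has_bochner_integral lborel (\<lambda>t. f (- t)) I"
  using lborel_has_bochner_integral_real_affine_iff[of "-1" f I 0] assms by simp

lemma has_bochner_integral_abs_powr:
  fixes q d :: real
  assumes "q > -1" "d \<ge> 0"
  shows "has_bochner_integral lborel (\<lambda>t. indicator {-d..d} t * \<bar>t\<bar> powr q) (2 * (d powr (q + 1) / (q + 1)))"
proof -
  have "has_bochner_integral lborel (\<lambda>t. indicator {0..d} t * \<bar>t\<bar> powr q + indicator {0..d} (- t) * \<bar>- t\<bar> powr q)
      (d powr (q + 1) / (q + 1) + d powr (q + 1) / (q + 1))"
    by (intro has_bochner_integral_add has_bochner_integral_on_Icc_0_powr assms
        has_bochner_integral_reflect[of "\<lambda>t. indicator {0..d} t * \<bar>t\<bar> powr q"])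
  moreover have "indicator {0..d} t * \<bar>t\<bar> powr q + indicator {0..d} (- t) * \<bar>- t\<bar> powr q =
      indicator {-d..d} t * \<bar>t\<bar> powr q" for t :: real
    by (auto simp: indicator_def)
  ultimately show ?thesis by simp
qed

lemma integrable_abs_powr_tail:
  fixes q :: real
  assumes "q < -1"
  shows "integrable lborel (\<lambda>t. indicator {t. \<bar>t\<bar> \<ge> 1} t * \<bar>t\<bar> powr q)"
proof -
  have "integrable lborel (\<lambda>t. indicator {1..} t * \<bar>t\<bar> powr q + indicator {1..} (- t) * \<bar>- t\<bar> powr q)"
    using has_bochner_integral_on_atLeast_powr[OF assms]
      has_bochner_integral_reflect[OF has_bochner_integral_on_atLeast_powr[OF assms]]
    by (intro Bochner_Integration.integrable_add) (auto simp: has_bochner_integral_iff)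
  moreover have "indicator {1..} t * \<bar>t\<bar> powr q + indicator {1..} (- t) * \<bar>- t\<bar> powr q =
      indicator {t. \<bar>t\<bar> \<ge> 1} t * \<bar>t\<bar> powr q" for t :: real
    by (auto simp: indicator_def)
  ultimately show ?thesis by simp
qed

section \<open>The Levy integral of a power weight\<close>

lemma one_minus_cos_le: "1 - cos t \<le> t\<^sup>2 / 2" for t :: real
proof -
  have "1 - cos t = 2 * (sin (t/2))\<^sup>2"
    using cos_double_sin[of "t/2"] by simp
  also have "(sin (t/2))\<^sup>2 \<le> (t/2)\<^sup>2"
    using abs_sin_x_le_abs_x[of "t/2"] by (simp only: abs_le_square_iff)
  finally show ?thesis by (simp add: power2_eq_square)
qed

text \<open>The constant in the Levy--Khintchine representation of
  \<open>\<bar>x\<bar> powr (2 * H)\<close>, the exponent of the symmetric stable law of index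
  \<open>2 * H\<close>.\<close>

definition levy_const :: "real \<Rightarrow> real" where
  "levy_const H = (LINT t|lborel. (1 - cos t) * \<bar>t\<bar> powr (- (2 * H + 1)))"

text \<open>Near 0 the factor \<open>1 - cos t\<close> is quadratic and leaves
  \<open>\<bar>t\<bar> powr (1 - 2 * H)\<close>, integrable because \<open>H < 1\<close>. At
  infinity it is at most 2, and \<open>H > 0\<close> gives integrability.\<close>

lemma integrable_levy:
  fixes H :: real
  assumes "0 < H" "H < 1"
  shows "integrable lborel (\<lambda>t. (1 - cos t) * \<bar>t\<bar> powr (- (2 * H + 1)))"
proof (rule Bochner_Integration.integrable_bound)
  show "integrable lborel (\<lambda>t. indicator {-1..1} t * \<bar>t\<bar> powr (1 - 2 * H) + 2 * (indicator {t. \<bar>t\<bar> \<ge> 1} t * \<bar>t\<bar> powr (- (2 * H + 1))))"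
    using has_bochner_integral_abs_powr[of "1 - 2 * H" 1] integrable_abs_powr_tail[of "- (2 * H + 1)"] assms
    by (intro Bochner_Integration.integrable_add integrable_mult_right) (auto simp: has_bochner_integral_iff)
  show "AE t in lborel. norm ((1 - cos t) * \<bar>t\<bar> powr (- (2 * H + 1))) \<le>
      norm (indicator {-1..1} t * \<bar>t\<bar> powr (1 - 2 * H) + 2 * (indicator {t. \<bar>t\<bar> \<ge> 1} t * \<bar>t\<bar> powr (- (2 * H + 1))))"
  proof (intro AE_I2)
    fix t :: real
    have c: "0 \<le> 1 - cos t" "1 - cos t \<le> 2" using cos_le_one[of t] cos_ge_minus_one[of t] by linarith+
    have "(1 - cos t) * \<bar>t\<bar> powr (- (2 * H + 1)) \<le>
      indicator {-1..1} t * \<bar>t\<bar> powr (1 - 2 * H) + 2 * (indicator {t. \<bar>t\<bar> \<ge> 1} t * \<bar>t\<bar> powr (- (2 * H + 1)))"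
    proof (cases "\<bar>t\<bar> \<ge> 1")
      case True
      have "(1 - cos t) * \<bar>t\<bar> powr (- (2 * H + 1)) \<le> 2 * \<bar>t\<bar> powr (- (2 * H + 1))"
        by (intro mult_right_mono c) auto
      moreover have "0 \<le> (indicator {-1..1} t :: real) * \<bar>t\<bar> powr (1 - 2 * H)" by simp
      ultimately show ?thesis using True by (simp add: add_increasing)
    next
      case False
      show ?thesis
      proof (cases "t = 0")
        case False
        have "(1 - cos t) * \<bar>t\<bar> powr (- (2 * H + 1)) \<le> t\<^sup>2 * \<bar>t\<bar> powr (- (2 * H + 1))"
          using one_minus_cos_le[of t] zero_le_power2[of t] by (intro mult_right_mono) (linarith, simp)
        also have t2: "t\<^sup>2 = \<bar>t\<bar> powr 2" using False by simp
        also have "\<bar>t\<bar> powr 2 * \<bar>t\<bar> powr (- (2 * H + 1)) = \<bar>t\<bar> powr (1 - 2 * H)"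
          unfolding powr_add[symmetric] by simp
        finally show ?thesis using \<open>\<not> \<bar>t\<bar> \<ge> 1\<close> by (auto simp: indicator_def)
      qed simp
    qed
    then show "norm ((1 - cos t) * \<bar>t\<bar> powr (- (2 * H + 1))) \<le>
      norm (indicator {-1..1} t * \<bar>t\<bar> powr (1 - 2 * H) + 2 * (indicator {t. \<bar>t\<bar> \<ge> 1} t * \<bar>t\<bar> powr (- (2 * H + 1))))"
      using c by (simp add: abs_mult)
  qed
qed measurable

lemma levy_const_pos:
  fixes H :: real
  assumes "0 < H" "H < 1"
  shows "levy_const H > 0"
proof -
  let ?f = "\<lambda>t::real. (1 - cos t) * \<bar>t\<bar> powr (- (2 * H + 1))"
  have nn: "0 \<le> ?f t" for t using cos_le_one[of t] by simp
  have "levy_const H \<noteq> 0"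
  proof
    assume "levy_const H = 0"
    then have "AE t in lborel. ?f t = 0"
      using integral_nonneg_eq_0_iff_AE[OF integrable_levy[OF assms]] nn by (simp add: levy_const_def)
    then have "AE t in lborel. t \<notin> {0<..<pi}"
    proof eventually_elim
      case (elim t)
      show ?case
      proof
        assume t: "t \<in> {0<..<pi}"
        then have "cos t < cos 0" by (intro cos_monotone_0_pi) auto
        with t elim show False by auto
      qed
    qed
    then have "emeasure lborel {0<..<pi} = 0"
      by (subst (asm) AE_iff_measurable[of "{0<..<pi}"]) auto
    then show False by simp
  qed
  moreover have "levy_const H \<ge> 0"
    unfolding levy_const_def by (intro integral_nonneg_AE AE_I2 nn)
  ultimately show ?thesis by simp
qed

text \<open>Substitute \<open>x * t\<close> for \<open>t\<close>: homogeneity of the weight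
  contributes \<open>\<bar>x\<bar> powr (2 * H + 1)\<close> and the Jacobian
  \<open>1 / \<bar>x\<bar>\<close>. The outcome is the variance function of fractional Brownian
  motion up to a constant.\<close>

lemma has_bochner_integral_levy:
  fixes x H :: real
  assumes "0 < H" "H < 1"
  shows "has_bochner_integral lborel (\<lambda>t. (1 - cos (x * t)) * \<bar>t\<bar> powr (- (2 * H + 1))) (\<bar>x\<bar> powr (2 * H) * levy_const H)"
proof (cases "x = 0")
  case True
  then show ?thesis by (simp add: has_bochner_integral_zero)
next
  case False
  let ?f = "\<lambda>t::real. (1 - cos t) * \<bar>t\<bar> powr (- (2 * H + 1))"
  have "has_bochner_integral lborel ?f (levy_const H)"
    using integrable_levy[OF assms] by (simp add: has_bochner_integral_iff levy_const_def)
  then have "has_bochner_integral lborel (\<lambda>t. ?f (x * t)) (levy_const H / \<bar>x\<bar>)"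
    using lborel_has_bochner_integral_real_affine_iff[of x ?f "levy_const H" 0] False
    by (simp add: divide_inverse mult.commute)
  then have "has_bochner_integral lborel (\<lambda>t. \<bar>x\<bar> powr (2 * H + 1) * ?f (x * t)) (\<bar>x\<bar> powr (2 * H + 1) * (levy_const H / \<bar>x\<bar>))"
    by (rule has_bochner_integral_mult_right)
  moreover have "\<bar>x\<bar> powr (2 * H + 1) * ?f (x * t) = (1 - cos (x * t)) * \<bar>t\<bar> powr (- (2 * H + 1))" for t
  proof -
    have "\<bar>x\<bar> powr (2 * H + 1) * \<bar>x\<bar> powr (- (2 * H + 1)) = 1"
      using False by (simp add: powr_add[symmetric])
    then have "\<bar>x\<bar> powr (2 * H + 1) * \<bar>x * t\<bar> powr (- (2 * H + 1)) = \<bar>t\<bar> powr (- (2 * H + 1))"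
      by (simp only: abs_mult powr_mult abs_ge_zero mult.assoc[symmetric] mult_1_left)
    then show ?thesis by (simp only: mult.left_commute)
  qed
  moreover have "\<bar>x\<bar> powr (2 * H + 1) * (levy_const H / \<bar>x\<bar>) = \<bar>x\<bar> powr (2 * H) * levy_const H"
    using False by (simp add: powr_add)
  ultimately show ?thesis by (simp only:)
qed

section \<open>The lattice sum\<close>

lemma summable_on_int_powr:
  fixes p :: real
  assumes "p < -1"
  shows "(\<lambda>k::int. \<bar>real_of_int k\<bar> powr p) summable_on UNIV"
proof -
  have nat: "(\<lambda>n::nat. real n powr p) summable_on UNIV"
    by (rule norm_summable_imp_summable_on) (use assms in \<open>simp add: summable_real_powr_iff\<close>)
  have r: "inj_on (\<lambda>n. int n) UNIV" "inj_on (\<lambda>n. - int n) UNIV"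
    by (auto simp: inj_on_def)
  have "(\<lambda>k::int. \<bar>real_of_int k\<bar> powr p) summable_on range (\<lambda>n. int n)"
    using nat by (subst summable_on_reindex[OF r(1)]) (simp add: o_def)
  moreover have "(\<lambda>k::int. \<bar>real_of_int k\<bar> powr p) summable_on range (\<lambda>n. - int n)"
    using nat by (subst summable_on_reindex[OF r(2)]) (simp add: o_def)
  moreover have "(UNIV :: int set) = range (\<lambda>n. int n) \<union> range (\<lambda>n. - int n)"
  proof -
    have "k \<in> range (\<lambda>n. int n) \<union> range (\<lambda>n. - int n)" for k :: int
      by (cases k rule: int_cases2) auto
    then show ?thesis by blast
  qed
  ultimately show ?thesis by (metis summable_on_Un_disjoint summable_on_union)
qed

lemma abs_minus_lattice_ge:
  fixes l :: real and k :: int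
  assumes "\<bar>l\<bar> \<le> pi" "k \<noteq> 0"
  shows "pi * \<bar>real_of_int k\<bar> \<le> \<bar>l - 2 * pi * real_of_int k\<bar>"
proof -
  have "1 \<le> \<bar>real_of_int k\<bar>" using assms(2) by linarith
  then have "pi \<le> pi * \<bar>real_of_int k\<bar>" by simp
  moreover have "\<bar>2 * pi * real_of_int k\<bar> = 2 * (pi * \<bar>real_of_int k\<bar>)" by (simp add: abs_mult)
  ultimately show ?thesis using assms(1) by linarith
qed

text \<open>The term \<open>k = 0\<close> is left out because it carries the singularity at 0; the
  rest is bounded and continuous on \<open>[-pi, pi]\<close>.\<close>

definition lattice_tail :: "real \<Rightarrow> real \<Rightarrow> real" where
  "lattice_tail p l = (\<Sum>\<^sub>\<infinity>k\<in>UNIV - {0::int}. \<bar>l - 2 * pi * real_of_int k\<bar> powr p)"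

lemma lattice_term_le:
  fixes l p :: real and k :: int
  assumes "p < 0" "\<bar>l\<bar> \<le> pi" "k \<noteq> 0"
  shows "\<bar>l - 2 * pi * real_of_int k\<bar> powr p \<le> pi powr p * \<bar>real_of_int k\<bar> powr p"
proof -
  have "\<bar>l - 2 * pi * real_of_int k\<bar> powr p \<le> (pi * \<bar>real_of_int k\<bar>) powr p"
    using assms abs_minus_lattice_ge[OF assms(2,3)] by (intro powr_mono2') auto
  then show ?thesis by (simp add: powr_mult)
qed

lemma summable_on_lattice_tail:
  fixes l p :: real
  assumes "p < -1" "\<bar>l\<bar> \<le> pi"
  shows "(\<lambda>k::int. \<bar>l - 2 * pi * real_of_int k\<bar> powr p) summable_on UNIV - {0}"
proof (rule summable_on_comparison_test)
  show "(\<lambda>k::int. pi powr p * \<bar>real_of_int k\<bar> powr p) summable_on UNIV - {0}"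
    by (intro summable_on_cmult_right summable_on_subset_banach[OF summable_on_int_powr] assms) auto
qed (use assms lattice_term_le[of p l] in auto)

lemma summable_on_lattice:
  fixes l p :: real
  assumes "p < -1" "\<bar>l\<bar> \<le> pi"
  shows "(\<lambda>k::int. \<bar>l - 2 * pi * real_of_int k\<bar> powr p) summable_on UNIV"
proof -
  have "(\<lambda>k::int. \<bar>l - 2 * pi * real_of_int k\<bar> powr p) summable_on insert 0 (UNIV - {0})"
    using summable_on_lattice_tail[OF assms] by (subst summable_on_insert_iff) auto
  then show ?thesis by (simp add: insert_absorb)
qed

lemma lattice_sum_split:
  fixes l p :: real
  assumes "p < -1" "\<bar>l\<bar> \<le> pi"
  shows "(\<Sum>\<^sub>\<infinity>k::int. \<bar>l - 2 * pi * real_of_int k\<bar> powr p) = \<bar>l\<bar> powr p + lattice_tail p l"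
proof -
  have "(\<Sum>\<^sub>\<infinity>k\<in>insert 0 (UNIV - {0::int}). \<bar>l - 2 * pi * real_of_int k\<bar> powr p) = \<bar>l\<bar> powr p + lattice_tail p l"
    unfolding lattice_tail_def using summable_on_lattice_tail[OF assms]
    by (subst infsum_insert) auto
  then show ?thesis by (simp add: insert_absorb)
qed

lemma lattice_tail_nonneg: "0 \<le> lattice_tail p l"
  unfolding lattice_tail_def by (intro infsum_nonneg) auto

lemma lattice_tail_bounded:
  fixes p :: real
  assumes "p < -1"
  shows "\<exists>B\<ge>0. \<forall>l. \<bar>l\<bar> \<le> pi \<longrightarrow> lattice_tail p l \<le> B"
proof (intro exI conjI allI impI)
  let ?B = "\<Sum>\<^sub>\<infinity>k\<in>UNIV - {0::int}. pi powr p * \<bar>real_of_int k\<bar> powr p"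
  show "0 \<le> ?B" by (intro infsum_nonneg) auto
  fix l :: real assume l: "\<bar>l\<bar> \<le> pi"
  show "lattice_tail p l \<le> ?B" unfolding lattice_tail_def
  proof (rule infsum_mono)
    show "(\<lambda>k::int. pi powr p * \<bar>real_of_int k\<bar> powr p) summable_on UNIV - {0}"
      by (intro summable_on_cmult_right summable_on_subset_banach[OF summable_on_int_powr] assms) auto
  qed (use assms l lattice_term_le[of p l] summable_on_lattice_tail[OF assms l] in auto)
qed

text \<open>Weierstrass M-test along the net of finite index sets; each term is continuous since its
  base is at least \<open>pi * \<bar>k\<bar>\<close>.\<close>

lemma continuous_on_lattice_tail:
  fixes p :: real
  assumes "p < -1"
  shows "continuous_on {-pi..pi} (lattice_tail p)"
proof -
  have "uniform_limit {-pi..pi} (\<lambda>X l. \<Sum>k\<in>X. \<bar>l - 2 * pi * real_of_int k\<bar> powr p)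
      (\<lambda>l. \<Sum>\<^sub>\<infinity>k\<in>UNIV - {0::int}. \<bar>l - 2 * pi * real_of_int k\<bar> powr p) (finite_subsets_at_top (UNIV - {0}))"
  proof (rule Weierstrass_m_test_general)
    show "(\<lambda>k::int. pi powr p * \<bar>real_of_int k\<bar> powr p) summable_on UNIV - {0}"
      by (intro summable_on_cmult_right summable_on_subset_banach[OF summable_on_int_powr] assms) auto
  qed (use assms lattice_term_le[of p] in \<open>auto simp: abs_le_iff\<close>)
  then show ?thesis unfolding lattice_tail_def[abs_def]
  proof (rule uniform_limit_theorem[rotated])
    show "\<forall>\<^sub>F X in finite_subsets_at_top (UNIV - {0}).
        continuous_on {-pi..pi} (\<lambda>l. \<Sum>k\<in>X. \<bar>l - 2 * pi * real_of_int k\<bar> powr p)"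
    proof (rule eventually_finite_subsets_at_top_weakI)
      fix X :: "int set" assume X: "finite X" "X \<subseteq> UNIV - {0}"
      have nz: "\<bar>l - 2 * pi * real_of_int k\<bar> \<noteq> 0" if "l \<in> {-pi..pi}" "k \<in> X" for l k
      proof -
        have "k \<noteq> 0" using X that by auto
        then have "0 < pi * \<bar>real_of_int k\<bar>" by simp
        also have "\<dots> \<le> \<bar>l - 2 * pi * real_of_int k\<bar>"
          using that \<open>k \<noteq> 0\<close> by (intro abs_minus_lattice_ge) auto
        finally show ?thesis by simp
      qed
      show "continuous_on {-pi..pi} (\<lambda>l. \<Sum>k\<in>X. \<bar>l - 2 * pi * real_of_int k\<bar> powr p)"
        using nz by (intro continuous_intros) auto
    qed
  qed (auto simp: finite_subsets_at_top_neq_bot)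
qed

section \<open>Size and regularity of the unnormalised density\<close>

lemma cmod_cis_minus_1_squared: "(cmod (cis t - 1))\<^sup>2 = 2 - 2 * cos t"
proof -
  have "(cmod (cis t - 1))\<^sup>2 = (cos t - 1)\<^sup>2 + (sin t)\<^sup>2"
    by (simp add: cmod_power2)
  also have "\<dots> = 2 - 2 * cos t"
    using sin_cos_squared_add[of t] by (simp add: power2_eq_square algebra_simps)
  finally show ?thesis .
qed

lemma fgn_raw_eq:
  assumes "H > 0" "\<bar>l\<bar> \<le> pi"
  shows "fgn_raw H l = (2 - 2 * cos l) * (\<bar>l\<bar> powr (- (2 * H + 1)) + lattice_tail (- (2 * H + 1)) l)"
  unfolding fgn_raw_def cmod_cis_minus_1_squared using assms by (subst lattice_sum_split) auto

text \<open>The vanishing first factor decides the value at 0, even when the density is unbounded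
  nearby. This agrees with \<open>0 powr q = 0\<close>, so the power bounds also hold at 0.\<close>

lemma fgn_raw_0: "fgn_raw H 0 = 0"
  by (simp add: fgn_raw_def)

lemma fgn_raw_even: "fgn_raw H (- l) = fgn_raw H l"
proof -
  have "(\<Sum>\<^sub>\<infinity>k::int. \<bar>- l - 2 * pi * real_of_int k\<bar> powr (- (2 * H + 1))) =
      (\<Sum>\<^sub>\<infinity>k::int. \<bar>- l - 2 * pi * real_of_int (- k)\<bar> powr (- (2 * H + 1)))"
    by (rule infsum_reindex_bij_witness[of UNIV uminus uminus]) auto
  also have "\<dots> = (\<Sum>\<^sub>\<infinity>k::int. \<bar>l - 2 * pi * real_of_int k\<bar> powr (- (2 * H + 1)))"
    by (intro infsum_cong) (simp add: abs_if)
  finally show ?thesis by (simp add: fgn_raw_def cmod_cis_minus_1_squared)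
qed

lemma fgn_raw_nonneg: "0 \<le> fgn_raw H l"
  unfolding fgn_raw_def by (intro mult_nonneg_nonneg infsum_nonneg) auto

text \<open>Write \<open>1 - cos t\<close> as \<open>2 * (sin (t / 2))\<^sup>2\<close> and apply
  Jordan's inequality, which says that the concave sine lies above its chord on
  \<open>[0, pi / 2]\<close>.\<close>

lemma one_minus_cos_ge:
  assumes "\<bar>t\<bar> \<le> pi"
  shows "2 / pi\<^sup>2 * t\<^sup>2 \<le> 1 - cos t"
proof -
  have jordan: "2 / pi * x \<le> sin x" if "0 \<le> x" "x \<le> pi / 2" for x
  proof -
    have "concave_on {0..pi} sin"
      unfolding concave_on_def
    proof (rule f''_ge0_imp_convex[where f' = "\<lambda>x. - cos x" and f'' = "\<lambda>x. sin x"])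
      show "\<And>x. x \<in> {0..pi} \<Longrightarrow> 0 \<le> sin x" by (auto intro: sin_ge_zero)
    qed (auto intro!: derivative_eq_intros)
    then have "(1 - 2 * x / pi) * sin 0 + (2 * x / pi) * sin (pi / 2) \<le> sin ((1 - 2 * x / pi) *\<^sub>R 0 + (2 * x / pi) *\<^sub>R (pi / 2))"
      using that by (intro concave_onD) (auto simp: field_simps)
    then show ?thesis by simp
  qed
  have "2 / pi * \<bar>t / 2\<bar> \<le> sin \<bar>t / 2\<bar>"
    by (rule jordan) (use assms in auto)
  then have "(\<bar>t\<bar> / pi)\<^sup>2 \<le> (sin \<bar>t / 2\<bar>)\<^sup>2"
    by (intro power_mono) auto
  also have "(sin \<bar>t / 2\<bar>)\<^sup>2 = (sin (t / 2))\<^sup>2" by (simp add: abs_if)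
  finally have "2 * (\<bar>t\<bar> / pi)\<^sup>2 \<le> 2 * (sin (t / 2))\<^sup>2" by simp
  also have "2 * (sin (t / 2))\<^sup>2 = 1 - cos t"
    using cos_double_sin[of "t/2"] by simp
  finally show ?thesis by (simp add: power_divide)
qed

lemma abs_powr_times_square:
  fixes t q :: real
  shows "t\<^sup>2 * \<bar>t\<bar> powr q = \<bar>t\<bar> powr (q + 2)"
  by (cases "t = 0") (simp_all add: powr_add)

text \<open>The term \<open>k = 0\<close> suffices. The constant is twice the one in
  \<open>one_minus_cos_ge\<close>.\<close>

lemma fgn_raw_lower:
  assumes "H > 0" "\<bar>l\<bar> \<le> pi"
  shows "4 / pi\<^sup>2 * \<bar>l\<bar> powr (1 - 2 * H) \<le> fgn_raw H l"
proof -
  have "4 / pi\<^sup>2 * \<bar>l\<bar> powr (1 - 2 * H) = 4 / pi\<^sup>2 * (l\<^sup>2 * \<bar>l\<bar> powr (- (2 * H + 1)))"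
    by (simp add: abs_powr_times_square)
  also have "\<dots> = (4 / pi\<^sup>2 * l\<^sup>2) * \<bar>l\<bar> powr (- (2 * H + 1))"
    by simp
  also have "\<dots> \<le> (2 - 2 * cos l) * (\<bar>l\<bar> powr (- (2 * H + 1)) + lattice_tail (- (2 * H + 1)) l)"
    using one_minus_cos_ge[OF assms(2)] lattice_tail_nonneg
    by (intro mult_mono) auto
  finally show ?thesis using fgn_raw_eq[OF assms] by simp
qed

lemma fgn_raw_upper:
  assumes "H > 0"
  shows "\<exists>C>0. \<forall>l. \<bar>l\<bar> \<le> pi \<longrightarrow> fgn_raw H l \<le> C * \<bar>l\<bar> powr (1 - 2 * H)"
proof -
  let ?p = "- (2 * H + 1)"
  obtain B where B: "B \<ge> 0" "\<And>l. \<bar>l\<bar> \<le> pi \<Longrightarrow> lattice_tail ?p l \<le> B"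
    using lattice_tail_bounded[of ?p] assms by auto
  show ?thesis
  proof (intro exI[of _ "1 + B * pi powr (2 * H + 1)"] conjI allI impI)
    show "0 < 1 + B * pi powr (2 * H + 1)" using B by (intro add_pos_nonneg) auto
    fix l :: real assume l: "\<bar>l\<bar> \<le> pi"
    have "fgn_raw H l \<le> l\<^sup>2 * (\<bar>l\<bar> powr ?p + B)"
      unfolding fgn_raw_eq[OF assms l] using one_minus_cos_le[of l] B(2)[OF l] lattice_tail_nonneg[of ?p l]
      by (intro mult_mono) auto
    also have "\<dots> = \<bar>l\<bar> powr (1 - 2 * H) + B * l\<^sup>2"
      using abs_powr_times_square[of l ?p] by (simp add: algebra_simps)
    \<comment> \<open>The tail contributes only \<open>B * l\<^sup>2\<close>, which is absorbed into
      the power because \<open>\<bar>l\<bar> powr (2 * H + 1)\<close> is at most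
      \<open>pi powr (2 * H + 1)\<close>.\<close>
    also have "B * l\<^sup>2 \<le> B * (\<bar>l\<bar> powr (1 - 2 * H) * pi powr (2 * H + 1))"
    proof (rule mult_left_mono[OF _ B(1)])
      have "l\<^sup>2 = \<bar>l\<bar> powr (1 - 2 * H) * \<bar>l\<bar> powr (2 * H + 1)"
        by (cases "l = 0") (simp_all add: powr_add[symmetric])
      also have "\<dots> \<le> \<bar>l\<bar> powr (1 - 2 * H) * pi powr (2 * H + 1)"
        using assms l by (intro mult_left_mono powr_mono2) auto
      finally show "l\<^sup>2 \<le> \<bar>l\<bar> powr (1 - 2 * H) * pi powr (2 * H + 1)" .
    qed
    finally show "fgn_raw H l \<le> (1 + B * pi powr (2 * H + 1)) * \<bar>l\<bar> powr (1 - 2 * H)"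
      by (simp add: algebra_simps)
  qed
qed

lemma continuous_on_fgn_raw:
  assumes "H > 0"
  shows "continuous_on ({-pi<..<pi} - {0}) (fgn_raw H)"
proof -
  have "continuous_on ({-pi<..<pi} - {0}) (\<lambda>l. (2 - 2 * cos l) * (\<bar>l\<bar> powr (- (2 * H + 1)) + lattice_tail (- (2 * H + 1)) l))"
    using assms
    by (intro continuous_intros continuous_on_subset[OF continuous_on_lattice_tail]) auto
  then show ?thesis
    by (rule continuous_on_eq) (use assms in \<open>auto simp: fgn_raw_eq\<close>)
qed

section \<open>Unfolding to the line and the normalising constant\<close>

lemma lattice_translate_unique:
  "\<exists>!k::int. t + 2 * pi * real_of_int k \<in> {-pi..<pi}"
proof -
  have eq: "t + 2 * pi * real_of_int k \<in> {-pi..<pi} \<longleftrightarrow> \<lfloor>(t + pi) / (2 * pi)\<rfloor> = - k" for k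
  proof -
    have "\<lfloor>(t + pi) / (2 * pi)\<rfloor> = - k \<longleftrightarrow> - real_of_int k \<le> (t + pi) / (2 * pi) \<and> (t + pi) / (2 * pi) < - real_of_int k + 1"
      by (simp add: floor_eq_iff)
    also have "\<dots> \<longleftrightarrow> - real_of_int k * (2 * pi) \<le> t + pi \<and> t + pi < (- real_of_int k + 1) * (2 * pi)"
      by (simp add: pos_le_divide_eq pos_divide_less_eq)
    finally show ?thesis by (auto simp: algebra_simps)
  qed
  show ?thesis unfolding eq by (rule ex1I[of _ "- \<lfloor>(t + pi) / (2 * pi)\<rfloor>"]) auto
qed

text \<open>The translates of \<open>[-pi, pi)\<close> by multiples of \<open>2 * pi\<close> tile
  the line. Inserting this partition of unity, exchanging sum and integral by Tonelli and
  translating each piece back gives the claim.\<close>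

lemma nn_integral_periodise:
  fixes G :: "real \<Rightarrow> ennreal"
  assumes [measurable]: "G \<in> borel_measurable borel"
  shows "(\<integral>\<^sup>+t. G t \<partial>lborel) =
    (\<integral>\<^sup>+t. (\<integral>\<^sup>+k. G (t - 2 * pi * real_of_int k) \<partial>count_space UNIV) * indicator {-pi..<pi} t \<partial>lborel)"
proof -
  let ?C = "count_space (UNIV :: int set)"
  interpret C: sigma_finite_measure ?C by (rule sigma_finite_measure_count_space_countable) auto
  interpret P: pair_sigma_finite ?C lborel ..
  have [measurable]: "(\<lambda>x. real_of_int (fst x)) \<in> borel_measurable (?C \<Otimes>\<^sub>M lborel)"
    by (rule measurable_compose[OF measurable_fst]) simp
  have one: "(\<integral>\<^sup>+k. indicator {-pi..<pi} (t + 2 * pi * real_of_int k) \<partial>?C) = (1::ennreal)" for t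
  proof -
    obtain k0 :: int where k0: "\<And>k. t + 2 * pi * real_of_int k \<in> {-pi..<pi} \<longleftrightarrow> k = k0"
      using lattice_translate_unique[of t] by metis
    have "indicator {-pi..<pi} (t + 2 * pi * real_of_int k) = (indicator {k0} k :: ennreal)" for k
      using k0[of k] by (simp add: indicator_def)
    then have "(\<integral>\<^sup>+k. indicator {-pi..<pi} (t + 2 * pi * real_of_int k) \<partial>?C) = (\<integral>\<^sup>+k. (indicator {k0} k :: ennreal) \<partial>?C)"
      by simp
    also have "\<dots> = 1" by (subst nn_integral_indicator) auto
    finally show ?thesis .
  qed
  have "(\<integral>\<^sup>+t. G t \<partial>lborel) = (\<integral>\<^sup>+t. (\<integral>\<^sup>+k. G t * indicator {-pi..<pi} (t + 2 * pi * real_of_int k) \<partial>?C) \<partial>lborel)"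
    by (simp add: nn_integral_cmult one)
  also have "\<dots> = (\<integral>\<^sup>+k. (\<integral>\<^sup>+t. G t * indicator {-pi..<pi} (t + 2 * pi * real_of_int k) \<partial>lborel) \<partial>?C)"
    by (rule P.Fubini') (simp add: case_prod_beta)
  also have "\<dots> = (\<integral>\<^sup>+k. (\<integral>\<^sup>+t. G (t - 2 * pi * real_of_int k) * indicator {-pi..<pi} t \<partial>lborel) \<partial>?C)"
  proof (rule nn_integral_cong)
    fix k :: int
    show "(\<integral>\<^sup>+t. G t * indicator {-pi..<pi} (t + 2 * pi * real_of_int k) \<partial>lborel) =
        (\<integral>\<^sup>+t. G (t - 2 * pi * real_of_int k) * indicator {-pi..<pi} t \<partial>lborel)"
      by (subst nn_integral_real_affine[where c = 1 and t = "- 2 * pi * real_of_int k"]) (auto simp: algebra_simps)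
  qed
  also have "\<dots> = (\<integral>\<^sup>+t. (\<integral>\<^sup>+k. G (t - 2 * pi * real_of_int k) * indicator {-pi..<pi} t \<partial>?C) \<partial>lborel)"
    by (rule P.Fubini'[symmetric]) (simp add: case_prod_beta)
  also have "\<dots> = (\<integral>\<^sup>+t. (\<integral>\<^sup>+k. G (t - 2 * pi * real_of_int k) \<partial>?C) * indicator {-pi..<pi} t \<partial>lborel)"
    by (simp add: nn_integral_multc)
  finally show ?thesis .
qed

text \<open>Passes from the integral over counting measure, the form in which Tonelli delivers the
  sum, to the unordered sum in \<open>fgn_raw\<close>.\<close>

lemma nn_integral_count_space_lattice:
  assumes "H > 0" "\<bar>l\<bar> \<le> pi"
  shows "(\<integral>\<^sup>+k. ennreal (\<bar>l - 2 * pi * real_of_int k\<bar> powr (- (2 * H + 1))) \<partial>count_space UNIV) =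
    ennreal (\<Sum>\<^sub>\<infinity>k::int. \<bar>l - 2 * pi * real_of_int k\<bar> powr (- (2 * H + 1)))"
proof -
  let ?f = "\<lambda>k::int. \<bar>l - 2 * pi * real_of_int k\<bar> powr (- (2 * H + 1))"
  have "?f summable_on UNIV" using assms by (intro summable_on_lattice) auto
  then have a: "Infinite_Set_Sum.abs_summable_on ?f UNIV"
    by (simp add: abs_summable_equivalent[symmetric])
  have "(\<integral>\<^sup>+k. ennreal (?f k) \<partial>count_space UNIV) = ennreal (LINT k|count_space UNIV. ?f k)"
    using a unfolding Infinite_Set_Sum.abs_summable_on_def by (intro nn_integral_eq_integral) auto
  also have "(LINT k|count_space UNIV. ?f k) = infsetsum ?f UNIV" by (simp add: infsetsum_def)
  also have "\<dots> = infsum ?f UNIV" by (rule infsetsum_infsum[OF a])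
  finally show ?thesis .
qed

text \<open>The factor \<open>1 + cos (m t)\<close> is non-negative and \<open>2 \<pi>\<close>-periodic, so that the integral over a
  period unfolds without any integrability assumption.\<close>

lemma nn_integral_fgn_raw_unfold:
  assumes "H > 0"
  shows "(\<integral>\<^sup>+t. ennreal (indicator {-pi..<pi} t * ((1 + cos (real_of_int m * t)) * fgn_raw H t)) \<partial>lborel) =
    (\<integral>\<^sup>+t. ennreal ((1 + cos (real_of_int m * t)) * (2 - 2 * cos t) * \<bar>t\<bar> powr (- (2 * H + 1))) \<partial>lborel)"
proof -
  define w where "w = (\<lambda>t. (1 + cos (real_of_int m * t)) * (2 - 2 * cos t))"
  have c1: "cos x \<le> 1" "- 1 \<le> cos x" for x :: real by auto
  have wn: "0 \<le> w t" for t unfolding w_def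
    using c1(1)[of t] c1(2)[of "real_of_int m * t"] by (intro mult_nonneg_nonneg) linarith+
  have per: "w (t - 2 * pi * real_of_int k) = w t" for t k
  proof -
    have 1: "cos (t - 2 * pi * real_of_int k) = cos t"
      using cos_int_2pin[of k] sin_int_2pin[of k] by (simp add: cos_diff)
    have "real_of_int m * (t - 2 * pi * real_of_int k) = real_of_int m * t - 2 * pi * real_of_int (m * k)"
      by (simp add: algebra_simps)
    then have "cos (real_of_int m * (t - 2 * pi * real_of_int k)) = cos (real_of_int m * t)"
      using cos_int_2pin[of "m * k"] sin_int_2pin[of "m * k"] by (simp add: cos_diff)
    with 1 show ?thesis by (simp add: w_def)
  qed
  have "(\<integral>\<^sup>+t. ennreal (w t * \<bar>t\<bar> powr (- (2 * H + 1))) \<partial>lborel) =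
    (\<integral>\<^sup>+t. (\<integral>\<^sup>+k. ennreal (w (t - 2 * pi * real_of_int k) * \<bar>t - 2 * pi * real_of_int k\<bar> powr (- (2 * H + 1)))
       \<partial>count_space UNIV) * indicator {-pi..<pi} t \<partial>lborel)"
    by (rule nn_integral_periodise) (simp add: w_def)
  also have "\<dots> = (\<integral>\<^sup>+t. ennreal (indicator {-pi..<pi} t * ((1 + cos (real_of_int m * t)) * fgn_raw H t)) \<partial>lborel)"
  proof (rule nn_integral_cong)
    fix t :: real
    show "(\<integral>\<^sup>+k. ennreal (w (t - 2 * pi * real_of_int k) * \<bar>t - 2 * pi * real_of_int k\<bar> powr (- (2 * H + 1)))
       \<partial>count_space UNIV) * indicator {-pi..<pi} t = ennreal (indicator {-pi..<pi} t * ((1 + cos (real_of_int m * t)) * fgn_raw H t))"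
    proof (cases "t \<in> {-pi..<pi}")
      case True
      then have t: "\<bar>t\<bar> \<le> pi" by auto
      have "(\<integral>\<^sup>+k. ennreal (w (t - 2 * pi * real_of_int k) * \<bar>t - 2 * pi * real_of_int k\<bar> powr (- (2 * H + 1))) \<partial>count_space UNIV) =
          ennreal (w t) * (\<integral>\<^sup>+k. ennreal (\<bar>t - 2 * pi * real_of_int k\<bar> powr (- (2 * H + 1))) \<partial>count_space UNIV)"
        by (simp add: per ennreal_mult wn nn_integral_cmult)
      also have "\<dots> = ennreal (w t * (\<Sum>\<^sub>\<infinity>k::int. \<bar>t - 2 * pi * real_of_int k\<bar> powr (- (2 * H + 1))))"
        unfolding nn_integral_count_space_lattice[OF assms t] by (intro ennreal_mult[symmetric] wn infsum_nonneg) simp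
      also have "\<dots> = ennreal ((1 + cos (real_of_int m * t)) * fgn_raw H t)"
        by (simp add: w_def fgn_raw_def cmod_cis_minus_1_squared mult.assoc)
      finally show ?thesis using True by simp
    qed simp
  qed
  finally show ?thesis by (simp add: w_def)
qed

lemma borel_measurable_fgn_raw:
  assumes "H > 0"
  shows "(\<lambda>t. indicator {-pi..<pi} t * fgn_raw H t) \<in> borel_measurable borel"
proof -
  have [measurable]: "(\<lambda>t. indicator ({-pi<..<pi} - {0}) t *\<^sub>R fgn_raw H t) \<in> borel_measurable borel"
    by (rule borel_measurable_continuous_on_indicator[OF _ continuous_on_fgn_raw[OF assms]]) auto
  \<comment> \<open>Continuity covers the open interval without 0. The endpoint \<open>- pi\<close>
    is added as a one-point function, and at 0 the density vanishes.\<close>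
  have "(\<lambda>t. indicator ({-pi<..<pi} - {0}) t *\<^sub>R fgn_raw H t + indicator {-pi} t * fgn_raw H (- pi)) \<in> borel_measurable borel"
    by measurable
  also have "(\<lambda>t. indicator ({-pi<..<pi} - {0}) t *\<^sub>R fgn_raw H t + indicator {-pi} t * fgn_raw H (- pi)) =
      (\<lambda>t. indicator {-pi..<pi} t * fgn_raw H t)"
    by (rule ext) (auto simp: indicator_def fgn_raw_0)
  finally show ?thesis .
qed

lemma fgn_cov_eq:
  assumes "H > 0"
  shows "fgn_cov H m = (\<bar>real_of_int m + 1\<bar> powr (2 * H) - 2 * \<bar>real_of_int m\<bar> powr (2 * H)
      + \<bar>real_of_int m - 1\<bar> powr (2 * H)) / 2"
  by (simp add: fgn_cov_def fbm_cov_def field_simps)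

text \<open>After unfolding, \<open>(1 + cos (m t)) (2 - 2 cos t)\<close> equals \<open>2 (1 - cos
  t) + (1 - cos ((m + 1) t)) + (1 - cos ((m - 1) t)) - 2 (1 - cos (m t))\<close>. Each summand is
  separately integrable against the power weight, and the last three produce the second difference
  of \<open>\<bar>x\<bar> powr (2 * H)\<close> at \<open>m\<close>, that is, the covariance.\<close>

lemma has_bochner_integral_fgn_raw_weighted:
  assumes H: "0 < H" "H < 1"
  shows "has_bochner_integral lborel (\<lambda>t. indicator {-pi..<pi} t * ((1 + cos (real_of_int m * t)) * fgn_raw H t))
    (2 * levy_const H * (1 + fgn_cov H m))"
proof (rule has_bochner_integral_nn_integral)
  let ?p = "- (2 * H + 1)" and ?K = "levy_const H" and ?m = "real_of_int m"
  let ?w = "\<lambda>t::real. (1 + cos (?m * t)) * (2 - 2 * cos t) * \<bar>t\<bar> powr ?p"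
  have c1: "cos x \<le> 1" "- 1 \<le> cos x" for x :: real by auto
  have nn: "0 \<le> 1 + cos (?m * t)" for t using c1(2)[of "?m * t"] by linarith
  have L: "has_bochner_integral lborel (\<lambda>t. (1 - cos (x * t)) * \<bar>t\<bar> powr ?p) (\<bar>x\<bar> powr (2 * H) * ?K)" for x
    by (rule has_bochner_integral_levy[OF H])
  have "has_bochner_integral lborel
      (\<lambda>t. 2 * ((1 - cos (1 * t)) * \<bar>t\<bar> powr ?p) + (1 - cos ((?m + 1) * t)) * \<bar>t\<bar> powr ?p
         + (1 - cos ((?m - 1) * t)) * \<bar>t\<bar> powr ?p - 2 * ((1 - cos (?m * t)) * \<bar>t\<bar> powr ?p))
      (2 * (\<bar>1\<bar> powr (2 * H) * ?K) + \<bar>?m + 1\<bar> powr (2 * H) * ?K + \<bar>?m - 1\<bar> powr (2 * H) * ?K - 2 * (\<bar>?m\<bar> powr (2 * H) * ?K))"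
    by (intro has_bochner_integral_add has_bochner_integral_diff has_bochner_integral_mult_right L)
  also have "(\<lambda>t. 2 * ((1 - cos (1 * t)) * \<bar>t\<bar> powr ?p) + (1 - cos ((?m + 1) * t)) * \<bar>t\<bar> powr ?p
         + (1 - cos ((?m - 1) * t)) * \<bar>t\<bar> powr ?p - 2 * ((1 - cos (?m * t)) * \<bar>t\<bar> powr ?p)) = ?w"
  proof (rule ext)
    fix t :: real
    have "cos ((?m + 1) * t) + cos ((?m - 1) * t) = 2 * cos (?m * t) * cos t"
      by (simp add: algebra_simps cos_add cos_diff)
    then have e: "cos ((?m + 1) * t) = 2 * cos (?m * t) * cos t - cos ((?m - 1) * t)" by simp
    show "2 * ((1 - cos (1 * t)) * \<bar>t\<bar> powr ?p) + (1 - cos ((?m + 1) * t)) * \<bar>t\<bar> powr ?p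
         + (1 - cos ((?m - 1) * t)) * \<bar>t\<bar> powr ?p - 2 * ((1 - cos (?m * t)) * \<bar>t\<bar> powr ?p) = ?w t"
      unfolding e by (simp add: algebra_simps)
  qed
  also have "2 * (\<bar>1\<bar> powr (2 * H) * ?K) + \<bar>?m + 1\<bar> powr (2 * H) * ?K + \<bar>?m - 1\<bar> powr (2 * H) * ?K - 2 * (\<bar>?m\<bar> powr (2 * H) * ?K) =
      2 * ?K * (1 + fgn_cov H m)"
    using H by (simp add: fgn_cov_eq field_simps)
  finally have *: "has_bochner_integral lborel ?w (2 * ?K * (1 + fgn_cov H m))" .
  have wn: "0 \<le> ?w t" for t
    using nn[of t] c1(1)[of t] by (intro mult_nonneg_nonneg) auto
  show "(\<integral>\<^sup>+t. ennreal (indicator {-pi..<pi} t * ((1 + cos (?m * t)) * fgn_raw H t)) \<partial>lborel) = ennreal (2 * ?K * (1 + fgn_cov H m))"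
    unfolding nn_integral_fgn_raw_unfold[OF H(1)]
    using * wn by (subst nn_integral_eq_integral) (auto simp: has_bochner_integral_iff)
  show "0 \<le> 2 * ?K * (1 + fgn_cov H m)"
    using * integral_nonneg_AE[of ?w lborel] wn by (auto simp: has_bochner_integral_iff)
  show "AE t in lborel. 0 \<le> indicator {-pi..<pi} t * ((1 + cos (?m * t)) * fgn_raw H t)"
    using nn fgn_raw_nonneg by (intro AE_I2 mult_nonneg_nonneg) auto
  have [measurable]: "(\<lambda>t. indicator {-pi..<pi} t * fgn_raw H t) \<in> borel_measurable borel"
    by (rule borel_measurable_fgn_raw[OF H(1)])
  have "(\<lambda>t. (1 + cos (?m * t)) * (indicator {-pi..<pi} t * fgn_raw H t)) \<in> borel_measurable lborel"
    by measurable
  then show "(\<lambda>t. indicator {-pi..<pi} t * ((1 + cos (?m * t)) * fgn_raw H t)) \<in> borel_measurable lborel"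
    by (simp add: mult_ac)
qed

lemma fgn_cov_0: "H > 0 \<Longrightarrow> fgn_cov H 0 = 1"
  by (simp add: fgn_cov_eq)

lemma integrable_fgn_raw:
  assumes H: "0 < H" "H < 1"
  shows "integrable lborel (\<lambda>t. indicator {-pi..<pi} t * fgn_raw H t)"
proof -
  have "integrable lborel (\<lambda>t. indicator {-pi..<pi} t * (2 * fgn_raw H t))"
    using has_bochner_integral_fgn_raw_weighted[OF H, of 0] by (simp add: has_bochner_integral_iff)
  then have "integrable lborel (\<lambda>t. 1/2 * (indicator {-pi..<pi} t * (2 * fgn_raw H t)))"
    by (rule integrable_mult_right)
  then show ?thesis by simp
qed

text \<open>Half of the case \<open>m = 0\<close> is the integral of the density itself; subtracting
  it removes the 1 that had been added for non-negativity.\<close>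

lemma has_bochner_integral_cos_fgn_raw:
  assumes H: "0 < H" "H < 1"
  shows "has_bochner_integral lborel (\<lambda>t. indicator {-pi..<pi} t * (cos (real_of_int m * t) * fgn_raw H t))
    (2 * levy_const H * fgn_cov H m)"
proof -
  have "has_bochner_integral lborel (\<lambda>t. 1/2 * (indicator {-pi..<pi} t * ((1 + cos (real_of_int 0 * t)) * fgn_raw H t)))
     (1/2 * (2 * levy_const H * (1 + fgn_cov H 0)))"
    by (intro has_bochner_integral_mult_right has_bochner_integral_fgn_raw_weighted[OF H])
  from has_bochner_integral_diff[OF has_bochner_integral_fgn_raw_weighted[OF H, of m] this]
  show ?thesis using H by (simp add: algebra_simps fgn_cov_0)
qed

lemma integrable_fgn_raw_bounded:
  assumes H: "0 < H" "H < 1" and [measurable]: "w \<in> borel_measurable borel" and b: "\<And>t. \<bar>w t\<bar> \<le> 1"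
  shows "integrable lborel (\<lambda>t. indicator {-pi..<pi} t * (w t * fgn_raw H t))"
proof (rule Bochner_Integration.integrable_bound[OF integrable_fgn_raw[OF H]])
  have [measurable]: "(\<lambda>t. indicator {-pi..<pi} t * fgn_raw H t) \<in> borel_measurable borel"
    by (rule borel_measurable_fgn_raw[OF H(1)])
  have "(\<lambda>t. w t * (indicator {-pi..<pi} t * fgn_raw H t)) \<in> borel_measurable lborel"
    by measurable
  then show "(\<lambda>t. indicator {-pi..<pi} t * (w t * fgn_raw H t)) \<in> borel_measurable lborel"
    by (simp add: mult_ac)
  show "AE t in lborel. norm (indicator {-pi..<pi} t * (w t * fgn_raw H t)) \<le> norm (indicator {-pi..<pi} t * fgn_raw H t)"
    using b fgn_raw_nonneg by (intro AE_I2) (auto simp: abs_mult indicator_def mult_left_le_one_le)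
qed

lemma integral_sin_fgn_raw:
  assumes H: "0 < H" "H < 1"
  shows "(LINT t|lborel. indicator {-pi..<pi} t * (sin (x * t) * fgn_raw H t)) = 0"
proof -
  let ?I = "LINT t|lborel. indicator {-pi..<pi} t * (sin (x * t) * fgn_raw H t)"
  have "?I = (LINT t|lborel. indicator {-pi..<pi} (- t) * (sin (x * (- t)) * fgn_raw H (- t)))"
    using lborel_integral_real_affine[of "-1" "\<lambda>t. indicator {-pi..<pi} t * (sin (x * t) * fgn_raw H t)" 0] by simp
  also have "\<dots> = (LINT t|lborel. - (indicator {-pi..<pi} t * (sin (x * t) * fgn_raw H t)))"
  proof (rule integral_cong_AE)
    have m: "(\<lambda>t. indicator {-pi..<pi} t * (sin (x * t) * fgn_raw H t)) \<in> borel_measurable lborel"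
      using integrable_fgn_raw_bounded[OF H, of "\<lambda>t. sin (x * t)"] by (auto simp: abs_sin_le_one)
    then show "(\<lambda>t. - (indicator {-pi..<pi} t * (sin (x * t) * fgn_raw H t))) \<in> borel_measurable lborel"
      by simp
    show "(\<lambda>t. indicator {-pi..<pi} (- t) * (sin (x * (- t)) * fgn_raw H (- t))) \<in> borel_measurable lborel"
      using measurable_compose[of uminus lborel lborel, OF _ m] by simp
    have "AE t in lborel. t \<noteq> -pi \<and> t \<noteq> pi"
      using AE_lborel_singleton[of "-pi"] AE_lborel_singleton[of pi] by eventually_elim auto
    then show "AE t in lborel. indicator {-pi..<pi} (- t) * (sin (x * (- t)) * fgn_raw H (- t)) =
        - (indicator {-pi..<pi} t * (sin (x * t) * fgn_raw H t))"
      by eventually_elim (auto simp: indicator_def fgn_raw_even)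
  qed
  also have "\<dots> = - ?I" by simp
  finally show ?thesis by simp
qed

lemma fourier_coeff_fgn_raw:
  assumes H: "0 < H" "H < 1"
  shows "fourier_coeff (\<lambda>t. c * fgn_raw H t) m = complex_of_real (c * (levy_const H / pi) * fgn_cov H m)"
proof -
  let ?m = "real_of_int m"
  let ?C = "\<lambda>t. indicator {-pi..<pi} t * (cos (?m * t) * fgn_raw H t)"
  let ?S = "\<lambda>t. indicator {-pi..<pi} t * (sin (?m * t) * fgn_raw H t)"
  have C: "integrable lborel ?C" "integral\<^sup>L lborel ?C = 2 * levy_const H * fgn_cov H m"
    using has_bochner_integral_cos_fgn_raw[OF H, of m] by (auto simp: has_bochner_integral_iff)
  have S: "integrable lborel ?S"
    by (rule integrable_fgn_raw_bounded[OF H]) (auto simp: abs_sin_le_one)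
  have "set_lebesgue_integral lborel {-pi..<pi} (\<lambda>t. cis (- ?m * t) * complex_of_real (c * fgn_raw H t)) =
      (CLINT t|lborel. complex_of_real (c * ?C t) - \<i> * complex_of_real (c * ?S t))"
    unfolding set_lebesgue_integral_def
    by (intro Bochner_Integration.integral_cong refl) (auto simp: indicator_def complex_eq_iff)
  also have "\<dots> = (CLINT t|lborel. complex_of_real (c * ?C t)) - \<i> * (CLINT t|lborel. complex_of_real (c * ?S t))"
    using C(1) S by (subst Bochner_Integration.integral_diff) (auto simp del: of_real_mult)
  also have "\<dots> = complex_of_real (c * (2 * levy_const H * fgn_cov H m))"
    unfolding integral_complex_of_real integral_mult_right_zero C(2) integral_sin_fgn_raw[OF H] by simp
  finally show ?thesis by (simp add: fourier_coeff_def)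
qed

text \<open>All coefficients of the raw density are \<open>levy_const H / pi\<close> times the
  covariances, which gives existence. Uniqueness is read off at \<open>m = 0\<close>, where the
  covariance is 1.\<close>

lemma fgn_const_eq:
  assumes H: "0 < H" "H < 1"
  shows "fgn_const H = pi / levy_const H"
  unfolding fgn_const_def
proof (rule the_equality)
  have K: "levy_const H > 0" by (rule levy_const_pos[OF H])
  then show "0 < pi / levy_const H \<and> (\<forall>m. fourier_coeff (\<lambda>t. pi / levy_const H * fgn_raw H t) m = complex_of_real (fgn_cov H m))"
    unfolding fourier_coeff_fgn_raw[OF H] by simp
  fix c assume "0 < c \<and> (\<forall>m. fourier_coeff (\<lambda>t. c * fgn_raw H t) m = complex_of_real (fgn_cov H m))"
  then have "complex_of_real (c * (levy_const H / pi) * fgn_cov H 0) = complex_of_real (fgn_cov H 0)"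
    unfolding fourier_coeff_fgn_raw[OF H] by blast
  then have "c * (levy_const H / pi) = 1" using H by (simp only: of_real_eq_iff fgn_cov_0 mult_1_right)
  with K show "c = pi / levy_const H" by (simp add: field_simps)
qed

lemma fgn_const_pos: "0 < H \<Longrightarrow> H < 1 \<Longrightarrow> 0 < fgn_const H"
  by (simp add: fgn_const_eq levy_const_pos)

text \<open>The real part of the Fourier coefficient of an integrable symbol, and all of it when the
  symbol is even.\<close>

definition cos_coeff :: "(real \<Rightarrow> real) \<Rightarrow> int \<Rightarrow> real" where
  "cos_coeff g m = 1 / (2 * pi) * (LINT t|lborel. indicator {-pi..<pi} t * (cos (real_of_int m * t) * g t))"

lemma fourier_coeff_fgn_density:
  assumes H: "0 < H" "H < 1"
  shows "fourier_coeff (fgn_density H) m = complex_of_real (cos_coeff (fgn_density H) m)"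
proof -
  have "(LINT t|lborel. indicator {-pi..<pi} t * (cos (real_of_int m * t) * fgn_density H t)) =
      (LINT t|lborel. fgn_const H * (indicator {-pi..<pi} t * (cos (real_of_int m * t) * fgn_raw H t)))"
    by (intro Bochner_Integration.integral_cong) (auto simp: fgn_density_def)
  also have "\<dots> = fgn_const H * (2 * levy_const H * fgn_cov H m)"
    using has_bochner_integral_cos_fgn_raw[OF H, of m] by (simp add: has_bochner_integral_iff)
  finally show ?thesis
    unfolding fgn_density_def[abs_def] fourier_coeff_fgn_raw[OF H] cos_coeff_def by simp
qed

section \<open>Toeplitz forms and Fejer means\<close>

definition torus :: "real measure" where
  "torus = restrict_space lborel {-pi..<pi}"

definition tmean :: "(real \<Rightarrow> real) \<Rightarrow> real" where
  "tmean g = 1 / (2 * pi) * integral\<^sup>L torus g"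

lemma space_torus [simp]: "space torus = {-pi..<pi}"
  by (simp add: torus_def space_restrict_space)

lemma borel_measurable_torus [measurable (raw)]:
  "g \<in> borel_measurable borel \<Longrightarrow> g \<in> borel_measurable torus"
  unfolding torus_def by (rule measurable_restrict_space1) simp

lemma integrable_torus_iff: "integrable torus g \<longleftrightarrow> integrable lborel (\<lambda>t. indicator {-pi..<pi} t * g t)"
  for g :: "real \<Rightarrow> real"
  unfolding torus_def by (subst integrable_restrict_space) auto

lemma integral_torus: "integral\<^sup>L torus g = (LINT t|lborel. indicator {-pi..<pi} t * g t)"
  for g :: "real \<Rightarrow> real"
  unfolding torus_def by (subst integral_restrict_space) auto

lemma finite_measure_torus: "finite_measure torus"
  unfolding torus_def by (rule finite_measureI) (simp add: emeasure_restrict_space space_restrict_space)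

lemma AE_torus_neq: "AE t in torus. t \<noteq> c"
proof -
  have "AE t in lborel. t \<in> {-pi..<pi} \<longrightarrow> t \<noteq> c"
    using AE_lborel_singleton[of c] by eventually_elim auto
  then show ?thesis unfolding torus_def by (subst AE_restrict_space_iff) auto
qed

lemma cos_coeff_tmean: "cos_coeff g m = tmean (\<lambda>t. cos (real_of_int m * t) * g t)"
  unfolding cos_coeff_def tmean_def integral_torus ..

lemma integrable_torus_bounded_mult:
  fixes g w :: "real \<Rightarrow> real"
  assumes g: "integrable torus g" and w: "w \<in> borel_measurable torus"
    and b: "\<And>t. t \<in> {-pi..<pi} \<Longrightarrow> \<bar>w t\<bar> \<le> B"
  shows "integrable torus (\<lambda>t. g t * w t)"
proof (rule Bochner_Integration.integrable_bound)
  show "integrable torus (\<lambda>t. B * \<bar>g t\<bar>)" using g by auto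
  show "(\<lambda>t. g t * w t) \<in> borel_measurable torus"
    using g w by auto
  show "AE t in torus. norm (g t * w t) \<le> norm (B * \<bar>g t\<bar>)"
  proof (intro AE_I2)
    fix t assume "t \<in> space torus"
    then have "\<bar>w t\<bar> \<le> B" using b by simp
    moreover from this have "0 \<le> B" by (rule order_trans[rotated]) simp
    ultimately show "norm (g t * w t) \<le> norm (B * \<bar>g t\<bar>)"
      using mult_right_mono[of "\<bar>w t\<bar>" B "\<bar>g t\<bar>"] by (simp add: abs_mult mult.commute)
  qed
qed

lemma integrable_torus_continuous_mult:
  fixes g w :: "real \<Rightarrow> real"
  assumes g: "integrable torus g" and w: "continuous_on UNIV w"
  shows "integrable torus (\<lambda>t. g t * w t)"
proof -
  have "compact (w ` {-pi..pi})"
    by (intro compact_continuous_image continuous_on_subset[OF w]) auto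
  then obtain B where "\<And>t. t \<in> {-pi..pi} \<Longrightarrow> \<bar>w t\<bar> \<le> B"
    using compact_imp_bounded[of "w ` {-pi..pi}"] unfolding bounded_iff by (auto simp del: atLeastAtMost_iff)
  then show ?thesis
    using g w by (intro integrable_torus_bounded_mult[of g w B]) (auto intro!: borel_measurable_torus borel_measurable_continuous_onI)
qed

lemma tmean_diff: "integrable torus f \<Longrightarrow> integrable torus g \<Longrightarrow> tmean (\<lambda>t. f t - g t) = tmean f - tmean g"
  by (simp add: tmean_def right_diff_distrib)

lemma tmean_add: "integrable torus f \<Longrightarrow> integrable torus g \<Longrightarrow> tmean (\<lambda>t. f t + g t) = tmean f + tmean g"
  by (simp add: tmean_def ring_distribs add_divide_distrib)

lemma tmean_cmult: "tmean (\<lambda>t. c * f t) = c * tmean f"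
  by (simp add: tmean_def)

lemma tmean_sum:
  "(\<And>i. i \<in> I \<Longrightarrow> integrable torus (f i)) \<Longrightarrow> tmean (\<lambda>t. \<Sum>i\<in>I. f i t) = (\<Sum>i\<in>I. tmean (f i))"
  by (simp add: tmean_def sum_distrib_left sum_divide_distrib)

lemma tmean_mono_AE:
  assumes "integrable torus f" "integrable torus g" "AE t in torus. f t \<le> g t"
  shows "tmean f \<le> tmean g"
  unfolding tmean_def by (intro mult_left_mono integral_mono_AE assms) auto

lemma tmean_nonneg: "(\<And>t. t \<in> {-pi..<pi} \<Longrightarrow> 0 \<le> f t) \<Longrightarrow> 0 \<le> tmean f"
  unfolding tmean_def by (intro mult_nonneg_nonneg integral_nonneg_AE AE_I2) auto

lemma integrable_torus_const [simp]: "integrable torus (\<lambda>t. c :: real)"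
  by (rule finite_measure.integrable_const[OF finite_measure_torus])

lemma tmean_const: "tmean (\<lambda>t. c) = c"
proof -
  have "measure torus {-pi..<pi} = 2 * pi"
    unfolding torus_def by (subst measure_restrict_space) auto
  then show ?thesis by (simp add: tmean_def)
qed

text \<open>Reflection maps \<open>[-pi, pi)\<close> to \<open>(-pi, pi]\<close>, so
  \<open>g pi\<close>, a value outside the torus, enters at \<open>- pi\<close>. The open interval
  in between carries the integral, and the extra point only adds a multiple of the indicator of a
  singleton.\<close>

lemma tmean_reflect:
  assumes "integrable torus g"
  shows "tmean (\<lambda>t. g (- t)) = tmean g"
proof -
  let ?G = "\<lambda>t. indicator {-pi..<pi} t * g t"
  have m: "?G \<in> borel_measurable lborel"
    using assms unfolding integrable_torus_iff by auto
  have "(LINT t|lborel. ?G t) = (LINT t|lborel. ?G (- t))"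
    using lborel_integral_real_affine[of "-1" ?G 0] by simp
  also have "\<dots> = (LINT t|lborel. indicator {-pi<..pi} t * g (- t))"
    by (intro Bochner_Integration.integral_cong) (auto simp: indicator_def)
  also have "\<dots> = (LINT t|lborel. indicator {-pi<..<pi} t * g (- t))"
  proof (rule integral_cong_AE)
    have gm: "(\<lambda>t. ?G (- t)) \<in> borel_measurable lborel"
      using measurable_compose[of uminus lborel lborel, OF _ m] by simp
    have "(\<lambda>t. indicator {-pi<..<pi} t * ?G (- t)) \<in> borel_measurable lborel"
      by (rule borel_measurable_times[OF _ gm]) simp
    then show "(\<lambda>t. indicator {-pi<..<pi} t * g (- t)) \<in> borel_measurable lborel"
      by (rule measurable_cong[THEN iffD1, rotated]) (auto simp: indicator_def)
    show "(\<lambda>t. indicator {-pi<..pi} t * g (- t)) \<in> borel_measurable lborel"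
      using gm by (rule measurable_cong[THEN iffD1, rotated]) (auto simp: indicator_def)
    show "AE t in lborel. indicator {-pi<..pi} t * g (- t) = indicator {-pi<..<pi} t * g (- t)"
      using AE_lborel_singleton[of pi] by eventually_elim (auto simp: indicator_def)
  qed
  also have "\<dots> = (LINT t|lborel. indicator {-pi..<pi} t * g (- t))"
  proof (rule integral_cong_AE)
    have gm: "(\<lambda>t. ?G (- t)) \<in> borel_measurable lborel"
      using measurable_compose[of uminus lborel lborel, OF _ m] by simp
    have g1[measurable]: "(\<lambda>t. indicator {-pi<..<pi} t * ?G (- t)) \<in> borel_measurable lborel"
      by (rule borel_measurable_times[OF _ gm]) simp
    then show "(\<lambda>t. indicator {-pi<..<pi} t * g (- t)) \<in> borel_measurable lborel"
      by (rule measurable_cong[THEN iffD1, rotated]) (auto simp: indicator_def)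
    have "(\<lambda>t. indicator {-pi<..<pi} t * ?G (- t) + indicator {-pi} t * g pi) \<in> borel_measurable lborel"
      by measurable
    then show "(\<lambda>t. indicator {-pi..<pi} t * g (- t)) \<in> borel_measurable lborel"
      by (rule measurable_cong[THEN iffD1, rotated]) (auto simp: indicator_def)
    show "AE t in lborel. indicator {-pi<..<pi} t * g (- t) = indicator {-pi..<pi} t * g (- t)"
      using AE_lborel_singleton[of "-pi"] by eventually_elim (auto simp: indicator_def)
  qed
  finally show ?thesis unfolding tmean_def integral_torus by simp
qed

lemma cos_coeff_one: "cos_coeff (\<lambda>_. 1) m = (if m = 0 then 1 else 0)"
proof (cases "m = 0")
  case True
  then show ?thesis by (simp add: cos_coeff_tmean tmean_const)
next
  case False
  let ?m = "real_of_int m"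
  have "(LINT t|lborel. indicator {-pi..<pi} t * cos (?m * t)) = (LINT t|lborel. indicator {-pi..pi} t * cos (?m * t))"
  proof (rule integral_cong_AE)
    show "AE t in lborel. indicator {-pi..<pi} t * cos (?m * t) = indicator {-pi..pi} t * cos (?m * t)"
      using AE_lborel_singleton[of pi] by eventually_elim (auto simp: indicator_def)
  qed auto
  also have "\<dots> = sin (?m * pi) / ?m - sin (?m * (- pi)) / ?m"
  proof -
    have "(LINT t|lborel. cos (?m * t) * indicator {-pi..pi} t) = sin (?m * pi) / ?m - sin (?m * (- pi)) / ?m"
      using False by (intro integral_FTC_Icc_real) (auto intro!: derivative_eq_intros)
    then show ?thesis by (simp only: mult.commute)
  qed
  also have "\<dots> = 0"
    using sin_npi_int[of m] by (simp add: mult.commute)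
  finally show ?thesis
    using False by (simp add: cos_coeff_def)
qed

section \<open>Toeplitz forms and trigonometric polynomials\<close>

definition trig_cos :: "nat \<Rightarrow> (nat \<Rightarrow> real) \<Rightarrow> real \<Rightarrow> real" where
  "trig_cos n x t = dotp n x (\<lambda>j. cos (real j * t))"

definition trig_sin :: "nat \<Rightarrow> (nat \<Rightarrow> real) \<Rightarrow> real \<Rightarrow> real" where
  "trig_sin n x t = dotp n x (\<lambda>j. sin (real j * t))"

definition toep :: "(real \<Rightarrow> real) \<Rightarrow> nat \<Rightarrow> nat \<Rightarrow> real" where
  "toep g j k = cos_coeff g (int j - int k)"

lemma continuous_trig: "continuous_on A (trig_cos n x)" "continuous_on A (trig_sin n x)"
  unfolding trig_cos_def[abs_def] trig_sin_def[abs_def] dotp_def by (intro continuous_intros)+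

lemma toep_sym: "toep g j k = toep g k j"
proof -
  have "cos (real_of_int (int j - int k) * t) = cos (real_of_int (int k - int j) * t)" for t
    by (metis cos_minus minus_diff_eq minus_mult_left of_int_minus)
  then show ?thesis by (simp add: toep_def cos_coeff_tmean)
qed

text \<open>\<open>trig_cos\<close> and \<open>trig_sin\<close> are the real and imaginary parts of
  \<open>P_x(t) = sum_j x_j e^(ijt)\<close>. The addition formula for \<open>cos ((j - k) t)\<close>
  turns the matrix form into the mean of \<open>g\<close> times the real part of \<open>P_x\<close>
  times the conjugate of \<open>P_y\<close>.\<close>

lemma bform_toep:
  assumes g: "integrable torus g"
  shows "bform n (toep g) x y =
    tmean (\<lambda>t. g t * (trig_cos n x t * trig_cos n y t + trig_sin n x t * trig_sin n y t))"
proof -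
  have int: "integrable torus (\<lambda>t. g t * (x j * cos (real_of_int (int j - int k) * t) * y k))" for j k
    by (intro integrable_torus_continuous_mult g continuous_intros)
  have "x j * toep g j k * y k = tmean (\<lambda>t. g t * (x j * cos (real_of_int (int j - int k) * t) * y k))" for j k
    unfolding toep_def cos_coeff_tmean tmean_cmult[symmetric] mult.commute[of _ "y k"] by (simp add: mult_ac)
  then have "bform n (toep g) x y = (\<Sum>j<n. \<Sum>k<n. tmean (\<lambda>t. g t * (x j * cos (real_of_int (int j - int k) * t) * y k)))"
    by (simp add: bform_def)
  also have "\<dots> = tmean (\<lambda>t. \<Sum>j<n. \<Sum>k<n. g t * (x j * cos (real_of_int (int j - int k) * t) * y k))"
    using int by (simp add: tmean_sum)
  also have "(\<lambda>t. \<Sum>j<n. \<Sum>k<n. g t * (x j * cos (real_of_int (int j - int k) * t) * y k)) =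
      (\<lambda>t. g t * (trig_cos n x t * trig_cos n y t + trig_sin n x t * trig_sin n y t))"
  proof
    fix t
    have c: "cos (real_of_int (int j - int k) * t) =
        cos (real j * t) * cos (real k * t) + sin (real j * t) * sin (real k * t)" for j k
      by (simp add: left_diff_distrib cos_diff)
    have "trig_cos n x t * trig_cos n y t + trig_sin n x t * trig_sin n y t =
        (\<Sum>j<n. \<Sum>k<n. x j * cos (real_of_int (int j - int k) * t) * y k)"
      unfolding trig_cos_def trig_sin_def dotp_def sum_product sum.distrib[symmetric]
      c
      by (intro sum.cong refl) (simp add: algebra_simps)
    then show "(\<Sum>j<n. \<Sum>k<n. g t * (x j * cos (real_of_int (int j - int k) * t) * y k)) =
        g t * (trig_cos n x t * trig_cos n y t + trig_sin n x t * trig_sin n y t)"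
      by (simp add: sum_distrib_left)
  qed
  finally show ?thesis .
qed

lemma bform_toep_one: "bform n (toep (\<lambda>_. 1)) x y = dotp n x y"
  by (rule bform_diagonal) (simp add: toep_def cos_coeff_one)

lemma dotp_parseval:
  "dotp n x y = tmean (\<lambda>t. trig_cos n x t * trig_cos n y t + trig_sin n x t * trig_sin n y t)"
  using bform_toep[of "\<lambda>_. 1" n x y] by (simp add: bform_toep_one)

text \<open>If the form vanished, the polynomial would vanish almost everywhere on the set where
  \<open>g > 0\<close>, and Parseval would give \<open>x = 0\<close> below \<open>n\<close>.\<close>

lemma bform_toep_pos:
  assumes g: "integrable torus g" and pos: "AE t in torus. g t > 0"
    and x: "k < n" "x k \<noteq> 0"
  shows "bform n (toep g) x x > 0"
proof -
  let ?X = "\<lambda>t. trig_cos n x t * trig_cos n x t + trig_sin n x t * trig_sin n x t"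
  have X: "0 \<le> ?X t" for t by simp
  have int: "integrable torus (\<lambda>t. g t * ?X t)"
    by (intro integrable_torus_continuous_mult g continuous_intros continuous_trig)
  have nn: "AE t in torus. 0 \<le> g t * ?X t"
    using pos by eventually_elim (simp add: X)
  have "integral\<^sup>L torus (\<lambda>t. g t * ?X t) \<noteq> 0"
  proof
    assume "integral\<^sup>L torus (\<lambda>t. g t * ?X t) = 0"
    then have "AE t in torus. g t * ?X t = 0"
      using integral_nonneg_eq_0_iff_AE[OF int nn] by simp
    with pos have "AE t in torus. ?X t = 0"
      by eventually_elim auto
    then have "integral\<^sup>L torus ?X = integral\<^sup>L torus (\<lambda>_. 0::real)"
      by (intro integral_cong_AE)
        (auto intro!: borel_measurable_torus borel_measurable_continuous_onI continuous_intros continuous_trig)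
    then have "dotp n x x = 0" unfolding dotp_parseval tmean_def by simp
    moreover have "0 < dotp n x x" unfolding dotp_def
      using x by (intro sum_pos2[of _ k]) (auto simp: zero_less_mult_iff linorder_neq_iff)
    ultimately show False by simp
  qed
  moreover have "integral\<^sup>L torus (\<lambda>t. g t * ?X t) \<ge> 0"
    by (rule integral_nonneg_AE[OF nn])
  ultimately show ?thesis unfolding bform_toep[OF g] tmean_def by simp
qed

section \<open>The Fejer kernel and its means\<close>

definition fejer :: "nat \<Rightarrow> real \<Rightarrow> real" where
  "fejer n u = ((\<Sum>j<n. cos (real j * u))\<^sup>2 + (\<Sum>j<n. sin (real j * u))\<^sup>2) / real n"

definition fejer_mean :: "nat \<Rightarrow> (real \<Rightarrow> real) \<Rightarrow> real \<Rightarrow> real" where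
  "fejer_mean n g t = tmean (\<lambda>s. g s * fejer n (t - s))"

lemma fejer_nonneg: "0 \<le> fejer n u"
  by (simp add: fejer_def)

lemma continuous_fejer: "continuous_on A (fejer n)"
  unfolding fejer_def[abs_def] by (cases "n = 0") (auto intro!: continuous_intros)

lemma fejer_eq_cmod: "fejer n u = (cmod (\<Sum>j<n. cis u ^ j))\<^sup>2 / real n"
proof -
  have "(\<Sum>j<n. cis u ^ j) = Complex (\<Sum>j<n. cos (real j * u)) (\<Sum>j<n. sin (real j * u))"
    by (auto simp: complex_eq_iff Complex.DeMoivre)
  then show ?thesis by (simp add: fejer_def cmod_def)
qed

lemma fejer_le: "fejer n u \<le> real n"
proof -
  have "cmod (\<Sum>j<n. cis u ^ j) \<le> (\<Sum>j<n. 1)"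
    by (rule sum_norm_le) (simp add: norm_power)
  then have "(cmod (\<Sum>j<n. cis u ^ j))\<^sup>2 \<le> (real n)\<^sup>2"
    by (intro power_mono) auto
  then show ?thesis
    unfolding fejer_eq_cmod by (cases "n = 0") (auto simp: pos_divide_le_eq power2_eq_square)
qed

text \<open>The geometric sum times \<open>1 - cis u\<close> has modulus at most 2, and
  \<open>1 - cis u\<close> has squared modulus \<open>2 - 2 * cos u\<close>.\<close>

lemma fejer_mult_le: "fejer n u * (1 - cos u) \<le> 2 / real n"
proof -
  have "(1 - cis u) * (\<Sum>j<n. cis u ^ j) = 1 - cis u ^ n"
    by (simp add: one_diff_power_eq)
  then have "cmod (1 - cis u) * cmod (\<Sum>j<n. cis u ^ j) = cmod (1 - cis u ^ n)"
    by (metis norm_mult)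
  also have "\<dots> \<le> 2"
    using norm_triangle_ineq4[of 1 "cis u ^ n"] by (simp add: norm_power)
  finally have "(cmod (1 - cis u) * cmod (\<Sum>j<n. cis u ^ j))\<^sup>2 \<le> 2\<^sup>2"
    by (intro power_mono) auto
  then have "(2 - 2 * cos u) * (cmod (\<Sum>j<n. cis u ^ j))\<^sup>2 \<le> 4"
    using cmod_cis_minus_1_squared[of u] by (simp add: power_mult_distrib norm_minus_commute)
  then have "(1 - cos u) * (cmod (\<Sum>j<n. cis u ^ j))\<^sup>2 \<le> 2" by (simp add: algebra_simps)
  then show ?thesis
    unfolding fejer_eq_cmod by (simp add: divide_right_mono mult.commute)
qed

text \<open>Multiplying the bound \<open>n\<close> with the bound \<open>2 / n\<close> eliminates
  \<open>n\<close>; this gives an estimate of the kernel away from 0 that is uniform in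
  \<open>n\<close>.\<close>

lemma fejer_square_le:
  assumes "n > 0"
  shows "(fejer n u)\<^sup>2 * (1 - cos u) \<le> 2"
proof -
  have "fejer n u * (fejer n u * (1 - cos u)) \<le> real n * (2 / real n)"
    using fejer_le[of n u] fejer_mult_le[of n u] fejer_nonneg[of n u] cos_le_one[of u]
    by (intro mult_mono) auto
  then show ?thesis using assms by (simp add: power2_eq_square mult.assoc)
qed

lemma integrable_fejer:
  "integrable torus g \<Longrightarrow> integrable torus (\<lambda>s. g s * fejer n (t - s))"
  by (intro integrable_torus_continuous_mult continuous_on_compose2[OF continuous_fejer[of UNIV]] continuous_intros) auto

lemma fejer_double_sum:
  "real n * fejer n u = (\<Sum>j<n. \<Sum>k<n. cos (real_of_int (int j - int k) * u))"
proof (cases "n = 0")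
  case False
  then have "real n * fejer n u = (\<Sum>j<n. cos (real j * u))\<^sup>2 + (\<Sum>j<n. sin (real j * u))\<^sup>2"
    by (simp add: fejer_def)
  also have "\<dots> = (\<Sum>j<n. \<Sum>k<n. cos (real j * u) * cos (real k * u) + sin (real j * u) * sin (real k * u))"
    by (simp add: power2_eq_square sum_product sum.distrib)
  also have "\<dots> = (\<Sum>j<n. \<Sum>k<n. cos (real_of_int (int j - int k) * u))"
    by (simp add: left_diff_distrib cos_diff)
  finally show ?thesis .
qed simp

text \<open>The real and imaginary parts of the exponential vector. For a real symmetric matrix, the
  sum of its forms at the two vectors is the Hermitian form at that vector.\<close>

definition vcos :: "real \<Rightarrow> nat \<Rightarrow> real" where "vcos t j = cos (real j * t)"
definition vsin :: "real \<Rightarrow> nat \<Rightarrow> real" where "vsin t j = sin (real j * t)"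

lemma trig_eq_dotp: "trig_cos n x t = dotp n x (vcos t)" "trig_sin n x t = dotp n x (vsin t)"
  by (simp_all add: trig_cos_def trig_sin_def vcos_def[abs_def] vsin_def[abs_def])

lemma dotp_vcos_vsin: "dotp n (vcos t) (vcos t) + dotp n (vsin t) (vsin t) = real n"
  by (simp add: dotp_def vcos_def vsin_def sum.distrib[symmetric] power2_eq_square[symmetric])

text \<open>The real symmetric Toeplitz matrix only sees the even part of the symbol, hence the evenness
  assumption.\<close>

lemma bform_toep_exponential:
  assumes g: "integrable torus g" and even: "\<And>t. g (- t) = g t"
  shows "bform n (toep g) (vcos t) (vcos t) + bform n (toep g) (vsin t) (vsin t) = real n * fejer_mean n g t"
proof -
  have reflected: "tmean (\<lambda>s. g s * fejer n (t + s)) = fejer_mean n g t"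
    using tmean_reflect[OF integrable_fejer[OF g, of n t]] by (simp add: even fejer_mean_def)
  have int: "integrable torus (\<lambda>s. g s * fejer n (t + s))"
    by (intro integrable_torus_continuous_mult g continuous_on_compose2[OF continuous_fejer[of UNIV]] continuous_intros) auto
  \<comment> \<open>The left side is the double sum of
    \<open>cos ((j - k) t) * cos ((j - k) s)\<close>, hence the average of the kernels at
    \<open>t - s\<close> and \<open>t + s\<close>. For even \<open>g\<close> both have the same
    mean.\<close>
  have pt: "trig_cos n (vcos t) s * trig_cos n (vcos t) s + trig_sin n (vcos t) s * trig_sin n (vcos t) s
      + (trig_cos n (vsin t) s * trig_cos n (vsin t) s + trig_sin n (vsin t) s * trig_sin n (vsin t) s) =
      real n * (1/2) * (fejer n (t - s) + fejer n (t + s))" for s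
  proof -
    have "real n * (1/2) * (fejer n (t - s) + fejer n (t + s)) = (1/2) * (real n * fejer n (t - s) + real n * fejer n (t + s))"
      by (simp add: algebra_simps)
    also have "\<dots> = (\<Sum>j<n. \<Sum>k<n. (1/2) * (cos (real_of_int (int j - int k) * (t - s)) + cos (real_of_int (int j - int k) * (t + s))))"
      unfolding fejer_double_sum sum.distrib[symmetric] sum_distrib_left ..
    also have "\<dots> = (\<Sum>j<n. \<Sum>k<n. (cos (real j * t) * cos (real k * t) + sin (real j * t) * sin (real k * t)) *
         (cos (real j * s) * cos (real k * s) + sin (real j * s) * sin (real k * s)))"
    proof (intro sum.cong refl)
      fix j k :: nat
      let ?m = "real_of_int (int j - int k)"
      have "(1/2) * (cos (?m * (t - s)) + cos (?m * (t + s))) = cos (?m * t) * cos (?m * s)"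
        by (simp only: right_diff_distrib distrib_left cos_add cos_diff)
      also have "cos (?m * t) = cos (real j * t) * cos (real k * t) + sin (real j * t) * sin (real k * t)"
        by (simp add: left_diff_distrib cos_diff)
      also have "cos (?m * s) = cos (real j * s) * cos (real k * s) + sin (real j * s) * sin (real k * s)"
        by (simp add: left_diff_distrib cos_diff)
      finally show "(1/2) * (cos (?m * (t - s)) + cos (?m * (t + s))) =
         (cos (real j * t) * cos (real k * t) + sin (real j * t) * sin (real k * t)) *
         (cos (real j * s) * cos (real k * s) + sin (real j * s) * sin (real k * s))" .
    qed
    also have "\<dots> = trig_cos n (vcos t) s * trig_cos n (vcos t) s + trig_sin n (vcos t) s * trig_sin n (vcos t) s
      + (trig_cos n (vsin t) s * trig_cos n (vsin t) s + trig_sin n (vsin t) s * trig_sin n (vsin t) s)"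
      unfolding trig_cos_def trig_sin_def dotp_def vcos_def vsin_def sum_product sum.distrib[symmetric]
      by (intro sum.cong refl) (simp add: algebra_simps)
    finally show ?thesis by simp
  qed
  have intc: "integrable torus (\<lambda>s. g s * (trig_cos n x s * trig_cos n x s + trig_sin n x s * trig_sin n x s))" for x
    by (intro integrable_torus_continuous_mult g continuous_intros continuous_trig)
  have "bform n (toep g) (vcos t) (vcos t) + bform n (toep g) (vsin t) (vsin t) =
      tmean (\<lambda>s. g s * (real n * (1/2) * (fejer n (t - s) + fejer n (t + s))))"
    unfolding bform_toep[OF g] tmean_add[OF intc intc, symmetric] distrib_left[symmetric] pt by (rule refl)
  also have "\<dots> = tmean (\<lambda>s. real n * (1/2) * (g s * fejer n (t - s) + g s * fejer n (t + s)))"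
    by (simp add: algebra_simps)
  also have "\<dots> = real n * (1/2) * (fejer_mean n g t + fejer_mean n g t)"
    unfolding tmean_cmult tmean_add[OF integrable_fejer[OF g] int] reflected fejer_mean_def[symmetric] ..
  finally show ?thesis by simp
qed

text \<open>For the constant symbol the Toeplitz matrix is the identity, and the exponential vector
  has squared length \<open>n\<close>.\<close>

lemma fejer_mean_one:
  assumes "n > 0"
  shows "tmean (\<lambda>s. fejer n (t - s)) = 1"
  using bform_toep_exponential[of "\<lambda>_. 1" n t] assms dotp_vcos_vsin[of n t]
  by (simp add: bform_toep_one fejer_mean_def)

text \<open>Differences of points of the torus range up to \<open>2 * pi\<close>, where the kernel
  peaks again, so a distance to both 0 and \<open>2 * pi\<close> is required.\<close>

lemma cos_le_cos_middle:
  fixes d x :: real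
  assumes "0 \<le> d" "d \<le> pi" "d \<le> \<bar>x\<bar>" "\<bar>x\<bar> \<le> 2 * pi - d"
  shows "cos x \<le> cos d"
proof -
  have "cos \<bar>x\<bar> \<le> cos d"
  proof (cases "\<bar>x\<bar> \<le> pi")
    case True
    then show ?thesis using assms by (intro cos_monotone_0_pi_le) auto
  next
    case False
    have "cos \<bar>x\<bar> = cos (2 * pi - \<bar>x\<bar>)" by (simp only: cos_2pi_minus)
    also have "\<dots> \<le> cos d"
      using False assms by (intro cos_monotone_0_pi_le) auto
    finally show ?thesis .
  qed
  then show ?thesis by simp
qed

text \<open>Near \<open>t\<close> continuity controls \<open>g s - g t\<close> against a kernel of
  mean 1. Elsewhere the kernel is uniformly \<open>O(1 / n)\<close>, so integrability of
  \<open>g\<close> suffices.\<close>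

lemma fejer_mean_tendsto:
  assumes g: "integrable torus g" and t: "-pi < t" "t < pi" and cont: "isCont g t"
  shows "(\<lambda>n. fejer_mean n g t) \<longlonglongrightarrow> g t"
proof (rule LIMSEQ_I)
  fix e :: real assume e: "e > 0"
  obtain d0 where d0: "d0 > 0" "\<And>s. \<bar>s - t\<bar> < d0 \<Longrightarrow> \<bar>g s - g t\<bar> < e / 2"
    using cont[unfolded continuous_at_eps_delta, rule_format, of "e / 2"] e by (auto simp: dist_real_def)
  \<comment> \<open>The bound \<open>pi - \<bar>t\<bar>\<close> ensures
    \<open>\<bar>t - s\<bar> \<le> 2 * pi - d\<close> for all \<open>s\<close> in the torus, away
    from the periodic copies of the peak.\<close>
  define d where "d = min d0 (pi - \<bar>t\<bar>)"
  have d: "d > 0" "d \<le> d0" "d \<le> pi - \<bar>t\<bar>" using d0 t by (auto simp: d_def)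
  have dpi: "d \<le> pi" using d by auto
  define k where "k = 1 - cos d"
  have k: "k > 0"
    using cos_monotone_0_pi[of 0 d] d dpi by (simp add: k_def)
  define D where "D = tmean (\<lambda>s. \<bar>g s - g t\<bar>)"
  have intd: "integrable torus (\<lambda>s. \<bar>g s - g t\<bar>)" using g by auto
  have intag: "integrable torus (\<lambda>s. \<bar>g s - g t\<bar> * fejer n (t - s))" for n
    by (intro integrable_fejer intd)
  have intf: "integrable torus (\<lambda>s. fejer n (t - s))" for n
    using integrable_fejer[of "\<lambda>_. 1"] by simp
  have bound: "\<bar>fejer_mean n g t - g t\<bar> \<le> e / 2 + 2 / (real n * k) * D" if n: "n > 0" for n
  proof -
    have "fejer_mean n g t - g t = tmean (\<lambda>s. g s * fejer n (t - s)) - tmean (\<lambda>s. g t * fejer n (t - s))"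
      unfolding tmean_cmult fejer_mean_one[OF n] by (simp add: fejer_mean_def)
    also have "\<dots> = tmean (\<lambda>s. (g s - g t) * fejer n (t - s))"
      unfolding left_diff_distrib
      by (rule tmean_diff[symmetric, OF integrable_fejer[OF g] integrable_mult_right[OF intf]])
    finally have "\<bar>fejer_mean n g t - g t\<bar> = \<bar>tmean (\<lambda>s. (g s - g t) * fejer n (t - s))\<bar>" by simp
    also have "\<dots> \<le> tmean (\<lambda>s. \<bar>g s - g t\<bar> * fejer n (t - s))"
      using integral_abs_bound[of torus "\<lambda>s. (g s - g t) * fejer n (t - s)"] fejer_nonneg
      by (simp add: tmean_def abs_mult divide_right_mono)
    also have "\<dots> \<le> tmean (\<lambda>s. e / 2 * fejer n (t - s) + 2 / (real n * k) * \<bar>g s - g t\<bar>)"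
    proof (rule tmean_mono_AE[OF intag])
      show "integrable torus (\<lambda>s. e / 2 * fejer n (t - s) + 2 / (real n * k) * \<bar>g s - g t\<bar>)"
        using intf intd by (intro Bochner_Integration.integrable_add integrable_mult_right)
      show "AE s in torus. \<bar>g s - g t\<bar> * fejer n (t - s) \<le> e / 2 * fejer n (t - s) + 2 / (real n * k) * \<bar>g s - g t\<bar>"
      proof (intro AE_I2)
        fix s assume "s \<in> space torus"
        then have s: "- pi \<le> s" "s < pi" by auto
        show "\<bar>g s - g t\<bar> * fejer n (t - s) \<le> e / 2 * fejer n (t - s) + 2 / (real n * k) * \<bar>g s - g t\<bar>"
        proof (cases "\<bar>s - t\<bar> < d")
          case True
          then have "\<bar>g s - g t\<bar> \<le> e / 2" using d0(2)[of s] d by auto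
          then have "\<bar>g s - g t\<bar> * fejer n (t - s) \<le> e / 2 * fejer n (t - s)"
            by (intro mult_right_mono fejer_nonneg)
          moreover have "0 \<le> 2 / (real n * k) * \<bar>g s - g t\<bar>" using k by simp
          ultimately show ?thesis by linarith
        next
          case False
          have "cos (t - s) \<le> cos d"
          proof (rule cos_le_cos_middle)
            show "d \<le> \<bar>t - s\<bar>" using False by linarith
            show "\<bar>t - s\<bar> \<le> 2 * pi - d" using d s t by linarith
          qed (use d dpi in auto)
          then have "fejer n (t - s) * k \<le> fejer n (t - s) * (1 - cos (t - s))"
            by (intro mult_left_mono fejer_nonneg) (simp add: k_def)
          also have "\<dots> \<le> 2 / real n" by (rule fejer_mult_le)
          finally have "fejer n (t - s) \<le> 2 / real n / k"
            using k by (subst pos_le_divide_eq)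
          then have "fejer n (t - s) \<le> 2 / (real n * k)"
            by (simp only: divide_divide_eq_left)
          then have "\<bar>g s - g t\<bar> * fejer n (t - s) \<le> \<bar>g s - g t\<bar> * (2 / (real n * k))"
            by (intro mult_left_mono) auto
          moreover have "0 \<le> e / 2 * fejer n (t - s)" using e fejer_nonneg by simp
          ultimately show ?thesis by (simp add: mult.commute)
        qed
      qed
    qed
    also have "\<dots> = e / 2 + 2 / (real n * k) * D"
      unfolding tmean_add[OF integrable_mult_right[OF intf] integrable_mult_right[OF intd]]
        tmean_cmult fejer_mean_one[OF n] D_def by simp
    finally show ?thesis .
  qed
  have "(\<lambda>n. e / 2 + 2 * D / k * (1 / real n)) \<longlonglongrightarrow> e / 2 + 2 * D / k * 0"
    by (intro tendsto_intros lim_1_over_n)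
  then have "(\<lambda>n. e / 2 + 2 / (real n * k) * D) \<longlonglongrightarrow> e / 2"
    by (simp add: mult.commute)
  from order_tendstoD(2)[OF this, of e]
  have "\<forall>\<^sub>F n in sequentially. e / 2 + 2 / (real n * k) * D < e"
    using e by simp
  then have "\<forall>\<^sub>F n in sequentially. \<bar>fejer_mean n g t - g t\<bar> < e"
    using eventually_gt_at_top[of 0]
  proof eventually_elim
    case (elim n)
    then show ?case using bound[of n] by linarith
  qed
  then show "\<exists>N. \<forall>n\<ge>N. norm (fejer_mean n g t - g t) < e"
    by (simp add: eventually_sequentially)
qed

section \<open>Fejer means of power weights\<close>

lemma integrable_torus_powr:
  fixes q :: real
  assumes "q > -1"
  shows "integrable torus (\<lambda>t. \<bar>t\<bar> powr q)"
proof -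
  have "integrable lborel (\<lambda>t. indicator {-pi..pi} t * \<bar>t\<bar> powr q)"
    using has_bochner_integral_abs_powr[OF assms, of pi] by (simp add: has_bochner_integral_iff)
  then have "integrable lborel (\<lambda>t. indicator {-pi..<pi} t *\<^sub>R (indicator {-pi..pi} t * \<bar>t\<bar> powr q))"
    by (rule integrable_mult_indicator[rotated]) simp
  also have "(\<lambda>t. indicator {-pi..<pi} t *\<^sub>R (indicator {-pi..pi} t * \<bar>t\<bar> powr q)) = (\<lambda>t. indicator {-pi..<pi} t * \<bar>t\<bar> powr q)"
    by (rule ext) (auto simp: indicator_def)
  finally show ?thesis by (simp add: integrable_torus_iff)
qed

lemma integrable_torus_powr_near_0:
  fixes q d :: real
  assumes "q > -1"
  shows "integrable torus (\<lambda>t. indicator {-d..d} t * \<bar>t\<bar> powr q)"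
  using integrable_torus_bounded_mult[OF integrable_torus_powr[OF assms], of "indicator {-d..d}" 1]
  by (simp add: mult.commute indicator_def borel_measurable_torus)

lemma tmean_powr_near_0:
  fixes q d :: real
  assumes "q > -1" "0 \<le> d" "d < pi"
  shows "tmean (\<lambda>t. indicator {-d..d} t * \<bar>t\<bar> powr q) = d powr (q + 1) / (pi * (q + 1))"
proof -
  have "(LINT t|lborel. indicator {-pi..<pi} t * (indicator {-d..d} t * \<bar>t\<bar> powr q)) = (LINT t|lborel. indicator {-d..d} t * \<bar>t\<bar> powr q)"
    using assms by (intro Bochner_Integration.integral_cong) (auto simp: indicator_def)
  also have "\<dots> = 2 * (d powr (q + 1) / (q + 1))"
    using has_bochner_integral_abs_powr[OF assms(1,2)] by (simp add: has_bochner_integral_iff)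
  finally show ?thesis by (simp add: tmean_def integral_torus)
qed

text \<open>This is the \<open>A\<^sub>1\<close> property of the weight \<open>\<bar>t\<bar> powr - a\<close>; the region \<open>\<bar>s\<bar> \<le> \<bar>t\<bar> / 2\<close> needs only
  \<open>fejer n (t - s) \<le> 2 * pi / \<bar>t\<bar>\<close>.\<close>

lemma fejer_mean_powr_le:
  fixes a C t :: real
  assumes a: "0 \<le> a" "a < 1" and n: "n > 0" and C: "C \<ge> 0"
    and g: "integrable torus g" "\<And>s. \<bar>s\<bar> \<le> pi \<Longrightarrow> g s \<le> C * \<bar>s\<bar> powr (- a)"
    and t: "\<bar>t\<bar> \<le> pi" "t \<noteq> 0"
  shows "fejer_mean n g t \<le> C * (2 powr a * (1 + 1 / (1 - a))) * \<bar>t\<bar> powr (- a)"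
proof -
  let ?T = "\<bar>t\<bar>" and ?r = "\<bar>t\<bar> / 2"
  have T: "?T > 0" using t by simp
  have rp: "?r powr (- a) = 2 powr a * ?T powr (- a)"
    using powr_divide[of ?T 2 "- a"] powr_minus[of 2 a] by (simp only: divide_inverse inverse_inverse_eq mult.commute)
  let ?ind = "indicator {-?r..?r} :: real \<Rightarrow> real"
  have near: "fejer n (t - s) \<le> 2 * pi / ?T" if s: "\<bar>s\<bar> \<le> ?r" for s
  proof -
    have u: "?r \<le> \<bar>t - s\<bar>" "\<bar>t - s\<bar> \<le> 3 * pi / 2" using s t by linarith+
    \<comment> \<open>If \<open>\<bar>t - s\<bar> \<le> pi\<close>, use the quadratic lower bound
      together with \<open>\<bar>t - s\<bar> \<ge> \<bar>t\<bar> / 2\<close>. Otherwise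
      \<open>\<bar>t - s\<bar>\<close> is at most \<open>3 * pi / 2\<close>, the cosine is
      non-positive, and the left side is at most 1.\<close>
    have c: "t\<^sup>2 / (2 * pi\<^sup>2) \<le> 1 - cos (t - s)"
    proof (cases "\<bar>t - s\<bar> \<le> pi")
      case True
      have "?r\<^sup>2 \<le> (t - s)\<^sup>2" using u(1) by (simp add: abs_le_square_iff[symmetric])
      then have "2 / pi\<^sup>2 * (t / 2)\<^sup>2 \<le> 2 / pi\<^sup>2 * (t - s)\<^sup>2"
        by (intro mult_left_mono) (auto simp: power_divide)
      also have "\<dots> \<le> 1 - cos (t - s)" by (rule one_minus_cos_ge[OF True])
      finally show ?thesis by (simp add: power2_eq_square field_simps)
    next
      case False
      have "cos (t - s) \<le> cos (pi / 2)"
        using False u(2) by (intro cos_le_cos_middle) auto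
      moreover have "t\<^sup>2 \<le> pi\<^sup>2" using t(1) by (simp add: abs_le_square_iff[symmetric])
      moreover have "t\<^sup>2 / (2 * pi\<^sup>2) \<le> 1"
      proof (subst pos_divide_le_eq)
        show "t\<^sup>2 \<le> 1 * (2 * pi\<^sup>2)" using \<open>t\<^sup>2 \<le> pi\<^sup>2\<close> zero_le_power2[of pi] by linarith
      qed simp
      ultimately show ?thesis unfolding cos_pi_half by linarith
    qed
    have "(fejer n (t - s))\<^sup>2 * (t\<^sup>2 / (2 * pi\<^sup>2)) \<le> (fejer n (t - s))\<^sup>2 * (1 - cos (t - s))"
      by (intro mult_left_mono c) auto
    also have "\<dots> \<le> 2" by (rule fejer_square_le[OF n])
    finally have "(fejer n (t - s))\<^sup>2 \<le> 2 / (t\<^sup>2 / (2 * pi\<^sup>2))"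
      using T by (subst pos_le_divide_eq) auto
    also have "\<dots> = (2 * pi / ?T)\<^sup>2"
      by (simp add: power_divide power_mult_distrib)
    finally have "(fejer n (t - s))\<^sup>2 \<le> (2 * pi / ?T)\<^sup>2" .
    then show ?thesis
      by (rule power2_le_imp_le) (use T in auto)
  qed
  \<comment> \<open>Outside \<open>\<bar>s\<bar> \<le> \<bar>t\<bar> / 2\<close> the weight is at
    most its value at \<open>\<bar>t\<bar> / 2\<close>, the source of \<open>2 powr a\<close>.
    Inside, the weight is kept and integrated, the source of \<open>1 / (1 - a)\<close>.\<close>
  have pw: "g s * fejer n (t - s) \<le> C * (2 powr a * ?T powr (- a)) * fejer n (t - s) + C * (2 * pi / ?T) * (?ind s * \<bar>s\<bar> powr (- a))"
    if s: "\<bar>s\<bar> \<le> pi" for s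
  proof (cases "\<bar>s\<bar> \<le> ?r")
    case True
    have "g s * fejer n (t - s) \<le> (C * \<bar>s\<bar> powr (- a)) * fejer n (t - s)"
      by (intro mult_right_mono g s fejer_nonneg)
    also have "\<dots> \<le> (C * \<bar>s\<bar> powr (- a)) * (2 * pi / ?T)"
      using C by (intro mult_left_mono near True) auto
    finally have 1: "g s * fejer n (t - s) \<le> C * (2 * pi / ?T) * \<bar>s\<bar> powr (- a)"
      by (simp add: mult_ac)
    have "0 \<le> C * (2 powr a * ?T powr (- a)) * fejer n (t - s)"
      using C fejer_nonneg by (intro mult_nonneg_nonneg) auto
    moreover have "?ind s = 1" using True by (auto simp: indicator_def abs_le_iff)
    ultimately show ?thesis using 1 by simp
  next
    case False
    have "\<bar>s\<bar> powr (- a) \<le> ?r powr (- a)"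
      using False T a by (intro powr_mono2') auto
    also have "\<dots> = 2 powr a * ?T powr (- a)" by (rule rp)
    finally have "g s \<le> C * (2 powr a * ?T powr (- a))"
      using g(2)[OF s] C by (meson mult_left_mono order_trans)
    then have "g s * fejer n (t - s) \<le> C * (2 powr a * ?T powr (- a)) * fejer n (t - s)"
      by (intro mult_right_mono fejer_nonneg)
    moreover have "0 \<le> C * (2 * pi / ?T) * (?ind s * \<bar>s\<bar> powr (- a))"
      using C T by (intro mult_nonneg_nonneg) auto
    ultimately show ?thesis by linarith
  qed
  have intf: "integrable torus (\<lambda>s. fejer n (t - s))"
    using integrable_fejer[of "\<lambda>_. 1"] by simp
  have inti: "integrable torus (\<lambda>s. ?ind s * \<bar>s\<bar> powr (- a))"
    by (rule integrable_torus_powr_near_0) (use a in auto)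
  have "fejer_mean n g t \<le> tmean (\<lambda>s. C * (2 powr a * ?T powr (- a)) * fejer n (t - s) + C * (2 * pi / ?T) * (?ind s * \<bar>s\<bar> powr (- a)))"
    unfolding fejer_mean_def
    by (intro tmean_mono_AE integrable_fejer g Bochner_Integration.integrable_add integrable_mult_right intf inti AE_I2 pw) auto
  also have "\<dots> = C * (2 powr a * ?T powr (- a)) * tmean (\<lambda>s. fejer n (t - s)) + C * (2 * pi / ?T) * tmean (\<lambda>s. ?ind s * \<bar>s\<bar> powr (- a))"
    unfolding tmean_cmult[symmetric] by (intro tmean_add integrable_mult_right intf inti)
  also have "tmean (\<lambda>s. fejer n (t - s)) = 1" by (rule fejer_mean_one[OF n])
  also have "tmean (\<lambda>s. ?ind s * \<bar>s\<bar> powr (- a)) = ?r powr (- a + 1) / (pi * (- a + 1))"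
    using a t pi_gt_zero by (intro tmean_powr_near_0) auto
  also have "?r powr (- a + 1) = ?r * (2 powr a * ?T powr (- a))"
  proof -
    have "?r powr (- a + 1) = ?r powr (- a) * ?r powr 1" by (rule powr_add)
    also have "?r powr 1 = ?r" using T by simp
    finally show ?thesis unfolding rp by (rule trans[OF _ mult.commute])
  qed
  also have "C * (2 powr a * ?T powr (- a)) * 1 + C * (2 * pi / ?T) * (?r * (2 powr a * ?T powr (- a)) / (pi * (- a + 1))) =
      C * (2 powr a * ?T powr (- a)) * (1 + 1 / (1 - a))"
  proof -
    have *: "(2 * pi / ?T) * (?r * x / (pi * (- a + 1))) = x / (1 - a)" for x
      using T by simp
    show ?thesis unfolding mult.assoc[of C "2 * pi / ?T"] * by (simp add: distrib_left)
  qed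
  also have "\<dots> = C * (2 powr a * (1 + 1 / (1 - a))) * \<bar>t\<bar> powr (- a)"
    by (simp only: mult.assoc mult.commute[of "?T powr (- a)"])
  finally show ?thesis .
qed

section \<open>Christoffel functions\<close>

locale diagonalised_pair =
  fixes n :: nat and A B :: "nat \<Rightarrow> nat \<Rightarrow> real" and c :: "nat \<Rightarrow> nat \<Rightarrow> real"
  assumes symA: "\<And>k l. k < n \<Longrightarrow> l < n \<Longrightarrow> A k l = A l k"
    and orth: "\<And>i j. i < n \<Longrightarrow> j < n \<Longrightarrow> bform n A (c i) (c j) = (if i = j then 1 else 0)"
    and diag: "\<And>i j. i < n \<Longrightarrow> j < n \<Longrightarrow> i \<noteq> j \<Longrightarrow> bform n B (c i) (c j) = 0"
    and inv: "\<And>k l. k < n \<Longrightarrow> l < n \<Longrightarrow> (\<Sum>m<n. A k m * (\<Sum>i<n. c i m * c i l)) = (if k = l then 1 else 0)"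
begin

text \<open>By \<open>inv\<close> this is the quadratic form of the inverse of
  \<open>A\<close>.\<close>

definition quad :: "(nat \<Rightarrow> real) \<Rightarrow> real" where
  "quad x = (\<Sum>i<n. (dotp n (c i) x)\<^sup>2)"

text \<open>The combination of the \<open>c i\<close> with coefficients
  \<open>dotp n (c i) y\<close> is \<open>A^-1 y\<close>, and pairing it with \<open>x\<close>
  through \<open>A\<close> recovers the inner product.\<close>

lemma resolution_of_identity: "(\<Sum>i<n. dotp n (c i) y * bform n A x (c i)) = dotp n x y"
proof -
  have "(\<Sum>i<n. dotp n (c i) y * bform n A x (c i)) = bform n A x (\<lambda>m. \<Sum>i<n. dotp n (c i) y * c i m)"
    by (rule bform_sum(2)[symmetric])
  also have "\<dots> = (\<Sum>k<n. \<Sum>m<n. x k * A k m * (\<Sum>l<n. (\<Sum>i<n. c i m * c i l) * y l))"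
    unfolding bform_def
  proof (intro sum.cong refl)
    fix k m
    have "(\<Sum>i<n. dotp n (c i) y * c i m) = (\<Sum>i<n. \<Sum>l<n. c i m * c i l * y l)"
      unfolding dotp_def sum_distrib_right by (intro sum.cong refl) simp
    also have "\<dots> = (\<Sum>l<n. \<Sum>i<n. c i m * c i l * y l)" by (rule sum.swap)
    also have "\<dots> = (\<Sum>l<n. (\<Sum>i<n. c i m * c i l) * y l)" by (simp add: sum_distrib_right)
    finally show "x k * A k m * (\<Sum>i<n. dotp n (c i) y * c i m) = x k * A k m * (\<Sum>l<n. (\<Sum>i<n. c i m * c i l) * y l)"
      by simp
  qed
  also have "\<dots> = (\<Sum>k<n. \<Sum>m<n. \<Sum>l<n. x k * (A k m * (\<Sum>i<n. c i m * c i l)) * y l)"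
    by (rule sum.cong[OF refl], rule sum.cong[OF refl], subst sum_distrib_left) (simp only: mult.assoc)
  also have "\<dots> = (\<Sum>k<n. \<Sum>l<n. \<Sum>m<n. x k * (A k m * (\<Sum>i<n. c i m * c i l)) * y l)"
    by (rule sum.cong[OF refl]) (rule sum.swap)
  also have "\<dots> = (\<Sum>k<n. \<Sum>l<n. x k * (\<Sum>m<n. A k m * (\<Sum>i<n. c i m * c i l)) * y l)"
    by (simp only: sum_distrib_left[symmetric] sum_distrib_right[symmetric])
  also have "\<dots> = (\<Sum>k<n. \<Sum>l<n. if k = l then x k * y l else 0)"
    by (intro sum.cong refl) (simp add: inv)
  also have "\<dots> = dotp n x y" by (simp add: dotp_def)
  finally show ?thesis .
qed

text \<open>Parseval for the \<open>A\<close>-orthonormal basis: the resolution of identity with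
  \<open>y = A x\<close>.\<close>

lemma sum_bform_squares: "(\<Sum>i<n. (bform n A x (c i))\<^sup>2) = bform n A x x"
proof -
  define y where "y = (\<lambda>l. \<Sum>m<n. A l m * x m)"
  have y: "dotp n z y = bform n A z x" for z
    by (simp add: y_def dotp_def bform_def sum_distrib_left mult.assoc)
  have "(\<Sum>i<n. (bform n A x (c i))\<^sup>2) = (\<Sum>i<n. dotp n (c i) y * bform n A x (c i))"
    unfolding y power2_eq_square by (intro sum.cong refl arg_cong2[of _ _ _ _ "(*)"] bform_comm symA)
  also have "\<dots> = dotp n x y" by (rule resolution_of_identity)
  also have "\<dots> = bform n A x x" by (rule y)
  finally show ?thesis .
qed

text \<open>Cauchy--Schwarz between a form and its inverse, linearised by \<open>\<tau>\<close> so
  that the estimates for the cosine and sine vectors can be added with one common parameter.\<close>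

lemma dotp_le_quad_bform:
  assumes "\<tau> > 0"
  shows "2 * dotp n x x \<le> \<tau> * quad x + bform n A x x / \<tau>"
proof -
  have "2 * dotp n x x = (\<Sum>i<n. 2 * (dotp n (c i) x * bform n A x (c i)))"
    by (simp only: resolution_of_identity sum_distrib_left[symmetric])
  also have "\<dots> \<le> (\<Sum>i<n. \<tau> * (dotp n (c i) x)\<^sup>2 + (bform n A x (c i))\<^sup>2 / \<tau>)"
  proof (rule sum_mono)
    fix i
    let ?u = "dotp n (c i) x" and ?v = "bform n A x (c i)"
    have "0 \<le> (\<tau> * ?u - ?v)\<^sup>2 / \<tau>" using assms by simp
    also have "\<dots> = \<tau> * ?u\<^sup>2 + ?v\<^sup>2 / \<tau> - 2 * (?u * ?v)"
      using assms by (simp add: power2_eq_square field_simps)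
    finally show "2 * (?u * ?v) \<le> \<tau> * ?u\<^sup>2 + ?v\<^sup>2 / \<tau>" by simp
  qed
  also have "\<dots> = \<tau> * quad x + bform n A x x / \<tau>"
    by (simp only: sum.distrib quad_def sum_distrib_left sum_divide_distrib[symmetric] sum_bform_squares)
  finally show ?thesis .
qed

text \<open>The witness is \<open>y = A^-1 x\<close>, the extremal vector of the dual description of
  the inverse form.\<close>

lemma quad_dual:
  obtains y where "bform n A y y = quad x" "dotp n x y = quad x"
proof
  let ?w = "\<lambda>i. dotp n (c i) x"
  let ?y = "\<lambda>m. \<Sum>i<n. ?w i * c i m"
  show "bform n A ?y ?y = quad x"
    unfolding bform_linear_combination using bform_diagonal[of n "\<lambda>a b. bform n A (c a) (c b)" ?w ?w, OF orth]
    by (simp add: quad_def dotp_def power2_eq_square)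
  have "dotp n x ?y = (\<Sum>k<n. \<Sum>i<n. x k * (?w i * c i k))"
    unfolding dotp_def[of n x] sum_distrib_left ..
  also have "\<dots> = (\<Sum>i<n. \<Sum>k<n. x k * (?w i * c i k))" by (rule sum.swap)
  also have "\<dots> = (\<Sum>i<n. ?w i * ?w i)"
    by (intro sum.cong refl) (simp add: dotp_def[of n "c _" x] sum_distrib_left mult_ac)
  finally show "dotp n x ?y = quad x" by (simp add: quad_def power2_eq_square)
qed

text \<open>The sum over \<open>i\<close> of the squared moduli of the polynomials with coefficients
  \<open>c i\<close> is the inverse form at the exponential vector; interchanging sum and mean gives
  the trace.\<close>

lemma trace_identity:
  assumes "integrable torus h"
  shows "(\<Sum>i<n. bform n (toep h) (c i) (c i)) = tmean (\<lambda>t. h t * (quad (vcos t) + quad (vsin t)))"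
proof -
  have int: "integrable torus (\<lambda>t. h t * (trig_cos n x t * trig_cos n x t + trig_sin n x t * trig_sin n x t))" for x
    by (intro integrable_torus_continuous_mult assms continuous_intros continuous_trig)
  show ?thesis
    unfolding bform_toep[OF assms] tmean_sum[OF int, symmetric]
    by (simp add: quad_def trig_eq_dotp sum.distrib[symmetric] sum_distrib_left[symmetric] power2_eq_square)
qed

end

section \<open>Christoffel functions of a pair of symbols\<close>

locale spectral_pair =
  fixes f h :: "real \<Rightarrow> real" and a b Cf Ch :: real
  assumes f_int: "integrable torus f"
    and f_pos: "\<And>t. \<bar>t\<bar> \<le> pi \<Longrightarrow> t \<noteq> 0 \<Longrightarrow> 0 < f t"
    and f_even: "\<And>t. f (- t) = f t"
    and f_cont: "\<And>t. -pi < t \<Longrightarrow> t < pi \<Longrightarrow> t \<noteq> 0 \<Longrightarrow> isCont f t"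
    and f_lower: "\<And>t. \<bar>t\<bar> \<le> pi \<Longrightarrow> 1 / f t \<le> Cf * \<bar>t\<bar> powr (- a)"
    and h_int: "integrable torus h"
    and h_nonneg: "\<And>t. \<bar>t\<bar> \<le> pi \<Longrightarrow> 0 \<le> h t"
    and h_upper: "\<And>t. \<bar>t\<bar> \<le> pi \<Longrightarrow> h t \<le> Ch * \<bar>t\<bar> powr (- b)"
    and ab: "0 \<le> a" "0 \<le> b" "a + b < 1"
    and C_pos: "0 < Cf" "0 < Ch"
begin

lemma AE_f_pos: "AE t in torus. 0 < f t"
  using AE_torus_neq[of 0] AE_space[of torus] by eventually_elim (auto intro!: f_pos)

lemma finv_meas: "(\<lambda>t. 1 / f t) \<in> borel_measurable torus"
  using f_int by (intro borel_measurable_divide) auto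

lemma finv_int: "integrable torus (\<lambda>t. 1 / f t)"
proof (rule Bochner_Integration.integrable_bound[OF _ finv_meas])
  show "integrable torus (\<lambda>t. Cf * \<bar>t\<bar> powr (- a))"
    by (intro integrable_mult_right integrable_torus_powr) (use ab in auto)
  show "AE t in torus. norm (1 / f t) \<le> norm (Cf * \<bar>t\<bar> powr (- a))"
    using AE_f_pos AE_space[of torus]
  proof eventually_elim
    case (elim t)
    have "1 / f t \<le> Cf * \<bar>t\<bar> powr (- a)" using elim by (intro f_lower) auto
    with elim C_pos show ?case by simp
  qed
qed

lemma f_inverse_even: "1 / f (- t) = 1 / f t"
  by (simp add: f_even)

definition diagonalising :: "nat \<Rightarrow> (nat \<Rightarrow> nat \<Rightarrow> real) \<Rightarrow> bool" where
  "diagonalising n c \<longleftrightarrow> diagonalised_pair n (toep f) (toep h) c"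

lemma diagonalising_exists: "\<exists>c. diagonalising n c"
proof -
  obtain c where
    "\<And>i j. i < n \<Longrightarrow> j < n \<Longrightarrow> bform n (toep f) (c i) (c j) = (if i = j then 1 else 0)"
    "\<And>i j. i < n \<Longrightarrow> j < n \<Longrightarrow> i \<noteq> j \<Longrightarrow> bform n (toep h) (c i) (c j) = 0"
    "\<And>k l. k < n \<Longrightarrow> l < n \<Longrightarrow> (\<Sum>m<n. toep f k m * (\<Sum>i<n. c i m * c i l)) = (if k = l then 1 else 0)"
    by (rule simultaneous_diagonalisation[of n "toep f" "toep h", OF toep_sym toep_sym bform_toep_pos[OF f_int AE_f_pos]])
      auto
  then show ?thesis
    unfolding diagonalising_def diagonalised_pair_def using toep_sym by blast
qed

text \<open>For diagonalising \<open>c\<close> the value does not depend on \<open>c\<close>, since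
  \<open>quad\<close> is then the inverse form of \<open>toep f\<close>.\<close>

definition christoffel :: "nat \<Rightarrow> (nat \<Rightarrow> nat \<Rightarrow> real) \<Rightarrow> real \<Rightarrow> real" where
  "christoffel n c t = diagonalised_pair.quad n c (vcos t) + diagonalised_pair.quad n c (vsin t)"

lemma christoffel_eq:
  assumes "diagonalising n c"
  shows "christoffel n c t = (\<Sum>i<n. (trig_cos n (c i) t)\<^sup>2 + (trig_sin n (c i) t)\<^sup>2)"
proof -
  interpret diagonalised_pair n "toep f" "toep h" c using assms by (simp add: diagonalising_def)
  show ?thesis by (simp add: christoffel_def quad_def trig_eq_dotp sum.distrib)
qed

lemma fejer_mean_f_pos:
  assumes "n > 0"
  shows "0 < fejer_mean n f t"
proof -
  have "0 < bform n (toep f) (vcos t) (vcos t)"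
    by (rule bform_toep_pos[OF f_int AE_f_pos, of 0]) (use assms in \<open>auto simp: vcos_def\<close>)
  moreover have "0 \<le> bform n (toep f) (vsin t) (vsin t)"
  proof (cases "\<exists>k<n. vsin t k \<noteq> 0")
    case True
    then show ?thesis using bform_toep_pos[OF f_int AE_f_pos] less_imp_le by blast
  next
    case False
    then show ?thesis by (simp add: bform_def)
  qed
  ultimately have "0 < real n * fejer_mean n f t"
    unfolding bform_toep_exponential[of f n t, OF f_int f_even, symmetric] by linarith
  then show ?thesis using assms by (simp add: zero_less_mult_iff)
qed

text \<open>Take \<open>\<tau> = fejer_mean n f t\<close> in \<open>dotp_le_quad_bform\<close>: for
  the two vectors together the left sides add up to \<open>2 * n\<close> and the last terms to
  \<open>n\<close>.\<close>

lemma christoffel_lower: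
  assumes "diagonalising n c" "n > 0"
  shows "1 / fejer_mean n f t \<le> christoffel n c t / real n"
proof -
  interpret diagonalised_pair n "toep f" "toep h" c using assms by (simp add: diagonalising_def)
  let ?s = "fejer_mean n f t"
  have s: "0 < ?s" by (rule fejer_mean_f_pos[OF assms(2)])
  have "bform n (toep f) (vcos t) (vcos t) / ?s + bform n (toep f) (vsin t) (vsin t) / ?s = real n"
    unfolding add_divide_distrib[symmetric] bform_toep_exponential[of f n t, OF f_int f_even] using s by simp
  then have "real n \<le> ?s * christoffel n c t"
    using dotp_le_quad_bform[OF s, of "vcos t"] dotp_le_quad_bform[OF s, of "vsin t"] dotp_vcos_vsin[of n t]
    unfolding christoffel_def distrib_left by linarith
  then show ?thesis using s assms(2) by (simp add: field_simps)
qed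

text \<open>For the dual vector \<open>y\<close>, \<open>quad x\<close> is the mean of the real part
  of \<open>P_x\<close> times the conjugate of \<open>P_y\<close>. Weighting by \<open>f\<close> and
  \<open>1 / f\<close> in the arithmetic-geometric inequality bounds it by half of
  \<open>quad x\<close> plus half of the form of \<open>1 / f\<close>, and the first half is
  absorbed.\<close>

lemma quad_le_inverse_symbol:
  assumes "diagonalising n c"
  shows "diagonalised_pair.quad n c x \<le> bform n (toep (\<lambda>t. 1 / f t)) x x"
proof -
  interpret diagonalised_pair n "toep f" "toep h" c using assms by (simp add: diagonalising_def)
  obtain y where y: "bform n (toep f) y y = quad x" "dotp n x y = quad x" by (rule quad_dual)
  let ?Y = "\<lambda>t. trig_cos n y t * trig_cos n y t + trig_sin n y t * trig_sin n y t"
  let ?X = "\<lambda>t. trig_cos n x t * trig_cos n x t + trig_sin n x t * trig_sin n x t"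
  have intY: "integrable torus (\<lambda>t. f t * ?Y t)"
    by (intro integrable_torus_continuous_mult f_int continuous_intros continuous_trig)
  have intX: "integrable torus (\<lambda>t. 1 / f t * ?X t)"
    by (intro integrable_torus_continuous_mult finv_int continuous_intros continuous_trig)
  have intXY: "integrable torus (\<lambda>t. 1 * (trig_cos n x t * trig_cos n y t + trig_sin n x t * trig_sin n y t))"
    by (intro integrable_torus_continuous_mult integrable_torus_const continuous_intros continuous_trig)
  have "quad x = tmean (\<lambda>t. 1 * (trig_cos n x t * trig_cos n y t + trig_sin n x t * trig_sin n y t))"
    using y(2) dotp_parseval[of n x y] by simp
  also have "\<dots> \<le> tmean (\<lambda>t. 1/2 * (f t * ?Y t) + 1/2 * (1 / f t * ?X t))"
  proof (rule tmean_mono_AE[OF intXY])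
    show "integrable torus (\<lambda>t. 1/2 * (f t * ?Y t) + 1/2 * (1 / f t * ?X t))"
      by (intro Bochner_Integration.integrable_add integrable_mult_right intX intY)
    have ineq: "2 * (u * v) \<le> w * (v * v) + 1 / w * (u * u)" if "0 < w" for u v w :: real
    proof -
      have "0 \<le> (w * v - u)\<^sup>2 / w" using that by simp
      also have "\<dots> = w * (v * v) + 1 / w * (u * u) - 2 * (u * v)"
        using that by (simp add: power2_eq_square field_simps)
      finally show ?thesis by simp
    qed
    show "AE t in torus. 1 * (trig_cos n x t * trig_cos n y t + trig_sin n x t * trig_sin n y t) \<le>
        1/2 * (f t * ?Y t) + 1/2 * (1 / f t * ?X t)"
      using AE_f_pos
    proof eventually_elim
      case (elim t)
      have add: "1 * (p + q) \<le> 1/2 * (A + B) + 1/2 * (C + D)" if "2 * p \<le> A + C" "2 * q \<le> B + D" for p q A B C D :: real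
        using that by (simp add: field_simps)
      show ?case unfolding distrib_left[of "f t"] distrib_left[of "1 / f t"]
        by (rule add[OF ineq[OF elim] ineq[OF elim]])
    qed
  qed
  also have "\<dots> = 1/2 * quad x + 1/2 * bform n (toep (\<lambda>t. 1 / f t)) x x"
    unfolding tmean_add[OF integrable_mult_right[OF intY] integrable_mult_right[OF intX]] tmean_cmult
      bform_toep[OF f_int, symmetric] bform_toep[OF finv_int, symmetric] y(1) ..
  finally show ?thesis by simp
qed

lemma christoffel_upper:
  assumes "diagonalising n c" "n > 0"
  shows "christoffel n c t / real n \<le> fejer_mean n (\<lambda>t. 1 / f t) t"
proof -
  have "christoffel n c t \<le> real n * fejer_mean n (\<lambda>t. 1 / f t) t"
    unfolding christoffel_def bform_toep_exponential[of "\<lambda>t. 1 / f t" n t, OF finv_int f_inverse_even, symmetric]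
    by (intro add_mono quad_le_inverse_symbol assms)
  then show ?thesis using assms(2) by (simp add: field_simps)
qed

lemma christoffel_nonneg: "diagonalising n c \<Longrightarrow> 0 \<le> christoffel n c t"
  by (auto simp: christoffel_eq intro!: sum_nonneg)

lemma christoffel_bound:
  obtains D where "D > 0" "\<And>n c t. diagonalising n c \<Longrightarrow> n > 0 \<Longrightarrow> \<bar>t\<bar> \<le> pi \<Longrightarrow> t \<noteq> 0 \<Longrightarrow>
    christoffel n c t / real n \<le> D * \<bar>t\<bar> powr (- a)"
proof
  let ?D = "Cf * (2 powr a * (1 + 1 / (1 - a)))"
  show "?D > 0" using C_pos ab by (intro mult_pos_pos add_pos_pos) auto
  fix n c t assume n: "diagonalising n c" "n > 0" "\<bar>t\<bar> \<le> pi" "t \<noteq> 0"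
  have "christoffel n c t / real n \<le> fejer_mean n (\<lambda>t. 1 / f t) t" by (rule christoffel_upper[OF n(1,2)])
  also have "\<dots> \<le> ?D * \<bar>t\<bar> powr (- a)"
    using ab C_pos by (intro fejer_mean_powr_le n finv_int f_lower) auto
  finally show "christoffel n c t / real n \<le> ?D * \<bar>t\<bar> powr (- a)" .
qed

lemma christoffel_tendsto:
  assumes c: "\<And>n. diagonalising n (c n)" and t: "-pi < t" "t < pi" "t \<noteq> 0"
  shows "(\<lambda>n. christoffel n (c n) t / real n) \<longlonglongrightarrow> 1 / f t"
proof (rule tendsto_sandwich)
  have "\<bar>t\<bar> \<le> pi" using t by linarith
  then have ft: "f t \<noteq> 0" using f_pos[of t] t by simp
  show "(\<lambda>n. 1 / fejer_mean n f t) \<longlonglongrightarrow> 1 / f t"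
    by (intro tendsto_intros fejer_mean_tendsto f_int f_cont t ft)
  show "(\<lambda>n. fejer_mean n (\<lambda>t. 1 / f t) t) \<longlonglongrightarrow> 1 / f t"
    using f_cont[OF t] ft by (intro fejer_mean_tendsto finv_int t) auto
  show "\<forall>\<^sub>F n in sequentially. 1 / fejer_mean n f t \<le> christoffel n (c n) t / real n"
    using eventually_gt_at_top[of 0] by eventually_elim (rule christoffel_lower[OF c])
  show "\<forall>\<^sub>F n in sequentially. christoffel n (c n) t / real n \<le> fejer_mean n (\<lambda>t. 1 / f t) t"
    using eventually_gt_at_top[of 0] by eventually_elim (rule christoffel_upper[OF c])
qed

end

section \<open>Eigenvalues: normalised trace and uniform bound\<close>

context spectral_pair
begin

definition eigenvalue :: "nat \<Rightarrow> (nat \<Rightarrow> nat \<Rightarrow> real) \<Rightarrow> nat \<Rightarrow> real" where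
  "eigenvalue n c i = bform n (toep h) (c i) (c i)"

lemma eigenvalue_eq:
  "eigenvalue n c i = tmean (\<lambda>t. h t * ((trig_cos n (c i) t)\<^sup>2 + (trig_sin n (c i) t)\<^sup>2))"
  unfolding eigenvalue_def bform_toep[OF h_int] power2_eq_square ..

lemma eigenvalue_nonneg: "0 \<le> eigenvalue n c i"
  unfolding eigenvalue_eq by (rule tmean_nonneg) (auto intro!: mult_nonneg_nonneg h_nonneg)

lemma sum_eigenvalues:
  assumes "diagonalising n c"
  shows "(\<Sum>i<n. eigenvalue n c i) = tmean (\<lambda>t. h t * christoffel n c t)"
proof -
  interpret diagonalised_pair n "toep f" "toep h" c using assms by (simp add: diagonalising_def)
  show ?thesis unfolding eigenvalue_def christoffel_def by (rule trace_identity[OF h_int])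
qed

lemma christoffel_meas:
  assumes "diagonalising n c"
  shows "christoffel n c \<in> borel_measurable torus"
proof -
  have "(\<lambda>t. \<Sum>i<n. (trig_cos n (c i) t)\<^sup>2 + (trig_sin n (c i) t)\<^sup>2) \<in> borel_measurable borel"
    by (intro borel_measurable_continuous_onI continuous_intros continuous_trig)
  then show ?thesis
    using christoffel_eq[OF assms] by (simp add: borel_measurable_torus cong: measurable_cong)
qed

lemma trace_tendsto:
  assumes c: "\<And>n. diagonalising n (c n)"
  shows "(\<lambda>n. (\<Sum>i<n. eigenvalue n (c n) i) / real n) \<longlonglongrightarrow> tmean (\<lambda>t. h t / f t)"
proof -
  obtain D where D: "D > 0" "\<And>n c t. diagonalising n c \<Longrightarrow> n > 0 \<Longrightarrow> \<bar>t\<bar> \<le> pi \<Longrightarrow> t \<noteq> 0 \<Longrightarrow>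
      christoffel n c t / real n \<le> D * \<bar>t\<bar> powr (- a)"
    using christoffel_bound by blast
  define u where "u = (\<lambda>n t. h t * (christoffel (Suc n) (c (Suc n)) t / real (Suc n)))"
  have lim: "(\<lambda>n. integral\<^sup>L torus (u n)) \<longlonglongrightarrow> integral\<^sup>L torus (\<lambda>t. h t / f t)"
  proof (rule integral_dominated_convergence)
    show "(\<lambda>t. h t / f t) \<in> borel_measurable torus"
      using h_int f_int by (intro borel_measurable_divide) auto
    show "u n \<in> borel_measurable torus" for n
      unfolding u_def using h_int christoffel_meas[OF c, of "Suc n"]
      by (intro borel_measurable_times borel_measurable_divide) auto
    \<comment> \<open>The exponents of \<open>h\<close> and of the Christoffel function add up, and
      \<open>a + b < 1\<close> is exactly integrability of this majorant.\<close>
    show "integrable torus (\<lambda>t. Ch * D * \<bar>t\<bar> powr (- b - a))"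
      by (intro integrable_mult_right integrable_torus_powr) (use ab in auto)
    show "AE t in torus. (\<lambda>n. u n t) \<longlonglongrightarrow> h t / f t"
      using AE_torus_neq[of 0] AE_torus_neq[of "-pi"] AE_space[of torus]
    proof eventually_elim
      case (elim t)
      have "(\<lambda>n. christoffel n (c n) t / real n) \<longlonglongrightarrow> 1 / f t"
        using elim by (intro christoffel_tendsto c) auto
      then have "(\<lambda>n. christoffel (Suc n) (c (Suc n)) t / real (Suc n)) \<longlonglongrightarrow> 1 / f t"
        by (rule LIMSEQ_Suc)
      then have "(\<lambda>n. u n t) \<longlonglongrightarrow> h t * (1 / f t)"
        unfolding u_def by (intro tendsto_mult tendsto_const)
      then show ?case by simp
    qed
    show "AE t in torus. norm (u n t) \<le> Ch * D * \<bar>t\<bar> powr (- b - a)" for n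
      using AE_torus_neq[of 0] AE_space[of torus]
    proof eventually_elim
      case (elim t)
      then have t: "\<bar>t\<bar> \<le> pi" "t \<noteq> 0" by auto
      have nn: "0 \<le> christoffel (Suc n) (c (Suc n)) t / real (Suc n)"
        using christoffel_nonneg[OF c] by simp
      have "h t * (christoffel (Suc n) (c (Suc n)) t / real (Suc n)) \<le> (Ch * \<bar>t\<bar> powr (- b)) * (D * \<bar>t\<bar> powr (- a))"
        using C_pos by (intro mult_mono h_upper D c t nn) auto
      also have "\<dots> = Ch * D * (\<bar>t\<bar> powr (- b) * \<bar>t\<bar> powr (- a))" by simp
      also have "\<bar>t\<bar> powr (- b) * \<bar>t\<bar> powr (- a) = \<bar>t\<bar> powr (- b - a)"
        by (simp add: powr_add[symmetric])
      finally have "u n t \<le> Ch * D * \<bar>t\<bar> powr (- b - a)" unfolding u_def .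
      moreover have "0 \<le> u n t" unfolding u_def by (intro mult_nonneg_nonneg h_nonneg t nn)
      ultimately show ?case by simp
    qed
  qed
  have "(\<Sum>i<Suc n. eigenvalue (Suc n) (c (Suc n)) i) / real (Suc n) = tmean (u n)" for n
  proof -
    have "(\<Sum>i<Suc n. eigenvalue (Suc n) (c (Suc n)) i) / real (Suc n) =
        (1 / real (Suc n)) * tmean (\<lambda>t. h t * christoffel (Suc n) (c (Suc n)) t)"
      unfolding sum_eigenvalues[OF c] by simp
    also have "\<dots> = tmean (\<lambda>t. (1 / real (Suc n)) * (h t * christoffel (Suc n) (c (Suc n)) t))"
      by (rule tmean_cmult[symmetric])
    also have "\<dots> = tmean (u n)" unfolding u_def by (simp add: mult_ac)
    finally show ?thesis .
  qed
  then have "(\<lambda>n. (\<Sum>i<Suc n. eigenvalue (Suc n) (c (Suc n)) i) / real (Suc n)) \<longlonglongrightarrow> tmean (\<lambda>t. h t / f t)"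
    using lim by (simp only: tmean_def) (intro tendsto_intros)
  then show ?thesis by (rule LIMSEQ_imp_Suc)
qed

text \<open>Splitting at \<open>\<bar>t\<bar> = 1/n\<close>: near \<open>0\<close> the polynomial is bounded by the Christoffel function,
  away from \<open>0\<close> the weight \<open>h\<close> is at most \<open>n powr (a + b)\<close> times \<open>f\<close>.\<close>

lemma eigenvalue_le:
  obtains E where "E > 0" "\<And>n c i. diagonalising n c \<Longrightarrow> i < n \<Longrightarrow> eigenvalue n c i \<le> E * real n powr (a + b)"
proof -
  obtain D where D: "D > 0" "\<And>n c t. diagonalising n c \<Longrightarrow> n > 0 \<Longrightarrow> \<bar>t\<bar> \<le> pi \<Longrightarrow> t \<noteq> 0 \<Longrightarrow>
      christoffel n c t / real n \<le> D * \<bar>t\<bar> powr (- a)"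
    using christoffel_bound by blast
  \<comment> \<open>The first summand is the integral of \<open>\<bar>t\<bar> powr (- b - a)\<close>
    over \<open>\<bar>t\<bar> \<le> 1 / n\<close>, scaled by \<open>n\<close>. The second comes from
    comparing \<open>h\<close> with \<open>f\<close> outside, where normalisation makes the mean of
    \<open>f * X\<close> equal to 1.\<close>
  define E where "E = Ch * D / (pi * (1 - a - b)) + Ch * Cf"
  show thesis
  proof
    show "E > 0" unfolding E_def using C_pos D ab by (intro add_pos_pos mult_pos_pos divide_pos_pos) auto
    fix n c i assume c: "diagonalising n c" and i: "i < n"
    interpret diagonalised_pair n "toep f" "toep h" c using c by (simp add: diagonalising_def)
    have n: "n > 0" using i by simp
    define d where "d = 1 / real n"
    have d: "0 < d" "d \<le> 1" using n by (auto simp: d_def)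
    define X where "X = (\<lambda>t. (trig_cos n (c i) t)\<^sup>2 + (trig_sin n (c i) t)\<^sup>2)"
    have X0: "0 \<le> X t" for t by (simp add: X_def)
    have Xc: "X t \<le> christoffel n c t" for t
      unfolding christoffel_eq[OF c] X_def
      by (rule member_le_sum[of i "{..<n}" "\<lambda>i. (trig_cos n (c i) t)\<^sup>2 + (trig_sin n (c i) t)\<^sup>2"]) (use i in auto)
    have intf: "integrable torus (\<lambda>t. f t * X t)"
      unfolding X_def by (intro integrable_torus_continuous_mult f_int continuous_intros continuous_trig)
    have inth: "integrable torus (\<lambda>t. h t * X t)"
      unfolding X_def by (intro integrable_torus_continuous_mult h_int continuous_intros continuous_trig)
    have intp: "integrable torus (\<lambda>t. indicator {-d..d} t * \<bar>t\<bar> powr (- b - a))"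
      by (rule integrable_torus_powr_near_0) (use ab in auto)
    have one: "tmean (\<lambda>t. f t * X t) = 1"
      using orth[OF i i] unfolding bform_toep[OF f_int] X_def power2_eq_square by simp
    let ?k = "Ch * Cf * d powr (- b - a)" and ?l = "Ch * (real n * D)"
    have "eigenvalue n c i = tmean (\<lambda>t. h t * X t)"
      unfolding eigenvalue_eq X_def ..
    also have "\<dots> \<le> tmean (\<lambda>t. ?l * (indicator {-d..d} t * \<bar>t\<bar> powr (- b - a)) + ?k * (f t * X t))"
    proof (rule tmean_mono_AE[OF inth])
      show "integrable torus (\<lambda>t. ?l * (indicator {-d..d} t * \<bar>t\<bar> powr (- b - a)) + ?k * (f t * X t))"
        by (intro Bochner_Integration.integrable_add integrable_mult_right intp intf)
      show "AE t in torus. h t * X t \<le> ?l * (indicator {-d..d} t * \<bar>t\<bar> powr (- b - a)) + ?k * (f t * X t)"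
        using AE_torus_neq[of 0] AE_space[of torus] AE_f_pos
      proof eventually_elim
        case (elim t)
        then have t: "\<bar>t\<bar> \<le> pi" "t \<noteq> 0" by auto
        have pa: "\<bar>t\<bar> powr (- b) * \<bar>t\<bar> powr (- a) = \<bar>t\<bar> powr (- b - a)"
          by (simp add: powr_add[symmetric])
        show ?case
        proof (cases "\<bar>t\<bar> \<le> d")
          case True
          have "christoffel n c t \<le> real n * (D * \<bar>t\<bar> powr (- a))"
            using D(2)[OF c n t] n by (simp add: pos_divide_le_eq mult.commute)
          then have "X t \<le> real n * (D * \<bar>t\<bar> powr (- a))" using Xc[of t] by linarith
          then have "h t * X t \<le> (Ch * \<bar>t\<bar> powr (- b)) * (real n * (D * \<bar>t\<bar> powr (- a)))"
            using C_pos by (intro mult_mono h_upper t X0) auto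
          also have "\<dots> = ?l * (\<bar>t\<bar> powr (- b) * \<bar>t\<bar> powr (- a))" by simp
          also have "\<dots> = ?l * (indicator {-d..d} t * \<bar>t\<bar> powr (- b - a))"
            unfolding pa using True by (auto simp: indicator_def abs_le_iff)
          finally have "h t * X t \<le> ?l * (indicator {-d..d} t * \<bar>t\<bar> powr (- b - a))" .
          moreover have "0 \<le> ?k * (f t * X t)"
            using C_pos elim X0[of t] by (intro mult_nonneg_nonneg) auto
          ultimately show ?thesis by linarith
        next
          case False
          have "1 \<le> Cf * \<bar>t\<bar> powr (- a) * f t"
            using f_lower[OF t(1)] elim by (simp add: pos_divide_le_eq)
          then have "h t * 1 \<le> (Ch * \<bar>t\<bar> powr (- b)) * (Cf * \<bar>t\<bar> powr (- a) * f t)"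
            using C_pos by (intro mult_mono h_upper t) auto
          also have "\<dots> = Ch * Cf * (\<bar>t\<bar> powr (- b) * \<bar>t\<bar> powr (- a)) * f t" by simp
          also have "\<dots> \<le> ?k * f t"
            unfolding pa using False d ab C_pos elim
            by (intro mult_right_mono mult_left_mono powr_mono2') auto
          finally have "h t * X t \<le> ?k * f t * X t"
            by (intro mult_right_mono X0) simp
          moreover have "0 \<le> ?l * (indicator {-d..d} t * \<bar>t\<bar> powr (- b - a))"
            using C_pos D by (intro mult_nonneg_nonneg) auto
          ultimately show ?thesis by simp
        qed
      qed
    qed
    also have "\<dots> = ?l * tmean (\<lambda>t. indicator {-d..d} t * \<bar>t\<bar> powr (- b - a)) + ?k * 1"
      unfolding tmean_add[OF integrable_mult_right[OF intp] integrable_mult_right[OF intf]] tmean_cmult one ..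
    also have "tmean (\<lambda>t. indicator {-d..d} t * \<bar>t\<bar> powr (- b - a)) = d powr (- b - a + 1) / (pi * (- b - a + 1))"
      using ab d pi_gt3 by (intro tmean_powr_near_0) auto
    also have "d powr (- b - a + 1) = d powr (- b - a) * d"
      using d by (simp add: powr_add powr_one del: add_uminus_conv_diff)
    also have "d powr (- b - a) = real n powr (a + b)"
    proof -
      have "d powr (- b - a) = inverse (d powr (a + b))"
        using powr_minus[of d "a + b"] by (simp only: minus_add add.commute diff_conv_add_uminus)
      also have "d powr (a + b) = 1 / real n powr (a + b)"
        unfolding d_def by (simp add: powr_divide)
      finally show ?thesis by simp
    qed
    also have "Ch * (real n * D) * (real n powr (a + b) * d / (pi * (- b - a + 1))) + Ch * Cf * real n powr (a + b) * 1 =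
        E * real n powr (a + b)"
    proof -
      have nd: "real n * d = 1" using n by (simp add: d_def)
      have "Ch * (real n * D) * (x * d / (pi * (- b - a + 1))) + Ch * Cf * x * 1 = (Ch * D * (real n * d) / (pi * (1 - a - b)) + Ch * Cf) * x" for x
        by (simp add: algebra_simps)
      then show ?thesis unfolding nd E_def by simp
    qed
    finally show "eigenvalue n c i \<le> E * real n powr (a + b)" .
  qed
qed

end

section \<open>Almost sure convergence\<close>

lemma abs_powr_le_powr:
  fixes p q t :: real
  assumes "p \<le> q" "\<bar>t\<bar> \<le> pi"
  shows "\<bar>t\<bar> powr q \<le> pi powr (q - p) * \<bar>t\<bar> powr p"
proof -
  have "\<bar>t\<bar> powr q = \<bar>t\<bar> powr (q - p) * \<bar>t\<bar> powr p"
    by (simp add: powr_add[symmetric])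
  also have "\<dots> \<le> pi powr (q - p) * \<bar>t\<bar> powr p"
    using assms by (intro mult_right_mono powr_mono2) auto
  finally show ?thesis .
qed

lemma integrable_torus_g_dens:
  assumes "-1/2 < \<alpha>" "\<alpha> < 1/2"
  shows "integrable torus (g_dens \<alpha>)"
proof -
  have "integrable lborel (\<lambda>t. fgn_const (1/2 + \<alpha>) * (indicator {-pi..<pi} t * fgn_raw (1/2 + \<alpha>) t))"
    using assms by (intro integrable_mult_right integrable_fgn_raw) auto
  then show ?thesis
    by (simp add: integrable_torus_iff g_dens_def fgn_density_def mult_ac)
qed

lemma g_dens_nonneg:
  assumes "-1/2 < \<alpha>" "\<alpha> < 1/2"
  shows "0 \<le> g_dens \<alpha> t"
  using fgn_const_pos[of "1/2 + \<alpha>"] fgn_raw_nonneg assms by (simp add: g_dens_def fgn_density_def)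

lemma g_dens_lower:
  assumes "-1/2 < \<alpha>" "\<alpha> < 1/2"
  obtains k where "k > 0" "\<And>t. \<bar>t\<bar> \<le> pi \<Longrightarrow> k * \<bar>t\<bar> powr (- 2 * \<alpha>) \<le> g_dens \<alpha> t"
proof
  let ?H = "1/2 + \<alpha>"
  have K: "fgn_const ?H > 0" using assms by (intro fgn_const_pos) auto
  then show "fgn_const ?H * (4 / pi\<^sup>2) > 0" by simp
  fix t :: real assume "\<bar>t\<bar> \<le> pi"
  then have "4 / pi\<^sup>2 * \<bar>t\<bar> powr (1 - 2 * ?H) \<le> fgn_raw ?H t"
    using assms by (intro fgn_raw_lower) auto
  also have "1 - 2 * ?H = - 2 * \<alpha>" by simp
  finally have "fgn_const ?H * (4 / pi\<^sup>2 * \<bar>t\<bar> powr (- 2 * \<alpha>)) \<le> fgn_const ?H * fgn_raw ?H t"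
    using K by (intro mult_left_mono) auto
  then show "fgn_const ?H * (4 / pi\<^sup>2) * \<bar>t\<bar> powr (- 2 * \<alpha>) \<le> g_dens \<alpha> t"
    by (simp only: g_dens_def fgn_density_def mult.assoc)
qed

lemma g_dens_upper:
  assumes "-1/2 < \<beta>" "\<beta> < 1/2"
  obtains k where "k > 0" "\<And>t. \<bar>t\<bar> \<le> pi \<Longrightarrow> g_dens \<beta> t \<le> k * \<bar>t\<bar> powr (- 2 * \<beta>)"
proof -
  let ?H = "1/2 + \<beta>"
  have K: "fgn_const ?H > 0" using assms by (intro fgn_const_pos) auto
  obtain C where C: "C > 0" "\<And>t. \<bar>t\<bar> \<le> pi \<Longrightarrow> fgn_raw ?H t \<le> C * \<bar>t\<bar> powr (1 - 2 * ?H)"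
    using fgn_raw_upper[of ?H] assms by auto
  show thesis
  proof
    show "fgn_const ?H * C > 0" using K C by simp
    fix t :: real assume "\<bar>t\<bar> \<le> pi"
    then have "fgn_raw ?H t \<le> C * \<bar>t\<bar> powr (1 - 2 * ?H)" by (rule C(2))
    also have "1 - 2 * ?H = - 2 * \<beta>" by simp
    finally have "fgn_const ?H * fgn_raw ?H t \<le> fgn_const ?H * (C * \<bar>t\<bar> powr (- 2 * \<beta>))"
      using K by (intro mult_left_mono) auto
    then show "g_dens \<beta> t \<le> fgn_const ?H * C * \<bar>t\<bar> powr (- 2 * \<beta>)"
      by (simp only: g_dens_def fgn_density_def mult.assoc)
  qed
qed

lemma g_dens_spectral_pair:
  assumes \<alpha>: "-1/2 < \<alpha>" "\<alpha> < 1/2" and \<beta>: "-1/2 < \<beta>" "\<beta> < 1/2"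
    and ab: "max (-\<alpha>) 0 + max \<beta> 0 < 1/2"
  obtains Cf Ch where
    "spectral_pair (g_dens \<alpha>) (g_dens \<beta>) (2 * max (-\<alpha>) 0) (2 * max \<beta> 0) Cf Ch"
proof -
  let ?a = "2 * max (-\<alpha>) 0" and ?b = "2 * max \<beta> 0"
  obtain k where k: "k > 0" "\<And>t. \<bar>t\<bar> \<le> pi \<Longrightarrow> k * \<bar>t\<bar> powr (- 2 * \<alpha>) \<le> g_dens \<alpha> t"
    using g_dens_lower[OF \<alpha>] by blast
  obtain l where l: "l > 0" "\<And>t. \<bar>t\<bar> \<le> pi \<Longrightarrow> g_dens \<beta> t \<le> l * \<bar>t\<bar> powr (- 2 * \<beta>)"
    using g_dens_upper[OF \<beta>] by blast
  \<comment> \<open>The true exponents are \<open>2 * \<alpha>\<close> and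
    \<open>- 2 * \<beta>\<close>. Replacing them by the non-positive \<open>- ?a\<close> and
    \<open>- ?b\<close> costs powers of \<open>pi\<close>, as \<open>\<bar>t\<bar>\<close> may
    exceed 1.\<close>
  define Cf where "Cf = 1 / k * pi powr (2 * \<alpha> - (- ?a))"
  define Ch where "Ch = l * pi powr (- 2 * \<beta> - (- ?b))"
  have pos: "0 < g_dens \<alpha> t" if "\<bar>t\<bar> \<le> pi" "t \<noteq> 0" for t
  proof -
    have "0 < k * \<bar>t\<bar> powr (- 2 * \<alpha>)" using k that by simp
    also have "\<dots> \<le> g_dens \<alpha> t" by (rule k(2)[OF that(1)])
    finally show ?thesis .
  qed
  have "spectral_pair (g_dens \<alpha>) (g_dens \<beta>) ?a ?b Cf Ch"
  proof
    show "integrable torus (g_dens \<alpha>)" by (rule integrable_torus_g_dens[OF \<alpha>])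
    show "integrable torus (g_dens \<beta>)" by (rule integrable_torus_g_dens[OF \<beta>])
    show "0 < g_dens \<alpha> t" if "\<bar>t\<bar> \<le> pi" "t \<noteq> 0" for t by (rule pos[OF that])
    show "g_dens \<alpha> (- t) = g_dens \<alpha> t" for t
      by (simp add: g_dens_def fgn_density_def fgn_raw_even)
    show "isCont (g_dens \<alpha>) t" if "-pi < t" "t < pi" "t \<noteq> 0" for t
    proof -
      have "continuous_on ({-pi<..<pi} - {0}) (g_dens \<alpha>)"
        unfolding g_dens_def fgn_density_def[abs_def]
        using \<alpha> by (intro continuous_intros continuous_on_fgn_raw) auto
      then show ?thesis
        using that by (subst (asm) continuous_on_eq_continuous_at) (auto intro!: open_Diff)
    qed
    show "1 / g_dens \<alpha> t \<le> Cf * \<bar>t\<bar> powr (- ?a)" if t: "\<bar>t\<bar> \<le> pi" for t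
    proof (cases "t = 0")
      case True
      \<comment> \<open>Both sides are 0 here: the density vanishes at 0, division by it yields 0,
        and so does \<open>0 powr (- ?a)\<close>.\<close>
      then show ?thesis by (simp add: g_dens_def fgn_density_def fgn_raw_0)
    next
      case False
      have "1 / g_dens \<alpha> t \<le> 1 / (k * \<bar>t\<bar> powr (- 2 * \<alpha>))"
        using k(2)[OF t] k(1) False pos[OF t False] by (intro divide_left_mono mult_pos_pos) auto
      also have "\<dots> = 1 / k * \<bar>t\<bar> powr (2 * \<alpha>)"
        using powr_minus[of "\<bar>t\<bar>" "2 * \<alpha>"] by (simp add: divide_inverse)
      also have "\<dots> \<le> 1 / k * (pi powr (2 * \<alpha> - (- ?a)) * \<bar>t\<bar> powr (- ?a))"
        using k t by (intro mult_left_mono abs_powr_le_powr) auto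
      finally show ?thesis by (simp only: Cf_def mult.assoc)
    qed
    show "0 \<le> g_dens \<beta> t" for t by (rule g_dens_nonneg[OF \<beta>])
    show "g_dens \<beta> t \<le> Ch * \<bar>t\<bar> powr (- ?b)" if t: "\<bar>t\<bar> \<le> pi" for t
    proof -
      have "g_dens \<beta> t \<le> l * \<bar>t\<bar> powr (- 2 * \<beta>)" by (rule l(2)[OF t])
      also have "\<dots> \<le> l * (pi powr (- 2 * \<beta> - (- ?b)) * \<bar>t\<bar> powr (- ?b))"
        using l t by (intro mult_left_mono abs_powr_le_powr) auto
      finally show ?thesis by (simp only: Ch_def mult.assoc)
    qed
    show "0 < Cf" "0 < Ch" using k l by (simp_all add: Cf_def Ch_def)
  qed (use ab in auto)
  then show thesis by (rule that)
qed

lemma toeplitz_g_dens: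
  assumes "-1/2 < \<alpha>" "\<alpha> < 1/2"
  shows "toeplitz n (g_dens \<alpha>) = mat n n (\<lambda>(j, k). complex_of_real (toep (g_dens \<alpha>) j k))"
  using fourier_coeff_fgn_density[of "1/2 + \<alpha>"] assms by (simp add: toeplitz_def toep_def g_dens_def)

section \<open>Summable deviations and Borel--Cantelli\<close>

lemma summable_exp_powr:
  fixes \<gamma> p :: real
  assumes "\<gamma> > 0" "p > 0"
  shows "summable (\<lambda>n. exp (- (\<gamma> * real n powr p)))"
proof -
  \<comment> \<open>The exponential eventually beats the \<open>k\<close>-th power of its argument;
    this choice makes the comparison series decay faster than \<open>1 / n\<^sup>2\<close>.\<close>
  obtain k :: nat where k: "2 / p < real k" using reals_Archimedean2 by blast
  then have pk: "p * real k > 2" using assms by (simp add: pos_divide_less_eq mult.commute)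
  have "filterlim (\<lambda>n. inverse (real n powr (- p))) at_top sequentially"
  proof (rule filterlim_inverse_at_top)
    show "(\<lambda>n. real n powr (- p)) \<longlonglongrightarrow> 0"
      using assms by (intro tendsto_neg_powr filterlim_real_sequentially) auto
    show "\<forall>\<^sub>F n in sequentially. 0 < real n powr (- p)"
      using eventually_gt_at_top[of 0] by eventually_elim simp
  qed
  then have "filterlim (\<lambda>n. real n powr p) at_top sequentially"
    by (simp add: powr_minus)
  then have "filterlim (\<lambda>n. \<gamma> * real n powr p) at_top sequentially"
    using assms by (intro filterlim_tendsto_pos_mult_at_top[OF tendsto_const]) auto
  then have "(\<lambda>n. (\<gamma> * real n powr p) ^ k / exp (\<gamma> * real n powr p)) \<longlonglongrightarrow> 0"
    by (rule filterlim_compose[OF tendsto_power_div_exp_0])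
  then have "\<forall>\<^sub>F n in sequentially. (\<gamma> * real n powr p) ^ k / exp (\<gamma> * real n powr p) < 1"
    by (rule order_tendstoD(2)) simp
  then have "\<forall>\<^sub>F n in sequentially. norm (exp (- (\<gamma> * real n powr p))) \<le> 1 / \<gamma> ^ k * real n powr (- (p * real k))"
    using eventually_gt_at_top[of 0]
  proof eventually_elim
    case (elim n)
    have "(real n powr p) ^ k = real n powr (p * real k)"
      using elim by (simp add: powr_realpow[symmetric] powr_powr)
    then have x: "(\<gamma> * real n powr p) ^ k = \<gamma> ^ k * real n powr (p * real k)"
      by (simp add: power_mult_distrib)
    have pos: "0 < \<gamma> ^ k * real n powr (p * real k)" using elim assms by simp
    have "\<gamma> ^ k * real n powr (p * real k) \<le> exp (\<gamma> * real n powr p)"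
      using elim unfolding x by (simp add: pos_divide_less_eq)
    then have "1 / exp (\<gamma> * real n powr p) \<le> 1 / (\<gamma> ^ k * real n powr (p * real k))"
      using pos by (intro divide_left_mono mult_pos_pos[OF exp_gt_zero pos]) auto
    then show ?case by (simp add: exp_minus powr_minus divide_inverse)
  qed
  moreover have "summable (\<lambda>n. 1 / \<gamma> ^ k * real n powr (- (p * real k)))"
    using pk by (intro summable_mult) (simp add: summable_real_powr_iff)
  ultimately show ?thesis by (rule summable_comparison_test_ev)
qed

text \<open>Borel--Cantelli for each threshold \<open>1 / (m + 1)\<close>; countably many thresholds
  leave a single null set.\<close>

lemma AE_tendsto_zero_of_summable_deviations:
  fixes X :: "nat \<Rightarrow> 'a \<Rightarrow> real"
  assumes M: "prob_space M" and meas[measurable]: "\<And>n. X n \<in> borel_measurable M"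
    and summ: "\<And>\<delta>. \<delta> > 0 \<Longrightarrow> summable (\<lambda>n. measure M {\<omega> \<in> space M. \<delta> \<le> \<bar>X n \<omega>\<bar>})"
  shows "AE \<omega> in M. (\<lambda>n. X n \<omega>) \<longlonglongrightarrow> 0"
proof -
  interpret prob_space M by fact
  have "AE \<omega> in M. \<forall>\<^sub>F n in sequentially. \<omega> \<in> space M - {\<omega> \<in> space M. inverse (real (Suc m)) \<le> \<bar>X n \<omega>\<bar>}" for m
    by (rule borel_cantelli_AE1) (auto intro: summ simp: emeasure_eq_measure)
  then have "AE \<omega> in M. \<forall>m. \<forall>\<^sub>F n in sequentially. \<omega> \<in> space M - {\<omega> \<in> space M. inverse (real (Suc m)) \<le> \<bar>X n \<omega>\<bar>}"
    by (simp only: AE_all_countable) blast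
  then show ?thesis
  proof eventually_elim
    case (elim \<omega>)
    show ?case
    proof (rule tendstoI)
      fix e :: real assume "e > 0"
      then obtain m where m: "inverse (real (Suc m)) < e" using reals_Archimedean by blast
      from elim[rule_format, of m] show "\<forall>\<^sub>F n in sequentially. dist (X n \<omega>) 0 < e"
        by eventually_elim (use m in auto)
    qed
  qed
qed

lemma (in spectral_pair) normalised_quadratic_form_deviation:
  fixes \<xi> :: "nat \<Rightarrow> 'a \<Rightarrow> nat \<Rightarrow> real"
  assumes M: "prob_space M"
    and gauss: "\<And>n. centered_gaussian M n (\<xi> n) (mat n n (\<lambda>(j, k). complex_of_real (toep h j k)))"
    and c: "\<And>n. diagonalising n (c n)"
  shows "AE \<omega> in M. (\<lambda>n. ((\<Sum>i<n. (dotp n (c n i) (\<xi> n \<omega>))\<^sup>2) - (\<Sum>i<n. eigenvalue n (c n) i)) / real n) \<longlonglongrightarrow> 0"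
proof (rule AE_tendsto_zero_of_summable_deviations[OF M])
  define Y where "Y = (\<lambda>n i \<omega>. dotp n (c n i) (\<xi> n \<omega>))"
  define T where "T = (\<lambda>n. \<Sum>i<n. eigenvalue n (c n) i)"
  have Ym: "Y n i \<in> borel_measurable M" for n i
    unfolding Y_def dotp_def using gauss[of n] unfolding centered_gaussian_def
    by (intro borel_measurable_sum borel_measurable_times) auto
  have Qm: "(\<lambda>\<omega>. \<Sum>i<n. (Y n i \<omega>)\<^sup>2) \<in> borel_measurable M" for n
    by (intro borel_measurable_sum borel_measurable_power Ym)
  then show "(\<lambda>\<omega>. ((\<Sum>i<n. (dotp n (c n i) (\<xi> n \<omega>))\<^sup>2) - (\<Sum>i<n. eigenvalue n (c n) i)) / real n) \<in> borel_measurable M" for n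
    unfolding Y_def by (intro borel_measurable_divide borel_measurable_diff) auto
  \<comment> \<open>A combination of the \<open>Y n i\<close> is a linear functional of
    \<open>\<xi> n\<close> with coefficient vector \<open>?v\<close>. As \<open>toep h\<close> is
    diagonal in the basis \<open>c n\<close>, its variance has no cross terms.\<close>
  have cf: "(CLINT \<omega>|M. cis (\<Sum>i<n. \<theta> i * Y n i \<omega>)) =
      complex_of_real (exp (- (\<Sum>i<n. (\<theta> i)\<^sup>2 * eigenvalue n (c n) i) / 2))" for n and \<theta> :: "nat \<Rightarrow> real"
  proof -
    interpret diagonalised_pair n "toep f" "toep h" "c n" using c by (simp add: diagonalising_def)
    let ?v = "\<lambda>k. \<Sum>i<n. \<theta> i * c n i k"
    have "(\<Sum>i<n. \<theta> i * Y n i \<omega>) = (\<Sum>k<n. ?v k * \<xi> n \<omega> k)" for \<omega>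
      unfolding Y_def dotp_def sum_distrib_left sum_distrib_right mult.assoc by (rule sum.swap)
    then have "(CLINT \<omega>|M. cis (\<Sum>i<n. \<theta> i * Y n i \<omega>)) =
        exp (- (1/2) * (\<Sum>i<n. \<Sum>j<n. complex_of_real (?v i * ?v j) * (mat n n (\<lambda>(j, k). complex_of_real (toep h j k))) $$ (i, j)))"
      using gauss[of n] unfolding centered_gaussian_def by simp
    also have "(\<Sum>i<n. \<Sum>j<n. complex_of_real (?v i * ?v j) * (mat n n (\<lambda>(j, k). complex_of_real (toep h j k))) $$ (i, j)) =
        complex_of_real (bform n (toep h) ?v ?v)"
      unfolding bform_def of_real_sum by (intro sum.cong refl) (simp add: mult_ac)
    also have "bform n (toep h) ?v ?v = (\<Sum>i<n. (\<theta> i)\<^sup>2 * eigenvalue n (c n) i)"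
    proof -
      have "bform n (toep h) ?v ?v = (\<Sum>i<n. \<Sum>j<n. if i = j then (\<theta> i)\<^sup>2 * eigenvalue n (c n) i else 0)"
        unfolding bform_linear_combination bform_def[of _ "\<lambda>a b. bform n (toep h) (c n a) (c n b)"]
        by (intro sum.cong refl) (auto simp: diag eigenvalue_def power2_eq_square)
      then show ?thesis by simp
    qed
    finally show ?thesis by (simp add: exp_of_real[symmetric])
  qed
  obtain E where E: "E > 0" "\<And>n c i. diagonalising n c \<Longrightarrow> i < n \<Longrightarrow> eigenvalue n c i \<le> E * real n powr (a + b)"
    using eigenvalue_le by blast
  have "Bseq (\<lambda>n. T n / real n)"
    unfolding T_def by (rule convergent_imp_Bseq, rule convergentI, rule trace_tendsto[OF c])
  then obtain \<tau> where \<tau>: "\<tau> > 0" "\<And>n. norm (T n / real n) \<le> \<tau>" by (auto simp: Bseq_def)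
  fix \<delta> :: real assume \<delta>: "\<delta> > 0"
  \<comment> \<open>With \<open>s = \<eta> / \<Lambda>\<close>, the bound \<open>1/4\<close> meets
    the condition \<open>4 * s * \<Lambda> \<le> 1\<close>, and
    \<open>\<delta> / (8 * \<tau>)\<close> keeps the quadratic term below half of
    \<open>s * n * \<delta>\<close>. The other half equals
    \<open>\<gamma> * n powr (1 - (a + b))\<close>.\<close>
  define \<eta> where "\<eta> = min (1/4) (\<delta> / (8 * \<tau>))"
  have \<eta>: "\<eta> > 0" "\<eta> \<le> 1/4" "8 * \<eta> * \<tau> \<le> \<delta>"
  proof -
    show "\<eta> > 0" "\<eta> \<le> 1/4" using \<tau>(1) \<delta> by (auto simp: \<eta>_def)
    have "\<eta> \<le> \<delta> / (8 * \<tau>)" by (simp add: \<eta>_def)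
    then show "8 * \<eta> * \<tau> \<le> \<delta>" using \<tau>(1) by (simp add: pos_le_divide_eq mult_ac)
  qed
  define \<gamma> where "\<gamma> = \<eta> * \<delta> / (2 * E)"
  have \<gamma>: "\<gamma> > 0" using \<eta> \<delta> E by (simp add: \<gamma>_def)
  show "summable (\<lambda>n. measure M {\<omega> \<in> space M. \<delta> \<le> \<bar>((\<Sum>i<n. (dotp n (c n i) (\<xi> n \<omega>))\<^sup>2) - (\<Sum>i<n. eigenvalue n (c n) i)) / real n\<bar>})"
  proof (rule summable_comparison_test_ev)
    show "summable (\<lambda>n. 2 * exp (- (\<gamma> * real n powr (1 - (a + b)))))"
      using \<gamma> ab by (intro summable_mult summable_exp_powr) auto
    show "\<forall>\<^sub>F n in sequentially. norm (measure M {\<omega> \<in> space M. \<delta> \<le> \<bar>((\<Sum>i<n. (dotp n (c n i) (\<xi> n \<omega>))\<^sup>2) - (\<Sum>i<n. eigenvalue n (c n) i)) / real n\<bar>})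
        \<le> 2 * exp (- (\<gamma> * real n powr (1 - (a + b))))"
      using eventually_gt_at_top[of 0]
    proof eventually_elim
      case (elim n)
      define \<Lambda> where "\<Lambda> = E * real n powr (a + b)"
      have \<Lambda>: "\<Lambda> > 0" using E elim by (simp add: \<Lambda>_def)
      define s where "s = \<eta> / \<Lambda>"
      have s: "s \<ge> 0" "4 * s * \<Lambda> \<le> 1" "s * \<Lambda> = \<eta>" using \<Lambda> \<eta> by (auto simp: s_def)
      have "{\<omega> \<in> space M. \<delta> \<le> \<bar>((\<Sum>i<n. (dotp n (c n i) (\<xi> n \<omega>))\<^sup>2) - (\<Sum>i<n. eigenvalue n (c n) i)) / real n\<bar>} =
          {\<omega> \<in> space M. real n * \<delta> \<le> \<bar>(\<Sum>i<n. (Y n i \<omega>)\<^sup>2) - (\<Sum>i<n. eigenvalue n (c n) i)\<bar>}"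
        using elim by (auto simp: Y_def pos_le_divide_eq mult.commute)
      then have "measure M {\<omega> \<in> space M. \<delta> \<le> \<bar>((\<Sum>i<n. (dotp n (c n i) (\<xi> n \<omega>))\<^sup>2) - (\<Sum>i<n. eigenvalue n (c n) i)) / real n\<bar>} \<le>
          2 * exp (4 * s\<^sup>2 * \<Lambda> * T n - s * (real n * \<delta>))"
        unfolding T_def
        using sum_squares_concentration[OF M, of n "Y n" "eigenvalue n (c n)" \<Lambda> s "real n * \<delta>", OF Ym eigenvalue_nonneg _ cf s(1,2)]
          E(2)[OF c, of _ n] by (simp add: \<Lambda>_def)
      also have "4 * s\<^sup>2 * \<Lambda> * T n - s * (real n * \<delta>) \<le> - (\<gamma> * real n powr (1 - (a + b)))"
      proof -
        have "\<bar>T n\<bar> \<le> \<tau> * real n" using \<tau>(2)[of n] elim by (simp add: pos_divide_le_eq)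
        then have "T n \<le> \<tau> * real n" by linarith
        then have "(4 * s * \<eta>) * T n \<le> (4 * s * \<eta>) * (\<tau> * real n)"
          using s \<eta> by (intro mult_left_mono) auto
        also have "\<dots> = (s * real n / 2) * (8 * \<eta> * \<tau>)" by simp
        also have "\<dots> \<le> (s * real n / 2) * \<delta>"
          using s \<eta> by (intro mult_left_mono) auto
        finally have "(4 * s * \<eta>) * T n - s * (real n * \<delta>) \<le> - (s * real n * \<delta> / 2)"
          by (simp add: algebra_simps)
        moreover have "4 * s\<^sup>2 * \<Lambda> * T n = (4 * s * \<eta>) * T n"
          by (simp add: s(3)[symmetric] power2_eq_square)
        moreover have "s * real n * \<delta> / 2 = \<gamma> * real n powr (1 - (a + b))"
          using elim E by (simp add: s_def \<Lambda>_def \<gamma>_def powr_diff mult_ac)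
        ultimately show ?thesis by (simp only:)
      qed
      finally show ?case by simp
    qed
  qed
qed

theorem theorem2:
  fixes M :: "'a measure" and \<alpha> \<beta> :: real and \<xi> :: "nat \<Rightarrow> 'a \<Rightarrow> nat \<Rightarrow> real"
  assumes "prob_space M"
    and "-1/2 < \<alpha>" "\<alpha> < 1/2" "-1/2 < \<beta>" "\<beta> < 1/2"
    and "max (-\<alpha>) 0 + max \<beta> 0 < 1/2"
    and "\<And>n. centered_gaussian M n (\<xi> n) (toeplitz n (g_dens \<beta>))"
  shows "AE \<omega> in M. (\<lambda>n. quad_inv n (toeplitz n (g_dens \<alpha>)) (\<xi> n \<omega>) / of_nat n)
           \<longlonglongrightarrow> complex_of_real (1 / (2 * pi) *
                 set_lebesgue_integral lborel {-pi..<pi} (\<lambda>t. g_dens \<beta> t / g_dens \<alpha> t))"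
proof -
  obtain Cf Ch where "spectral_pair (g_dens \<alpha>) (g_dens \<beta>) (2 * max (-\<alpha>) 0) (2 * max \<beta> 0) Cf Ch"
    using g_dens_spectral_pair assms by blast
  then interpret spectral_pair "g_dens \<alpha>" "g_dens \<beta>" "2 * max (-\<alpha>) 0" "2 * max \<beta> 0" Cf Ch .
  obtain c where c: "\<And>n. diagonalising n (c n)"
    using diagonalising_exists by metis
  let ?Q = "\<lambda>n \<omega>. \<Sum>i<n. (dotp n (c n i) (\<xi> n \<omega>))\<^sup>2"
  let ?T = "\<lambda>n. \<Sum>i<n. eigenvalue n (c n) i"
  have quad: "quad_inv n (toeplitz n (g_dens \<alpha>)) (\<xi> n \<omega>) = complex_of_real (?Q n \<omega>)" for n \<omega>
  proof -
    interpret diagonalised_pair n "toep (g_dens \<alpha>)" "toep (g_dens \<beta>)" "c n"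
      using c by (simp add: diagonalising_def)
    show ?thesis by (rule quad_inv_eq_sum_squares[OF toeplitz_g_dens[OF assms(2,3)] inv])
  qed
  have "AE \<omega> in M. (\<lambda>n. (?Q n \<omega> - ?T n) / real n) \<longlonglongrightarrow> 0"
    by (rule normalised_quadratic_form_deviation[OF assms(1) assms(7)[unfolded toeplitz_g_dens[OF assms(4,5)]] c])
  then show ?thesis
  proof eventually_elim
    case (elim \<omega>)
    have "(\<lambda>n. (?Q n \<omega> - ?T n) / real n + ?T n / real n) \<longlonglongrightarrow> 0 + tmean (\<lambda>t. g_dens \<beta> t / g_dens \<alpha> t)"
      by (intro tendsto_add elim trace_tendsto c)
    then have "(\<lambda>n. ?Q n \<omega> / real n) \<longlonglongrightarrow> tmean (\<lambda>t. g_dens \<beta> t / g_dens \<alpha> t)"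
      by (simp add: add_divide_distrib[symmetric])
    then have "(\<lambda>n. complex_of_real (?Q n \<omega> / real n)) \<longlonglongrightarrow> complex_of_real (tmean (\<lambda>t. g_dens \<beta> t / g_dens \<alpha> t))"
      by (rule tendsto_of_real)
    then show ?case
      by (simp add: quad tmean_def integral_torus set_lebesgue_integral_def)
  qed
qed

end
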